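(* For every integer $D>9$ with $D\equiv 0,1,4\pmod 8$ which is not a square, $$\chi(W_D(0^3))=-\frac16\sum_{\substack{-\sqrt D<e<\sqrt D\\ e^2\equiv D\ (\mathrm{mod}\ 8)}} m_D(e),$$ where the sum runs over integers $e$.
   Context: **The function $m_D$.** For an integer $m\ge1$ put $c(m)=m\prod_{p\mid m,\ p\text{ prime}}\left(1+\frac1p\right)$ (so $c(1)=1$). For an integer $e$ with $e^2<D$ and $e^2\equiv D\pmod 8$ write $\frac{D-e^2}{8}=f^2q$ with $f,q$ positive integers, $q$ square-free, and set $$m_D(e)=\sum_{\substack{r\mid f\\ \gcd(r,e)=1}}c\!\left(\frac{D-e^2}{8r^2}\right),$$ the sum being over positive divisors $r$ of $f$ (with $\gcd(r,0)=r$). **The space $W_D(0^3)$.** $\mathcal{O}_D$ denotes the real quadratic order of discriminant $D$. Consider triples $\{(X_j,x_j,\omega_j): j=0,1,2\}$ with $X_j$ an elliptic curve, $x_j\in X_j$ a marked point, $\omega_j\ne 0$ a holomorphic 1-form on $X_j$, such that there is an isomorphism $\phi:X_1\to X_2$ with $\phi(x_1)=x_2$ and $\phi^*\omega_2=-\omega_1$. Let $X=X_0\sqcup X_1\sqcup X_2$, let $\omega$ be the 1-form on $X$ given by the $\omega_j$, and let $\tau$ be the involution of $X$ equal to the elliptic involution fixing $x_0$ on $X_0$, to $\phi$ on $X_1$ and to $\phi^{-1}$ on $X_2$. Let $\Omega(X)^-$ (dimension 2) and $H_1(X,\mathbb{Z})^-\simeq\mathbb{Z}^4$ be the $\tau$-anti-invariant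 parts of the space of holomorphic 1-forms and of $H_1(X,\mathbb{Z})$; $\mathrm{Prym}(X)=(\Omega(X)^-)^*/H_1(X,\mathbb{Z})^-$ is an abelian surface polarized by the intersection form. $\Omega E_D(0^3)$ is the space of such triples for which $\mathrm{End}(\mathrm{Prym}(X))$ contains a subring $R\simeq\mathcal{O}_D$ consisting of self-adjoint endomorphisms, proper (if $f\in\mathrm{End}(\mathrm{Prym}(X))$ and $nf\in R$ for some nonzero integer $n$, then $f\in R$), and having $\omega\in\Omega(X)^-$ as an eigenform. $W_D(0^3)=\Omega E_D(0^3)/\mathbb{C}^*$, where $\mathbb{C}^*$ multiplies all three forms simultaneously. It is a finite union of finite covers of the modular curve $\mathbb{H}/\mathrm{SL}(2,\mathbb{Z})$, and $\chi$ is the orbifold Euler characteristic, normalized by $\chi(\mathbb{H}/\mathrm{SL}(2,\mathbb{Z}))=-1/6$. *)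

theory Defs
  imports
    "HOL-Analysis.Analysis"
    "HOL-Computational_Algebra.Squarefree"
    "HOL-Number_Theory.Cong"
    "HOL-Algebra.Subrings"
begin

section \<open>The function \<open>m\<^sub>D\<close>\<close>

definition c_fun :: "nat \<Rightarrow> real" where
  "c_fun m = real m * (\<Prod>p\<in>prime_factors m. 1 + 1 / real p)"

text \<open>The library's \<^const>\<open>square_part\<close> of \<open>n > 0\<close> is the \<open>f\<close> with \<open>n = f\<^sup>2 q\<close>, \<open>q\<close> squarefree.
  Both divisions are exact for the \<open>e\<close> that occur.\<close>

definition m_fun :: "int \<Rightarrow> int \<Rightarrow> real" where
  "m_fun D e = (let n = nat ((D - e\<^sup>2) div 8) in
     \<Sum>r | r dvd square_part n \<and> coprime (int r) e. c_fun (n div r\<^sup>2))"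

section \<open>Elliptic curves with a marked point and a 1-form\<close>

text \<open>Elliptic curves are complex tori \<open>\<complex>/\<Lambda>\<close>, whose points are the cosets of \<open>\<Lambda>\<close>. Every
  holomorphic 1-form on \<open>\<complex>/\<Lambda>\<close> is \<open>c dz\<close> with \<open>c\<close> constant, and is represented by \<open>c\<close>.\<close>

definition lattice_basis :: "complex set \<Rightarrow> complex \<Rightarrow> complex \<Rightarrow> bool" where
  "lattice_basis L w1 w2 \<longleftrightarrow>
     Im (cnj w1 * w2) > 0 \<and> L = {of_int m * w1 + of_int n * w2 | m n. True}"

definition is_lattice :: "complex set \<Rightarrow> bool" where
  "is_lattice L \<longleftrightarrow> (\<exists>w1 w2. lattice_basis L w1 w2)"

definition torus_point :: "complex set \<Rightarrow> complex \<Rightarrow> complex set" where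
  "torus_point L z = (\<lambda>l. z + l) ` L"

definition torus :: "complex set \<Rightarrow> complex set set" where
  "torus L = range (torus_point L)"

text \<open>\<open>F\<close> is a holomorphic lift of \<open>\<phi> : \<complex>/L \<rightarrow> \<complex>/L'\<close> to the universal covers; \<open>\<phi>\<close> is
  holomorphic iff it has one.\<close>

definition is_lift ::
  "complex set \<Rightarrow> complex set \<Rightarrow> (complex set \<Rightarrow> complex set) \<Rightarrow> (complex \<Rightarrow> complex) \<Rightarrow> bool" where
  "is_lift L L' \<phi> F \<longleftrightarrow>
     F holomorphic_on UNIV \<and> (\<forall>z. \<phi> (torus_point L z) = torus_point L' (F z))"

text \<open>Pullback of the 1-form \<open>c dz\<close>: the derivative of a lift is periodic and entire, hence constant.\<close>

definition pull :: "(complex \<Rightarrow> complex) \<Rightarrow> complex \<Rightarrow> complex" where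
  "pull F c = c * deriv F 0"

text \<open>Action on \<open>H\<^sub>1(\<complex>/\<Lambda>,\<int>) = \<Lambda>\<close>: the loop lifting to a path from \<open>0\<close> to \<open>l\<close> is mapped to the
  loop lifting to a path from \<open>F 0\<close> to \<open>F l\<close>.\<close>

definition push :: "(complex \<Rightarrow> complex) \<Rightarrow> complex \<Rightarrow> complex" where
  "push F l = F l - F 0"

text \<open>Intersection number of two classes in \<open>H\<^sub>1(\<complex>/\<Lambda>,\<int>) = \<Lambda>\<close>.\<close>

definition torus_intersection :: "complex set \<Rightarrow> complex \<Rightarrow> complex \<Rightarrow> int" where
  "torus_intersection L a b = (THE k. \<exists>w1 w2 m n m' n'. lattice_basis L w1 w2 \<and>
     a = of_int m * w1 + of_int n * w2 \<and> b = of_int m' * w1 + of_int n' * w2 \<and>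
     k = m * n' - n * m')"

record elliptic_form =
  lat :: "complex set"
  marked :: "complex set"
  form :: complex

definition elliptic_form :: "elliptic_form \<Rightarrow> bool" where
  "elliptic_form E \<longleftrightarrow> is_lattice (lat E) \<and> marked E \<in> torus (lat E) \<and> form E \<noteq> 0"

definition pointed_iso ::
  "elliptic_form \<Rightarrow> elliptic_form \<Rightarrow> (complex set \<Rightarrow> complex set) \<Rightarrow> (complex \<Rightarrow> complex) \<Rightarrow> bool" where
  "pointed_iso E E' \<phi> F \<longleftrightarrow>
     bij_betw \<phi> (torus (lat E)) (torus (lat E')) \<and> is_lift (lat E) (lat E') \<phi> F \<and>
     \<phi> (marked E) = marked E'"

section \<open>Triples and their Prym varieties\<close>

text \<open>A triple is indexed by the three-element type \<open>3\<close>, whose elements are \<open>0, 1, 2\<close>.\<close>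

type_synonym triple = "3 \<Rightarrow> elliptic_form"

text \<open>The involution \<open>\<tau>\<close> of \<open>X = X\<^sub>0 \<squnion> X\<^sub>1 \<squnion> X\<^sub>2\<close> is given by lifts \<open>\<tau> j\<close> of its restrictions
  \<open>X\<^sub>j \<rightarrow> X\<^sub>-\<^sub>j\<close>: negation in the type \<open>3\<close> fixes \<open>0\<close> and exchanges \<open>1\<close> and \<open>2\<close>. On \<open>X\<^sub>0\<close> it is
  \<open>x\<^sub>0 + z \<mapsto> x\<^sub>0 - z\<close>.\<close>

definition is_involution :: "triple \<Rightarrow> (3 \<Rightarrow> complex \<Rightarrow> complex) \<Rightarrow> bool" where
  "is_involution X \<tau> \<longleftrightarrow>
     (\<exists>p\<in>marked (X 0). \<tau> 0 = (\<lambda>z. 2 * p - z)) \<and>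
     (\<exists>\<phi>. pointed_iso (X 1) (X 2) \<phi> (\<tau> 1) \<and>
          pull (\<tau> 1) (form (X 2)) = - form (X 1) \<and>
          is_lift (lat (X 2)) (lat (X 1)) (inv_into (torus (lat (X 1))) \<phi>) (\<tau> 2))"

definition forms_minus :: "(3 \<Rightarrow> complex \<Rightarrow> complex) \<Rightarrow> (complex ^ 3) set" where
  "forms_minus \<tau> = {c. (\<chi> j. pull (\<tau> j) (c $ (- j))) = - c}"

definition H1_minus :: "triple \<Rightarrow> (3 \<Rightarrow> complex \<Rightarrow> complex) \<Rightarrow> (complex ^ 3) set" where
  "H1_minus X \<tau> = {l. (\<forall>j. l $ j \<in> lat (X j)) \<and> (\<chi> j. push (\<tau> (- j)) (l $ (- j))) = - l}"

definition intersection :: "triple \<Rightarrow> complex ^ 3 \<Rightarrow> complex ^ 3 \<Rightarrow> int" where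
  "intersection X a b = (\<Sum>j\<in>UNIV. torus_intersection (lat (X j)) (a $ j) (b $ j))"

text \<open>The dual space of \<open>\<Omega>(X)\<^sup>-\<close>, and in it the functional of integration along a homology class.\<close>

definition dual_forms :: "(3 \<Rightarrow> complex \<Rightarrow> complex) \<Rightarrow> (complex ^ 3 \<Rightarrow> complex) set" where
  "dual_forms \<tau> = {f \<in> extensional (forms_minus \<tau>).
     \<forall>a b. \<forall>c\<in>forms_minus \<tau>. \<forall>d\<in>forms_minus \<tau>. f (a *s c + b *s d) = a * f c + b * f d}"

definition integration ::
  "(3 \<Rightarrow> complex \<Rightarrow> complex) \<Rightarrow> complex ^ 3 \<Rightarrow> complex ^ 3 \<Rightarrow> complex" where
  "integration \<tau> l = (\<lambda>c\<in>forms_minus \<tau>. \<Sum>j\<in>UNIV. c $ j * l $ j)"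

text \<open>Endomorphisms of \<open>Prym(X) = (\<Omega>(X)\<^sup>-)\<^sup>* / H\<^sub>1(X,\<int>)\<^sup>-\<close>: the complex-linear
  endomorphisms of the dual space that preserve the lattice.\<close>

definition prym_End :: "triple \<Rightarrow> (3 \<Rightarrow> complex \<Rightarrow> complex) \<Rightarrow>
    ((complex ^ 3 \<Rightarrow> complex) \<Rightarrow> (complex ^ 3 \<Rightarrow> complex)) ring" where
  "prym_End X \<tau> = \<lparr>
     carrier = {T \<in> dual_forms \<tau> \<rightarrow>\<^sub>E dual_forms \<tau>.
       (\<forall>a b. \<forall>f\<in>dual_forms \<tau>. \<forall>g\<in>dual_forms \<tau>.
          T (\<lambda>c\<in>forms_minus \<tau>. a * f c + b * g c) = (\<lambda>c\<in>forms_minus \<tau>. a * T f c + b * T g c)) \<and>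
       T ` integration \<tau> ` H1_minus X \<tau> \<subseteq> integration \<tau> ` H1_minus X \<tau>},
     monoid.mult = (\<lambda>T U. compose (dual_forms \<tau>) T U),
     one = (\<lambda>f\<in>dual_forms \<tau>. f),
     zero = (\<lambda>f\<in>dual_forms \<tau>. \<lambda>c\<in>forms_minus \<tau>. 0),
     add = (\<lambda>T U. \<lambda>f\<in>dual_forms \<tau>. \<lambda>c\<in>forms_minus \<tau>. T f c + U f c)\<rparr>"

definition self_adjoint :: "triple \<Rightarrow> (3 \<Rightarrow> complex \<Rightarrow> complex) \<Rightarrow>
    ((complex ^ 3 \<Rightarrow> complex) \<Rightarrow> (complex ^ 3 \<Rightarrow> complex)) \<Rightarrow> bool" where
  "self_adjoint X \<tau> T \<longleftrightarrow>
     (\<forall>a\<in>H1_minus X \<tau>. \<forall>b\<in>H1_minus X \<tau>. \<forall>a'\<in>H1_minus X \<tau>. \<forall>b'\<in>H1_minus X \<tau>.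
        T (integration \<tau> a) = integration \<tau> a' \<longrightarrow> T (integration \<tau> b) = integration \<tau> b' \<longrightarrow>
        intersection X a' b = intersection X a b')"

text \<open>\<open>\<omega>\<close> is an eigenvector of the transpose of \<open>T\<close>, acting on \<open>\<Omega>(X)\<^sup>-\<close>.\<close>

definition eigenform :: "(3 \<Rightarrow> complex \<Rightarrow> complex) \<Rightarrow>
    ((complex ^ 3 \<Rightarrow> complex) \<Rightarrow> (complex ^ 3 \<Rightarrow> complex)) \<Rightarrow> complex ^ 3 \<Rightarrow> bool" where
  "eigenform \<tau> T \<omega> \<longleftrightarrow> (\<exists>\<mu>. \<forall>f\<in>dual_forms \<tau>. T f \<omega> = \<mu> * f \<omega>)"

definition quadratic_order :: "int \<Rightarrow> real ring" where
  "quadratic_order D = \<lparr>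
     carrier = {of_int a + of_int b * ((of_int D + sqrt (of_int D)) / 2) | a b. True},
     monoid.mult = (*), one = 1, zero = 0, add = (+)\<rparr>"

definition real_mult :: "int \<Rightarrow> triple \<Rightarrow> (3 \<Rightarrow> complex \<Rightarrow> complex) \<Rightarrow>
    ((complex ^ 3 \<Rightarrow> complex) \<Rightarrow> (complex ^ 3 \<Rightarrow> complex)) set \<Rightarrow> bool" where
  "real_mult D X \<tau> R \<longleftrightarrow>
     subring R (prym_End X \<tau>) \<and>
     (prym_End X \<tau>)\<lparr>carrier := R\<rparr> \<simeq> quadratic_order D \<and>
     (\<forall>T\<in>R. self_adjoint X \<tau> T) \<and>
     (\<forall>T\<in>carrier (prym_End X \<tau>). \<forall>n::int. n \<noteq> 0 \<longrightarrow> add_pow (prym_End X \<tau>) n T \<in> R \<longrightarrow> T \<in> R)"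

definition eigenform_triples :: "int \<Rightarrow> triple set" where
  "eigenform_triples D = {X. (\<forall>j. elliptic_form (X j)) \<and>
     (\<exists>\<tau>. is_involution X \<tau> \<and> (\<chi> j. form (X j)) \<in> forms_minus \<tau> \<and>
        (\<exists>R. real_mult D X \<tau> R \<and> (\<forall>T\<in>R. eigenform \<tau> T (\<chi> j. form (X j)))))}"

section \<open>The orbifold \<open>W\<^sub>D(0\<^sup>3)\<close>\<close>

definition triple_iso :: "triple \<Rightarrow> triple \<Rightarrow> bool" where
  "triple_iso X Y \<longleftrightarrow>
     (\<forall>j. \<exists>\<phi> F. pointed_iso (X j) (Y j) \<phi> F \<and> pull F (form (Y j)) = form (X j))"

definition scale :: "complex \<Rightarrow> triple \<Rightarrow> triple" where
  "scale k X = (\<lambda>j. (X j)\<lparr>form := k * form (X j)\<rparr>)"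

definition W_rel :: "int \<Rightarrow> (triple \<times> triple) set" where
  "W_rel D = {(X, Y). X \<in> eigenform_triples D \<and> Y \<in> eigenform_triples D \<and>
     (\<exists>k. k \<noteq> 0 \<and> triple_iso (scale k X) Y)}"

definition W :: "int \<Rightarrow> triple set set" where
  "W D = eigenform_triples D // W_rel D"

text \<open>Period coordinates: the periods of \<open>\<omega>\<close> over symplectic bases of \<open>H\<^sub>1(X\<^sub>0,\<int>)\<close> and
  \<open>H\<^sub>1(X\<^sub>1,\<int>)\<close>. They determine the triple up to isomorphism, since \<open>(X\<^sub>2, x\<^sub>2, \<omega>\<^sub>2)\<close> is isomorphic
  to \<open>(X\<^sub>1, x\<^sub>1, -\<omega>\<^sub>1)\<close>. The topology on \<open>W\<^sub>D(0\<^sup>3)\<close> is the quotient topology from the space of all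
  period coordinates of points of \<open>\<Omega>E\<^sub>D(0\<^sup>3)\<close>.\<close>

definition periods :: "triple \<Rightarrow> (complex \<times> complex \<times> complex \<times> complex) set" where
  "periods X = {(form (X 0) * a, form (X 0) * b, form (X 1) * u, form (X 1) * v) | a b u v.
     lattice_basis (lat (X 0)) a b \<and> lattice_basis (lat (X 1)) u v}"

definition period_space :: "int \<Rightarrow> (complex \<times> complex \<times> complex \<times> complex) set" where
  "period_space D = (\<Union>X\<in>eigenform_triples D. periods X)"

definition W_point :: "int \<Rightarrow> complex \<times> complex \<times> complex \<times> complex \<Rightarrow> triple set" where
  "W_point D p = (THE w. w \<in> W D \<and> (\<exists>X\<in>w. p \<in> periods X))"

definition W_top :: "int \<Rightarrow> triple set topology" where
  "W_top D = topology (\<lambda>U. U \<subseteq> W D \<and>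
     openin (top_of_set (period_space D)) {p \<in> period_space D. W_point D p \<in> U})"

lemma openin_W_top:
  "openin (W_top D) U \<longleftrightarrow> U \<subseteq> W D \<and>
     openin (top_of_set (period_space D)) {p \<in> period_space D. W_point D p \<in> U}"
proof -
  let ?P = "\<lambda>U. {p \<in> period_space D. W_point D p \<in> U}"
  have "istopology (\<lambda>U. U \<subseteq> W D \<and> openin (top_of_set (period_space D)) (?P U))"
    unfolding istopology_def
  proof (intro conjI allI impI)
    fix S T assume "S \<subseteq> W D \<and> openin (top_of_set (period_space D)) (?P S)"
      and "T \<subseteq> W D \<and> openin (top_of_set (period_space D)) (?P T)"
    moreover have "?P (S \<inter> T) = ?P S \<inter> ?P T" by auto
    ultimately show "S \<inter> T \<subseteq> W D" "openin (top_of_set (period_space D)) (?P (S \<inter> T))"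
      by auto
  next
    fix \<K> assume *: "\<forall>K\<in>\<K>. K \<subseteq> W D \<and> openin (top_of_set (period_space D)) (?P K)"
    show "\<Union>\<K> \<subseteq> W D" using * by auto
    have "?P (\<Union>\<K>) = \<Union>(?P ` \<K>)" by auto
    thus "openin (top_of_set (period_space D)) (?P (\<Union>\<K>))" using * by auto
  qed
  thus ?thesis unfolding W_top_def by (simp add: topology_inverse')
qed

text \<open>Order of the isotropy group. An isomorphism \<open>k X \<cong> X\<close> is determined by \<open>k\<close>, and
  \<open>k = \<plusminus>1\<close> always occurs. As for \<open>\<HH>/SL(2,\<int>)\<close>, where \<open>-1\<close> acts trivially, this generic
  stabilizer is divided out; it is the convention for which \<open>\<HH>/SL(2,\<int>)\<close> has orbifold Euler
  characteristic \<open>-1/6\<close> (and not \<open>-1/12\<close>).\<close>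

definition isotropy_order :: "triple set \<Rightarrow> nat" where
  "isotropy_order w = card {k. k \<noteq> 0 \<and> (\<exists>X\<in>w. triple_iso (scale k X) X)} div 2"

text \<open>\<open>x = \<Sum>\<^sub>C (-1)\<^bsup>dim C\<^esup> / n\<^sub>C\<close> for a finite decomposition of an orbifold, with underlying space \<open>T\<close>
  and isotropy orders \<open>ord\<close>, into open cells \<open>C\<close> on which the isotropy order is the constant \<open>n\<^sub>C\<close>.
  The frontier of a cell lies in the union of the cells of lower dimension. Cells need not be
  relatively compact (they may run into a cusp), so this is the compactly supported version, which
  agrees with the usual one for orbifolds of even dimension such as complex curves. By additivity
  of the compactly supported Euler characteristic \<open>x\<close> does not depend on the decomposition. Example:
  the usual fundamental domain decomposes \<open>\<HH>/SL(2,\<int>)\<close> into the points \<open>i\<close> and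
  \<open>exp(2\<pi>i/3)\<close>, two open edges and one open face, whence \<open>1/2 + 1/3 - 2 + 1 = -1/6\<close>.\<close>

definition has_orbifold_euler_char :: "'a topology \<Rightarrow> ('a \<Rightarrow> nat) \<Rightarrow> real \<Rightarrow> bool" where
  "has_orbifold_euler_char T ord x \<longleftrightarrow>
     (\<exists>\<C> d n. finite \<C> \<and> disjoint \<C> \<and> \<Union>\<C> = topspace T \<and>
       (\<forall>C\<in>\<C>. subtopology T C homeomorphic_space Euclidean_space (d C) \<and>
          T closure_of C - C \<subseteq> \<Union>{C'\<in>\<C>. d C' < d C} \<and>
          n C > 0 \<and> (\<forall>y\<in>C. ord y = n C)) \<and>
       x = (\<Sum>C\<in>\<C>. (- 1) ^ d C / real (n C)))"

end

theory Submission
  imports Defs "HOL-Complex_Analysis.Cauchy_Integral_Formula" "HOL-Number_Theory.Totient"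
begin

text \<open>For a triple write \<open>\<Lambda>\<^sub>j\<close> for the lattice of periods of \<open>\<omega>\<^sub>j\<close>. Holomorphic maps between complex tori
lift to affine maps (\<open>lift_affine\<close>, by Liouville), so a triple is determined up to isomorphism by
\<open>\<Lambda>\<^sub>0, \<Lambda>\<^sub>1, \<Lambda>\<^sub>2\<close> (\<open>triple_iso_iff\<close>), and the existence of the involution means \<open>\<Lambda>\<^sub>2 = \<Lambda>\<^sub>1\<close>. The space
\<open>W\<^sub>D(0\<^sup>3)\<close> is therefore a space of pairs \<open>(\<Lambda>\<^sub>0, \<Lambda>\<^sub>1)\<close> up to a common complex factor.

In suitable coordinates the Prym variety is \<open>\<complex>\<^sup>2 / (\<Lambda>\<^sub>0 \<times> \<Lambda>\<^sub>1)\<close>, polarized by the sum of the intersection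
form of \<open>\<Lambda>\<^sub>0\<close> and twice that of \<open>\<Lambda>\<^sub>1\<close>, and \<open>\<omega>\<close> is the functional \<open>(x, y) \<mapsto> x + 2 y\<close>
(\<open>real_mult_iff_matrices\<close>). Real multiplication is thus given by a \<open>2 \<times> 2\<close> matrix \<open>A\<close> that
preserves \<open>\<Lambda>\<^sub>0 \<times> \<Lambda>\<^sub>1\<close> and satisfies the equation of the generator \<open>(D + \<surd>D) / 2\<close> of \<open>\<O>\<^sub>D\<close>. It is
self-adjoint with eigenform \<open>\<omega>\<close>; hence its entries are real, the diagonal entries are integers
\<open>P, S\<close> with \<open>P + S = D\<close>, and with \<open>e = \<plusminus>(P - S)\<close> the lower left entry is \<open>\<plusminus>c\<close>, where
\<open>c = (\<surd>D - e) / 4\<close>. So \<open>c \<Lambda>\<^sub>0\<close> is a sublattice of \<open>\<Lambda>\<^sub>1\<close>; its index is \<open>(D - e\<^sup>2) / 8\<close>, and the ring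
generated by \<open>A\<close> is proper if and only if the content of the sublattice (the largest \<open>k\<close> with
\<open>c \<Lambda>\<^sub>0 \<subseteq> k \<Lambda>\<^sub>1\<close>) is prime to \<open>e\<close> (\<open>real_mult_matrices_imp_lattices\<close>,
\<open>real_mult_lattices_imp_matrices\<close>). Since \<open>\<surd>D\<close> is irrational, \<open>e\<close> is determined by the two lattices
(\<open>multiplier_unique\<close>).

Normalizing \<open>\<Lambda>\<^sub>1 = \<int> + \<int>\<tau>\<close>, one finds that \<open>W\<^sub>D(0\<^sup>3)\<close> is the quotient of \<open>\<S> \<times> \<HH>\<close> by \<open>SL(2,\<int>)\<close>, as a set
(\<open>W_eq\<close>, \<open>level_point_eq_iff\<close>), with its isotropy orders (\<open>isotropy_order_level_point\<close>) and with its
topology (\<open>openin_W_top_iff\<close>). Here \<open>\<S>\<close> is the finite set of pairs \<open>(e, K)\<close> with \<open>e\<^sup>2 < D\<close>,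
\<open>e\<^sup>2 \<equiv> D (mod 8)\<close> and \<open>K \<subseteq> \<int>\<^sup>2\<close> a sublattice of index \<open>(D - e\<^sup>2) / 8\<close> and content prime to \<open>e\<close>.

The orbifold Euler characteristic of such a quotient is \<open>-\<bar>\<S>\<bar>/6\<close> (\<open>orbifold_euler_char\<close>): the
standard fundamental domain is cut into a face, two edges and the points \<open>i\<close> and \<open>exp(\<pi>i/3)\<close>, and by
the orbit-stabilizer theorem the cells above each of these pieces contribute \<open>\<bar>\<S>\<bar>\<close> times what the
piece contributes to \<open>\<HH>/SL(2,\<int>)\<close>. Finally \<open>\<bar>\<S>\<bar> = \<Sum>\<^sub>e m\<^sub>D(e)\<close> (\<open>card_level_data\<close>): sublattices of index
\<open>n\<close> and content \<open>r\<close> correspond to primitive sublattices of index \<open>n / r\<^sup>2\<close>, and counting Hermite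
normal forms shows that their number is the summand \<open>c(n / r\<^sup>2)\<close> of \<open>m\<^sub>D(e)\<close>, with the function \<open>c\<close> from the definition of \<open>m\<^sub>D\<close>.\<close>

section \<open>The modular group and the upper half plane\<close>

datatype mat2 = Mat (m11: int) (m12: int) (m21: int) (m22: int)

definition SL2 :: "mat2 set" where
  "SL2 = {g. m11 g * m22 g - m12 g * m21 g = 1}"

fun mmul :: "mat2 \<Rightarrow> mat2 \<Rightarrow> mat2" where
  "mmul (Mat a b c d) (Mat a' b' c' d') =
     (Mat (a * a' + b * c') (a * b' + b * d') (c * a' + d * c') (c * b' + d * d'))"

fun minv :: "mat2 \<Rightarrow> mat2" where
  "minv (Mat a b c d) = Mat d (- b) (- c) a"

fun mneg :: "mat2 \<Rightarrow> mat2" where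
  "mneg (Mat a b c d) = Mat (- a) (- b) (- c) (- d)"

fun mob :: "mat2 \<Rightarrow> complex \<Rightarrow> complex" where
  "mob (Mat a b c d) z = (of_int a * z + of_int b) / (of_int c * z + of_int d)"

definition uhp :: "complex set" where
  "uhp = {z. Im z > 0}"

lemma open_uhp: "open uhp"
  by (simp add: uhp_def open_halfspace_Im_gt)

lemma mem_SL2 [simp]: "Mat a b c d \<in> SL2 \<longleftrightarrow> a * d - b * c = 1"
  by (simp add: SL2_def)

lemma mmul_assoc: "mmul (mmul g h) k = mmul g (mmul h k)"
  by (cases g; cases h; cases k) (simp add: algebra_simps)

lemma mmul_SL2: "g \<in> SL2 \<Longrightarrow> h \<in> SL2 \<Longrightarrow> mmul g h \<in> SL2"
proof (cases g; cases h)
  fix a b c d a' b' c' d'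
  assume *: "g \<in> SL2" "h \<in> SL2" "g = Mat a b c d" "h = Mat a' b' c' d'"
  have "(a * a' + b * c') * (c * b' + d * d') - (a * b' + b * d') * (c * a' + d * c')
      = (a * d - b * c) * (a' * d' - b' * c')" by (simp add: algebra_simps)
  then show ?thesis using * by simp
qed

lemma minv_SL2: "g \<in> SL2 \<Longrightarrow> minv g \<in> SL2"
  by (cases g) (simp add: mult.commute)

lemma mmul_minv: "g \<in> SL2 \<Longrightarrow> mmul g (minv g) = Mat 1 0 0 1"
  and minv_mmul: "g \<in> SL2 \<Longrightarrow> mmul (minv g) g = Mat 1 0 0 1"
  by (cases g; simp add: algebra_simps)+

lemma mmul_one: "mmul (Mat 1 0 0 1) g = g" and mmul_one_right: "mmul g (Mat 1 0 0 1) = g"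
  by (cases g; simp)+

lemma denominator_nonzero:
  assumes "Mat a b c d \<in> SL2" "z \<in> uhp"
  shows "of_int c * z + of_int d \<noteq> 0"
proof
  assume *: "of_int c * z + of_int d = 0"
  then have "Im (of_int c * z + of_int d) = 0" by simp
  then have "c = 0" using assms by (simp add: uhp_def)
  moreover from this * have "d = 0" by simp
  ultimately show False using assms by simp
qed

lemma mob_uhp:
  assumes "g \<in> SL2" "z \<in> uhp"
  shows "mob g z \<in> uhp"
proof -
  obtain a b c d where g: "g = Mat a b c d" by (cases g)
  define w where "w = of_int c * z + of_int d"
  have w: "w \<noteq> 0" using denominator_nonzero[of a b c d z] assms g w_def by simp
  have "mob g z = (of_int a * z + of_int b) * cnj w / (w * cnj w)"
    using w by (simp add: g flip: w_def)
  also have "w * cnj w = of_real ((cmod w)\<^sup>2)" by (simp only: complex_norm_square)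
  finally have "Im (mob g z) = Im ((of_int a * z + of_int b) * cnj w) / (cmod w)\<^sup>2"
    by simp
  also have "Im ((of_int a * z + of_int b) * cnj w) = of_int (a * d - b * c) * Im z"
    by (simp add: w_def algebra_simps)
  also have "of_int (a * d - b * c) = (1 :: real)" using assms by (simp add: g)
  finally show ?thesis using assms w by (simp add: uhp_def)
qed

lemma mob_mmul:
  assumes "g \<in> SL2" "h \<in> SL2" "z \<in> uhp"
  shows "mob (mmul g h) z = mob g (mob h z)"
proof -
  obtain a b c d a' b' c' d' where g: "g = Mat a b c d" and h: "h = Mat a' b' c' d'"
    by (cases g, cases h)
  let ?w = "of_int c' * z + of_int d'"
  have w: "?w \<noteq> 0" using denominator_nonzero assms h by blast
  have "mob g (mob h z) = (of_int a * ((of_int a' * z + of_int b') / ?w) + of_int b) /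
     (of_int c * ((of_int a' * z + of_int b') / ?w) + of_int d)" by (simp add: g h)
  also have "\<dots> = (of_int a * (of_int a' * z + of_int b') + of_int b * ?w) /
     (of_int c * (of_int a' * z + of_int b') + of_int d * ?w)"
    using w by (simp add: divide_simps)
  also have "\<dots> = mob (mmul g h) z" by (simp add: g h algebra_simps)
  finally show ?thesis ..
qed

lemma mob_one: "mob (Mat 1 0 0 1) z = z"
  by simp

lemma mob_mneg: "mob (mneg g) z = mob g z"
proof -
  obtain a b c d where g: "g = Mat a b c d" by (cases g)
  have "mob (mneg g) z = (- (of_int a * z + of_int b)) / (- (of_int c * z + of_int d))"
    by (simp add: g)
  also have "\<dots> = mob g z" by (simp only: minus_divide_divide g mob.simps)
  finally show ?thesis .
qed

lemma mob_minv:
  assumes "g \<in> SL2" "z \<in> uhp" "mob g z = w"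
  shows "mob (minv g) w = z"
  using assms mob_mmul[of "minv g" g z] minv_mmul[of g] minv_SL2 mob_one by metis

lemma open_mob_vimage:
  assumes "g \<in> SL2" "open V"
  shows "open {z \<in> uhp. mob g z \<in> V}"
proof -
  obtain a b c d where g: "g = Mat a b c d" by (cases g)
  have "continuous_on uhp (mob g)"
    unfolding g mob.simps using denominator_nonzero assms g
    by (intro continuous_intros) auto
  then have "open (uhp \<inter> mob g -` V)"
    using assms open_uhp by (simp add: continuous_open_preimage)
  moreover have "uhp \<inter> mob g -` V = {z \<in> uhp. mob g z \<in> V}" by auto
  ultimately show ?thesis by simp
qed

section \<open>The fundamental domain of the modular group\<close>

definition fundamental_domain :: "complex set" where
  "fundamental_domain = {z \<in> uhp. - 1 / 2 < Re z \<and> Re z \<le> 1 / 2 \<and>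
     1 \<le> (Re z)\<^sup>2 + (Im z)\<^sup>2 \<and> ((Re z)\<^sup>2 + (Im z)\<^sup>2 = 1 \<longrightarrow> 0 \<le> Re z)}"

text \<open>The sixth root of unity \<open>exp(\<pi>i/3)\<close>, the corner of the domain that belongs to it.\<close>

definition rho :: complex where
  "rho = Complex (1 / 2) (sqrt 3 / 2)"

text \<open>The numbers \<open>c z + d\<close> form a lattice, so only finitely many of them lie in the unit disc. This is
what makes the maximum of \<open>Im (g z) = Im z / \<bar>c z + d\<bar>\<^sup>2\<close> over the orbit exist.\<close>

lemma finite_small_denominators:
  assumes "z \<in> uhp"
  shows "finite {(c, d). (of_int c * Re z + of_int d)\<^sup>2 + (of_int c * Im z)\<^sup>2 \<le> 1}" (is "finite ?A")
proof -
  define k :: int where "k = \<lceil>1 / Im z + 1 + \<bar>Re z\<bar> / Im z\<rceil>"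
  have y: "Im z > 0" using assms by (simp add: uhp_def)
  have "?A \<subseteq> {- k..k} \<times> {- k..k}"
  proof clarify
    fix c d :: int
    assume *: "(of_int c * Re z + of_int d)\<^sup>2 + (of_int c * Im z)\<^sup>2 \<le> 1"
    have "(of_int c * Im z)\<^sup>2 \<le> 1" "(of_int c * Re z + of_int d)\<^sup>2 \<le> 1"
      using * zero_le_power2[of "of_int c * Re z + of_int d"] zero_le_power2[of "of_int c * Im z"]
      by linarith+
    then have 1: "\<bar>of_int c * Im z\<bar> \<le> 1" and 2: "\<bar>of_int c * Re z + of_int d\<bar> \<le> 1"
      using abs_le_square_iff[of "of_int c * Im z" 1]
        abs_le_square_iff[of "of_int c * Re z + of_int d" 1] by auto
    from 1 have c: "\<bar>of_int c\<bar> \<le> 1 / Im z" using y by (simp add: abs_mult field_simps)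
    have "\<bar>of_int c * Re z\<bar> \<le> 1 / Im z * \<bar>Re z\<bar>"
      unfolding abs_mult using c by (intro mult_right_mono) auto
    then have d: "\<bar>of_int d\<bar> \<le> 1 + \<bar>Re z\<bar> / Im z" using 2 by simp
    have "0 \<le> 1 / Im z" "0 \<le> \<bar>Re z\<bar> / Im z" using y by auto
    then have "\<bar>of_int c\<bar> \<le> (of_int k :: real)" "\<bar>of_int d\<bar> \<le> (of_int k :: real)"
      using c d unfolding k_def by linarith+
    then show "c \<in> {- k..k} \<and> d \<in> {- k..k}" by (auto simp: abs_le_iff)
  qed
  then show ?thesis by (rule finite_subset) auto
qed

lemma norm_mob_S: "z \<in> uhp \<Longrightarrow> mob (Mat 0 (-1) 1 0) z = Complex (- Re z / ((Re z)\<^sup>2 + (Im z)\<^sup>2)) (Im z / ((Re z)\<^sup>2 + (Im z)\<^sup>2))"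
  by (simp add: complex_eq_iff Re_divide Im_divide)

lemma mob_translation: "mob (Mat 1 n 0 1) z = z + of_int n"
  by simp

text \<open>A point of maximal imaginary part in the orbit has absolute value at least \<open>1\<close> after every
translation, because inversion would otherwise raise it further; a translation puts it into the
strip, and on the unit circle an inversion corrects the sign of the real part.\<close>

lemma reduction_to_fundamental_domain:
  assumes z: "z \<in> uhp"
  obtains g where "g \<in> SL2" "mob g z \<in> fundamental_domain"
proof -
  \<comment> \<open>\<open>N g = \<bar>c z + d\<bar>\<^sup>2\<close>, so minimizing \<open>N\<close> maximizes \<open>Im (g z) = Im z / N g\<close>.\<close>
  define N :: "mat2 \<Rightarrow> real" where "N = (\<lambda>g. (of_int (m21 g) * Re z + of_int (m22 g))\<^sup>2 + (of_int (m21 g) * Im z)\<^sup>2)"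
  define B where "B = {(c, d). (of_int c * Re z + of_int d)\<^sup>2 + (of_int c * Im z)\<^sup>2 \<le> 1}"
  define P where "P = (\<lambda>g. (m21 g, m22 g)) ` {g \<in> SL2. N g \<le> 1}"
  have "P \<subseteq> B" unfolding P_def B_def N_def by auto
  then have fin: "finite P" using finite_small_denominators[OF z] B_def finite_subset by auto
  define NN :: "int \<times> int \<Rightarrow> real" where "NN = (\<lambda>(c, d). (of_int c * Re z + of_int d)\<^sup>2 + (of_int c * Im z)\<^sup>2)"
  have one: "Mat 1 0 0 1 \<in> {g \<in> SL2. N g \<le> 1}" by (auto simp: N_def)
  then have "P \<noteq> {}" unfolding P_def by blast
  define q where "q = arg_min_on NN P"
  have q: "q \<in> P" "\<And>p. p \<in> P \<Longrightarrow> NN q \<le> NN p"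
    using arg_min_if_finite[OF fin \<open>P \<noteq> {}\<close>, of NN] by (force simp: q_def not_less)+
  have NNN: "N (Mat a b c d) = NN (c, d)" for a b c d by (simp add: N_def NN_def)
  obtain g where g: "g \<in> SL2" "N g \<le> 1" "N g = NN q"
  proof -
    obtain g where g: "g \<in> SL2" "N g \<le> 1" "q = (m21 g, m22 g)"
      using q(1) unfolding P_def by blast
    obtain a b c d where "g = Mat a b c d" by (cases g)
    then have "N g = NN q" using g(3) NNN by simp
    then show thesis using that g by blast
  qed
  have min: "N g \<le> N h" if "h \<in> SL2" for h
  proof (cases "N h \<le> 1")
    case True
    obtain a b c d where h: "h = Mat a b c d" by (cases h)
    have "(m21 h, m22 h) \<in> P" unfolding P_def using that True by blast
    then have "NN q \<le> NN (c, d)" using q(2) h by simp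
    then show ?thesis using g(3) h NNN by simp
  qed (use g in auto)
  have Npos: "N h > 0" if "h \<in> SL2" for h
  proof -
    obtain a b c d where h: "h = Mat a b c d" by (cases h)
    have "of_int c * z + of_int d \<noteq> 0" using denominator_nonzero z that h by blast
    then have "(cmod (of_int c * z + of_int d))\<^sup>2 > 0" by simp
    then show ?thesis by (simp add: h N_def cmod_power2)
  qed
  \<comment> \<open>The translation by \<open>n\<close> moves the real part into the interval \<open>(-1/2, 1/2]\<close> and leaves \<open>N\<close> unchanged.\<close>
  define n where "n = - \<lceil>Re (mob g z) - 1 / 2\<rceil>"
  define g2 where "g2 = mmul (Mat 1 n 0 1) g"
  have g2: "g2 \<in> SL2" unfolding g2_def using g by (intro mmul_SL2) auto
  have z2: "mob g2 z = mob g z + of_int n"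
    unfolding g2_def using g z by (subst mob_mmul) auto
  have N2: "N g2 = N g" by (cases g) (simp add: g2_def N_def)
  define w where "w = mob g2 z"
  have wU: "w \<in> uhp" unfolding w_def using g2 z mob_uhp by blast
  have wRe: "- 1 / 2 < Re w" "Re w \<le> 1 / 2" unfolding w_def z2 n_def by simp_all linarith+
  let ?S = "Mat 0 (-1) 1 0"
  have S: "?S \<in> SL2" by simp
  \<comment> \<open>Inversion multiplies \<open>N\<close> by \<open>\<bar>w\<bar>\<^sup>2\<close>, so minimality gives \<open>\<bar>w\<bar> \<ge> 1\<close>.\<close>
  have NS: "N (mmul ?S g2) = N g2 * ((Re w)\<^sup>2 + (Im w)\<^sup>2)"
  proof -
    obtain a b c d where h: "g2 = Mat a b c d" by (cases g2)
    have "N (mmul ?S g2) = (cmod (of_int a * z + of_int b))\<^sup>2"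
      by (simp add: h N_def cmod_power2)
    also have "of_int a * z + of_int b = w * (of_int c * z + of_int d)"
      unfolding w_def h using denominator_nonzero[of a b c d z] g2 h z by simp
    also have "(cmod \<dots>)\<^sup>2 = ((Re w)\<^sup>2 + (Im w)\<^sup>2) * N g2"
      by (simp add: h N_def norm_mult power_mult_distrib cmod_power2)
    finally show ?thesis by simp
  qed
  have w1: "1 \<le> (Re w)\<^sup>2 + (Im w)\<^sup>2"
    using min[of "mmul ?S g2"] NS N2 Npos[OF g(1)] mmul_SL2[OF S g2] by simp
  show thesis
  proof (cases "(Re w)\<^sup>2 + (Im w)\<^sup>2 = 1 \<and> Re w < 0")
    case True
    have "mob (mmul ?S g2) z = mob ?S w" unfolding w_def using g2 z S mob_mmul by blast
    also have "\<dots> = Complex (- Re w) (Im w)"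
      using norm_mob_S[OF wU] True by simp
    finally have "mob (mmul ?S g2) z \<in> fundamental_domain"
      using True wRe wU by (simp add: fundamental_domain_def uhp_def)
    then show ?thesis using that mmul_SL2[OF S g2] by blast
  next
    case False
    then have "w \<in> fundamental_domain"
      using wRe wU w1 by (auto simp: fundamental_domain_def)
    then show ?thesis using that g2 w_def by blast
  qed
qed

lemma rho_squares: "(Re rho)\<^sup>2 = 1 / 4" "(Im rho)\<^sup>2 = 3 / 4" "Im rho > 0" "Re rho = 1 / 2"
  by (simp_all add: rho_def power_divide)

lemma eq_rho: "Re z = 1 / 2 \<Longrightarrow> (Im z)\<^sup>2 = 3 / 4 \<Longrightarrow> Im z > 0 \<Longrightarrow> z = rho"
  using rho_squares by (metis complex_eq_iff order_less_imp_le power2_eq_imp_eq)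

text \<open>If \<open>w = g z\<close> does not lie below \<open>z\<close>, then \<open>\<bar>c z + d\<bar> \<le> 1\<close>. For \<open>z\<close> in the fundamental domain this
leaves only \<open>c = 0\<close> and a few pairs with \<open>c = \<plusminus>1\<close>, each of which puts \<open>z\<close> on the boundary arc and,
because only half of the boundary belongs to the domain, at \<open>i\<close> or at the corner.\<close>

lemma fundamental_domain_unique_aux:
  assumes z: "z \<in> fundamental_domain" and w: "w \<in> fundamental_domain"
    and g: "Mat a b c d \<in> SL2" and eq: "mob (Mat a b c d) z = w" and le: "Im z \<le> Im w"
  shows "w = z \<and> (c = 0 \<or> z = \<i> \<or> z = rho)"
proof -
  have core: "w = z \<and> (z = \<i> \<or> z = rho)"
    if g: "Mat a b c d \<in> SL2" and eq: "mob (Mat a b c d) z = w" and c: "c > 0" for a b c d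
  proof -
    define x y where "x = Re z" and "y = Im z"
    have y: "y > 0" and x: "- 1 / 2 < x" "x \<le> 1 / 2" "1 \<le> x\<^sup>2 + y\<^sup>2" "x\<^sup>2 + y\<^sup>2 = 1 \<longrightarrow> 0 \<le> x"
      using z by (auto simp: fundamental_domain_def x_def y_def uhp_def)
    have zU: "z \<in> uhp" using z by (simp add: fundamental_domain_def)
    have wy: "Im w > 0" and wx: "- 1 / 2 < Re w" "Re w \<le> 1 / 2"
      and w1: "1 \<le> (Re w)\<^sup>2 + (Im w)\<^sup>2" "(Re w)\<^sup>2 + (Im w)\<^sup>2 = 1 \<longrightarrow> 0 \<le> Re w"
      using w by (auto simp: fundamental_domain_def uhp_def)
    have "w * (of_int c * z + of_int d) = of_int a * z + of_int b"
      using eq denominator_nonzero[OF g zU] by (auto simp: field_simps)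
    then have re: "Re w * (c * x + d) - Im w * (c * y) = a * x + b"
      and im: "Re w * (c * y) + Im w * (c * x + d) = a * y"
      by (simp_all add: complex_eq_iff x_def y_def)
    have det: "real_of_int a * d - real_of_int b * c = 1"
      using g by (simp flip: of_int_mult of_int_diff)
    have "Im w * ((c * x + d)\<^sup>2 + (c * y)\<^sup>2)
        = (Re w * (c * y) + Im w * (c * x + d)) * (c * x + d)
          - (Re w * (c * x + d) - Im w * (c * y)) * (c * y)" by (simp add: algebra_simps power2_eq_square)
    also have "\<dots> = a * y * (c * x + d) - (a * x + b) * (c * y)" by (simp only: re im)
    also have "\<dots> = (a * d - b * c) * y" by (simp add: algebra_simps)
    finally have yy: "Im w * ((c * x + d)\<^sup>2 + (c * y)\<^sup>2) = y" using det by simp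
    have small: "(c * x + d)\<^sup>2 + (c * y)\<^sup>2 \<le> 1"
    proof (rule ccontr)
      assume "\<not> ?thesis"
      then have "Im w * 1 < Im w * ((c * x + d)\<^sup>2 + (c * y)\<^sup>2)"
        using wy by (intro mult_strict_left_mono) auto
      then show False using yy le by (simp add: y_def)
    qed
    have "\<bar>x\<bar> \<le> \<bar>1 / 2\<bar>" using x by auto
    then have "x\<^sup>2 \<le> (1 / 2)\<^sup>2" using abs_le_square_iff by blast
    then have "x\<^sup>2 \<le> 1 / 4" by (simp add: power_divide)
    then have y34: "y\<^sup>2 \<ge> 3 / 4" using x(3) by linarith
    have c1: "c = 1"
    proof (rule ccontr)
      assume "c \<noteq> 1"
      then have "c \<ge> 2" using c by simp
      then have "(real_of_int c)\<^sup>2 \<ge> 2\<^sup>2" by (intro power_mono) auto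
      then have "(real_of_int c)\<^sup>2 * y\<^sup>2 \<ge> 4 * (3 / 4)" using y34 by (intro mult_mono) auto
      then show False using small zero_le_power2[of "c * x + d"]
        by (simp add: power_mult_distrib)
    qed
    have sm: "d * (2 * x + d) \<le> 1 - (x\<^sup>2 + y\<^sup>2)"
      using small by (simp add: c1 power2_eq_square algebra_simps)
    have "d = 0 \<or> d = -1"
    proof (rule ccontr)
      assume "\<not> ?thesis"
      then consider "d \<ge> 1" | "d \<le> -2" by linarith
      then have "d * (2 * x + d) > 0"
        using x by cases (auto intro!: mult_pos_pos mult_neg_neg)
      then show False using sm x(3) by linarith
    qed
    then show ?thesis
    proof
      assume d: "d = 0"
      then have n1: "x\<^sup>2 + y\<^sup>2 = 1" using sm x(3) by simp
      have x0: "0 \<le> x" using x(4) n1 by simp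
      have b: "b = -1" using g d c1 by simp
      have ww: "Im w = y" using yy n1 by (simp add: c1 d)
      then have "Re w * y + y * x = a * y" using im by (simp add: c1 d)
      then have "y * (Re w + x - a) = 0" by (simp add: algebra_simps)
      then have wr: "Re w = a - x" using y by simp
      have "a = 0 \<or> a = 1" using wr wx x0 x by linarith
      then show ?thesis
      proof
        assume "a = 0"
        then have "Re w = - x" using wr by simp
        then have "x = 0" using w1(2) ww n1 x0 by simp
        then have "y = 1" using n1 y by (simp add: power2_eq_1_iff)
        then have "z = \<i>" "w = \<i>" using \<open>x = 0\<close> \<open>Re w = - x\<close> ww
          by (auto simp: complex_eq_iff x_def y_def)
        then show ?thesis by simp
      next
        assume "a = 1"
        then have "x = 1 / 2" "Re w = 1 / 2" using wr wx x by auto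
        moreover have "(1 / 2)\<^sup>2 + y\<^sup>2 = 1" using n1 calculation by simp
        then have "y\<^sup>2 = 3 / 4" by (simp add: power_divide)
        ultimately have "z = rho" "w = rho" using ww y by (auto intro!: eq_rho simp: x_def y_def)
        then show ?thesis by simp
      qed
    next
      assume d: "d = -1"
      then have "x = 1 / 2" and n1: "x\<^sup>2 + y\<^sup>2 = 1" using sm x by auto
      then have "(1 / 2)\<^sup>2 + y\<^sup>2 = 1" using n1 by (simp only:)
      then have y2: "y\<^sup>2 = 3 / 4" by (simp add: power_divide)
      have zr: "z = rho" using y2 y \<open>x = 1 / 2\<close> by (auto intro!: eq_rho simp: x_def y_def)
      have b: "b = - a - 1" using g d c1 by simp
      have "(c * x + d)\<^sup>2 + (c * y)\<^sup>2 = 1"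
        by (simp add: c1 d y2 \<open>x = 1 / 2\<close> power_divide)
      then have ww: "Im w = y" using yy by simp
      then have "Re w * y - y * (1/2) = a * y" using im \<open>x = 1/2\<close> by (simp add: c1 d)
      then have "y * (Re w - 1 / 2 - a) = 0" by (simp add: algebra_simps)
      then have "Re w = a + 1 / 2" using y by simp
      then have "a = 0" using wx by linarith
      then have "Re w = 1 / 2" using \<open>Re w = a + 1 / 2\<close> by simp
      then have "w = rho" using ww y2 y by (intro eq_rho) auto
      then show ?thesis using zr by simp
    qed
  qed
  consider "c > 0" | "c < 0" | "c = 0" by linarith
  then show ?thesis
  proof cases
    case 1
    then show ?thesis using core g eq by blast
  next
    case 2
    have "mob (Mat (- a) (- b) (- c) (- d)) z = w" using mob_mneg[of "(Mat a b c d)"] eq by simp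
    then show ?thesis using core[of "- a" "- b" "- c" "- d"] 2 g by auto
  next
    case 3
    then have "a * d = 1" using g by simp
    then have ad: "a = 1 \<and> d = 1 \<or> a = -1 \<and> d = -1" by (simp add: zmult_eq_1_iff)
    then have "w = z + of_int (b * d)" using eq 3 by auto
    moreover from this have "Re w = Re z + of_int (b * d)" by simp
    then have "- 1 < real_of_int (b * d)" "real_of_int (b * d) < 1"
      using z w unfolding fundamental_domain_def mem_Collect_eq by linarith+
    then have "b * d = 0" by linarith
    ultimately show ?thesis using 3 by simp
  qed
qed

text \<open>Exchanging \<open>z\<close> and \<open>w\<close>, and \<open>g\<close> and its inverse, reduces to the case \<open>Im z \<le> Im w\<close>.\<close>

lemma fundamental_domain_unique:
  assumes z: "z \<in> fundamental_domain" and w: "w \<in> fundamental_domain"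
    and g: "g \<in> SL2" and eq: "mob g z = w"
  shows "w = z" and "z \<noteq> \<i> \<Longrightarrow> z \<noteq> rho \<Longrightarrow> g = Mat 1 0 0 1 \<or> g = Mat (-1) 0 0 (-1)"
proof -
  obtain a b c d where h: "g = Mat a b c d" by (cases g)
  have zU: "z \<in> uhp" using z by (simp add: fundamental_domain_def)
  have inv: "mob (minv g) w = z" using mob_minv[OF g zU eq] .
  have *: "w = z \<and> (c = 0 \<or> z = \<i> \<or> z = rho)"
  proof (cases "Im z \<le> Im w")
    case True
    then show ?thesis using fundamental_domain_unique_aux z w g eq h by blast
  next
    case False
    then show ?thesis using fundamental_domain_unique_aux[of w z d "- b" "- c" a] z w
        minv_SL2[OF g] inv h by auto
  qed
  then show "w = z" by simp
  assume "z \<noteq> \<i>" "z \<noteq> rho"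
  then have c: "c = 0" using * by simp
  then have ad: "a = 1 \<and> d = 1 \<or> a = -1 \<and> d = -1" using g h by (simp add: zmult_eq_1_iff)
  then have "w = z + of_int (b * d)" using eq c h by auto
  then have "b = 0" using * ad by auto
  then show "g = Mat 1 0 0 1 \<or> g = Mat (-1) 0 0 (-1)" using ad c h by auto
qed

lemma stabilizer_i:
  "{g \<in> SL2. mob g \<i> = \<i>} = {Mat 1 0 0 1, Mat (-1) 0 0 (-1), Mat 0 (-1) 1 0, Mat 0 1 (-1) 0}"
  (is "?L = ?R")
proof
  show "?R \<subseteq> ?L" by auto
  show "?L \<subseteq> ?R"
  proof (rule subsetI)
    fix g assume "g \<in> ?L"
    then obtain a b c d where g: "g = Mat a b c d" "a * d - b * c = 1" and e: "mob (Mat a b c d) \<i> = \<i>"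
      by (cases g) auto
    have "\<i> * (of_int c * \<i> + of_int d) = of_int a * \<i> + of_int b"
      using e denominator_nonzero[of a b c d \<i>] g by (auto simp: field_simps uhp_def)
    then have "b = - c" "a = d" by (auto simp: complex_eq_iff)
    then have s: "d * d + c * c = 1" using g by simp
    have "d * d \<le> 1" "c * c \<le> 1"
      using s zero_le_square[of c] zero_le_square[of d] by linarith+
    then have "\<bar>d\<bar> \<le> 1" "\<bar>c\<bar> \<le> 1"
      using abs_le_square_iff[of d 1] abs_le_square_iff[of c 1]
      by (auto simp: power2_eq_square)
    then have "d \<in> {-1, 0, 1}" "c \<in> {-1, 0, 1}" by auto
    then show "g \<in> ?R" using s g \<open>b = - c\<close> \<open>a = d\<close> by auto
  qed
qed

lemma stabilizer_rho:
  "{g \<in> SL2. mob g rho = rho} = {Mat 1 0 0 1, Mat (-1) 0 0 (-1), Mat 1 (-1) 1 0, Mat (-1) 1 (-1) 0,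
     Mat 0 (-1) 1 (-1), Mat 0 1 (-1) 1}"
  (is "?L = ?R")
proof -
  have rU: "rho \<in> uhp" by (simp add: uhp_def rho_squares)
  have r2: "rho * rho = rho - 1"
    by (simp add: complex_eq_iff rho_def)
  have iff: "mob (Mat a b c d) rho = rho \<longleftrightarrow> a = c + d \<and> b = - c" if "Mat a b c d \<in> SL2" for a b c d
  proof -
    have "mob (Mat a b c d) rho = rho \<longleftrightarrow> of_int a * rho + of_int b = rho * (of_int c * rho + of_int d)"
      using denominator_nonzero[OF that rU] by (simp add: field_simps)
    also have "rho * (of_int c * rho + of_int d) = of_int c * (rho * rho) + of_int d * rho"
      by (simp add: algebra_simps)
    also have "\<dots> = of_int (c + d) * rho - of_int c" unfolding r2 by (simp add: algebra_simps)
    also have "of_int a * rho + of_int b = of_int (c + d) * rho - of_int c \<longleftrightarrow> a = c + d \<and> b = - c"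
    proof
      assume *: "of_int a * rho + of_int b = of_int (c + d) * rho - of_int c"
      then have "Im (of_int a * rho + of_int b) = Im (of_int (c + d) * rho - of_int c)" by simp
      then have "real_of_int a * Im rho = of_int (c + d) * Im rho" by simp
      then have "real_of_int a = of_int (c + d)" using rho_squares(3) by simp
      then have "a = c + d" by (simp only: of_int_eq_iff)
      then have "complex_of_int b = - of_int c" using * by simp
      then have "complex_of_int b = of_int (- c)" by simp
      then have "b = - c" by (simp only: of_int_eq_iff)
      with \<open>a = c + d\<close> show "a = c + d \<and> b = - c" by simp
    qed auto
    finally show ?thesis .
  qed
  show ?thesis
  proof
    show "?R \<subseteq> ?L" by (simp add: iff del: mob.simps)
    show "?L \<subseteq> ?R"
    proof (rule subsetI)
      fix g assume "g \<in> ?L"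
      then obtain a b c d where g: "g = Mat a b c d" "Mat a b c d \<in> SL2" and e: "mob (Mat a b c d) rho = rho"
        by (cases g) auto
      then have ab: "a = c + d" "b = - c" using iff by auto
      have s: "c * c + c * d + d * d = 1" using g ab by (simp add: algebra_simps)
      have "(2 * d + c)\<^sup>2 + 3 * c\<^sup>2 = 4 * (c * c + c * d + d * d)"
        "(2 * c + d)\<^sup>2 + 3 * d\<^sup>2 = 4 * (c * c + c * d + d * d)"
        by (simp_all add: power2_eq_square algebra_simps)
      then have "3 * c\<^sup>2 \<le> 4" "3 * d\<^sup>2 \<le> 4"
        unfolding s using zero_le_power2[of "2 * d + c"] zero_le_power2[of "2 * c + d"] by linarith+
      then have "c\<^sup>2 \<le> 1\<^sup>2" "d\<^sup>2 \<le> 1\<^sup>2" by auto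
      then have "\<bar>d\<bar> \<le> 1" "\<bar>c\<bar> \<le> 1" 
        using abs_le_square_iff[of d 1] abs_le_square_iff[of c 1] by auto
      then have "d \<in> {-1, 0, 1}" "c \<in> {-1, 0, 1}" by auto
      then show "g \<in> ?R" using s by (elim insertE emptyE) (simp_all add: g(1) ab)
    qed
  qed
qed

section \<open>Strata of the fundamental domain and their stars\<close>

datatype stratum = Face | Line | Arc | PtI | PtRho

lemma UNIV_stratum: "UNIV = {Face, Line, Arc, PtI, PtRho}"
  using stratum.exhaust by auto

fun region :: "stratum \<Rightarrow> complex set" where
  "region Face = {z. - 1 / 2 < Re z \<and> Re z < 1 / 2 \<and> 1 < (Re z)\<^sup>2 + (Im z)\<^sup>2 \<and> 0 < Im z}"
| "region Line = {z. Re z = 1 / 2 \<and> 1 < (Re z)\<^sup>2 + (Im z)\<^sup>2 \<and> 0 < Im z}"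
| "region Arc = {z. 0 < Re z \<and> Re z < 1 / 2 \<and> (Re z)\<^sup>2 + (Im z)\<^sup>2 = 1 \<and> 0 < Im z}"
| "region PtI = {\<i>}"
| "region PtRho = {rho}"

fun stratum_dim :: "stratum \<Rightarrow> nat" where
  "stratum_dim Face = 2"
| "stratum_dim Line = 1"
| "stratum_dim Arc = 1"
| "stratum_dim PtI = 0"
| "stratum_dim PtRho = 0"

fun stabilizer :: "stratum \<Rightarrow> mat2 set" where
  "stabilizer PtI = {Mat 1 0 0 1, Mat (-1) 0 0 (-1), Mat 0 (-1) 1 0, Mat 0 1 (-1) 0}"
| "stabilizer PtRho = {Mat 1 0 0 1, Mat (-1) 0 0 (-1), Mat 1 (-1) 1 0, Mat (-1) 1 (-1) 0,
     Mat 0 (-1) 1 (-1), Mat 0 1 (-1) 1}"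
| "stabilizer c = {Mat 1 0 0 1, Mat (-1) 0 0 (-1)}"

text \<open>An open neighbourhood of the stratum that is so small that it meets, up to the modular group, only
strata of larger dimension besides the given one. It is the interior of the union of the translates
of the closed left and right halves of the fundamental domain around the stratum; for \<open>PtRho\<close> this
is the ideal triangle with vertices \<open>0, 1, \<infinity>\<close>.\<close>

fun star :: "stratum \<Rightarrow> complex set" where
  "star Face = region Face"
| "star Line = {z. 0 < Re z \<and> Re z < 1 \<and> 1 < (Re z)\<^sup>2 + (Im z)\<^sup>2 \<and>
     1 < (Re z - 1)\<^sup>2 + (Im z)\<^sup>2 \<and> 0 < Im z}"
| "star Arc = {z. 0 < Re z \<and> Re z < 1 / 2 \<and> 1 < (Re z - 1)\<^sup>2 + (Im z)\<^sup>2 \<and> 0 < Im z}"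
| "star PtI = {z. - 1 / 2 < Re z \<and> Re z < 1 / 2 \<and> 1 < (Re z - 1)\<^sup>2 + (Im z)\<^sup>2 \<and>
     1 < (Re z + 1)\<^sup>2 + (Im z)\<^sup>2 \<and> 0 < Im z}"
| "star PtRho = {z. 0 < Re z \<and> Re z < 1 \<and> Re z < (Re z)\<^sup>2 + (Im z)\<^sup>2 \<and> 0 < Im z}"

lemma region_subset_fundamental_domain: "region c \<subseteq> fundamental_domain"
  by (cases c) (auto simp: fundamental_domain_def uhp_def rho_squares power_divide)

lemma region_disjoint: "z \<in> region c \<Longrightarrow> z \<in> region c' \<Longrightarrow> c = c'"
proof -
  have "Re rho \<noteq> Re \<i>" using rho_squares(4) by simp
  then have "rho \<noteq> \<i>" "\<i> \<noteq> rho" by metis+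
  then show "z \<in> region c \<Longrightarrow> z \<in> region c' \<Longrightarrow> c = c'"
    by (cases c; cases c'; auto simp: rho_squares power_divide)
qed

lemma fundamental_domain_regions:
  assumes "z \<in> fundamental_domain"
  shows "\<exists>c. z \<in> region c"
proof -
  define x y where "x = Re z" and "y = Im z"
  have z: "- 1 / 2 < x" "x \<le> 1 / 2" "1 \<le> x\<^sup>2 + y\<^sup>2" "x\<^sup>2 + y\<^sup>2 = 1 \<longrightarrow> 0 \<le> x" "0 < y"
    using assms by (auto simp: fundamental_domain_def uhp_def x_def y_def)
  consider "x < 1 / 2" "1 < x\<^sup>2 + y\<^sup>2" | "x = 1 / 2" "1 < x\<^sup>2 + y\<^sup>2"
    | "x\<^sup>2 + y\<^sup>2 = 1" "0 < x" "x < 1 / 2" | "x\<^sup>2 + y\<^sup>2 = 1" "x = 0" | "x\<^sup>2 + y\<^sup>2 = 1" "x = 1 / 2"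
    using z by linarith
  then show ?thesis
  proof cases
    case 1 then have "z \<in> region Face" using z by (simp add: x_def y_def)
    then show ?thesis ..
  next
    case 2 then have "z \<in> region Line" using z by (simp add: x_def y_def)
    then show ?thesis ..
  next
    case 3 then have "z \<in> region Arc" using z by (simp add: x_def y_def)
    then show ?thesis ..
  next
    case 4 then have "y = 1" using z by (simp add: power2_eq_1_iff)
    then have "z \<in> region PtI" using 4 by (simp add: x_def y_def complex_eq_iff)
    then show ?thesis ..
  next
    case 5
    then have "(1 / 2)\<^sup>2 + y\<^sup>2 = 1" by simp
    then have "y\<^sup>2 = 3 / 4" by (simp add: power_divide)
    then have "z \<in> region PtRho" using 5 z by (auto simp: x_def y_def intro!: eq_rho)
    then show ?thesis ..
  qed
qed

lemma region_nonempty: "region c \<noteq> {}"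
proof -
  have "Complex 0 2 \<in> region Face" "Complex (1/2) 2 \<in> region Line" "Complex (3/5) (4/5) \<notin> region Line"
    by (simp_all add: power_divide)
  moreover have "Complex (7/25) (24/25) \<in> region Arc" by (simp add: power_divide)
  ultimately show ?thesis by (cases c) (auto simp del: region.simps(1-3))
qed

lemma region_stabilizer:
  assumes "z \<in> region c"
  shows "{g \<in> SL2. mob g z = z} = stabilizer c"
proof -
  have z: "z \<in> fundamental_domain" using assms region_subset_fundamental_domain by blast
  show ?thesis
  proof (cases "c = PtI \<or> c = PtRho")
    case True
    then consider "c = PtI" "z = \<i>" | "c = PtRho" "z = rho" using assms by auto
    then show ?thesis
      by cases (simp_all only: stabilizer_i stabilizer_rho stabilizer.simps)
  next
    case False
    have "\<i> \<in> region PtI" "rho \<in> region PtRho" by auto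
    then have "z \<noteq> \<i>" "z \<noteq> rho" using False assms region_disjoint by blast+
    then have "{g \<in> SL2. mob g z = z} \<subseteq> {Mat 1 0 0 1, Mat (-1) 0 0 (-1)}"
      using fundamental_domain_unique(2)[OF z z] by blast
    moreover have "{Mat 1 0 0 1, Mat (-1) 0 0 (-1)} \<subseteq> {g \<in> SL2. mob g z = z}" by simp
    moreover have "stabilizer c = {Mat 1 0 0 1, Mat (-1) 0 0 (-1)}" using False by (cases c) simp_all
    ultimately show ?thesis by blast
  qed
qed

lemma finite_stabilizer: "finite (stabilizer c)"
  by (cases c) auto

lemma open_star: "open (star c)"
proof -
  have [continuous_intros]: "continuous_on UNIV Re" "continuous_on UNIV Im"
    by (intro continuous_intros)+
  show ?thesis
    by (cases c) (auto intro!: open_Collect_conj open_Collect_less continuous_intros)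
qed

lemma star_subset_uhp: "star c \<subseteq> uhp"
  by (cases c) (auto simp: uhp_def)

lemma region_subset_star: "region c \<subseteq> star c"
  by (cases c) (auto simp: rho_squares power_divide power2_diff power2_sum)

lemma orbit_meets_regions_trans:
  assumes "g \<in> SL2" "z \<in> uhp" "\<exists>h\<in>SL2. mob h (mob g z) \<in> R"
  shows "\<exists>h\<in>SL2. mob h z \<in> R"
  using assms mob_mmul mmul_SL2 by metis

lemma mob_S:
  assumes "z \<in> uhp"
  defines "n \<equiv> (Re z)\<^sup>2 + (Im z)\<^sup>2"
  shows "Re (mob (Mat 0 (-1) 1 0) z) = - Re z / n" "Im (mob (Mat 0 (-1) 1 0) z) = Im z / n" "n > 0"
    "(Re (mob (Mat 0 (-1) 1 0) z))\<^sup>2 + (Im (mob (Mat 0 (-1) 1 0) z))\<^sup>2 = 1 / n"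
proof -
  show n: "n > 0" using assms by (simp add: uhp_def sum_power2_gt_zero_iff)
  show 1: "Re (mob (Mat 0 (-1) 1 0) z) = - Re z / n" and 2: "Im (mob (Mat 0 (-1) 1 0) z) = Im z / n"
    using norm_mob_S[OF assms(1)] by (simp_all del: mob.simps add: n_def)
  have "(Re (mob (Mat 0 (-1) 1 0) z))\<^sup>2 + (Im (mob (Mat 0 (-1) 1 0) z))\<^sup>2 = n / n\<^sup>2"
    unfolding 1 2 by (simp add: n_def power_divide add_divide_distrib)
  also have "\<dots> = 1 / n" using n by (simp add: power2_eq_square)
  finally show "(Re (mob (Mat 0 (-1) 1 0) z))\<^sup>2 + (Im (mob (Mat 0 (-1) 1 0) z))\<^sup>2 = 1 / n" .
qed

text \<open>The stars are bounded by the circles and lines that the inversion \<open>S\<close> and the translations carry to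
the sides of the fundamental domain. In each case it suffices to locate a point inside or outside
the unit circle (and, for \<open>PtRho\<close>, its translate around \<open>1\<close>), and to apply \<open>S\<close> or a translation.\<close>

lemma star_reduces:
  assumes "z \<in> star c" "z \<notin> region c"
  shows "\<exists>c' g. g \<in> SL2 \<and> mob g z \<in> region c' \<and> stratum_dim c < stratum_dim c'"
proof -
  define x y n where "x = Re z" and "y = Im z" and "n = x\<^sup>2 + y\<^sup>2"
  have zU: "z \<in> uhp" using assms(1) star_subset_uhp by blast
  have y: "y > 0" using zU by (simp add: uhp_def y_def)
  let ?S = "Mat 0 (-1) 1 0"
  have S: "?S \<in> SL2" by simp
  have id: "Mat 1 0 0 1 \<in> SL2" "Mat 1 (-1) 0 1 \<in> SL2" "Mat 1 1 0 1 \<in> SL2" by simp_all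
  note Sz = mob_S[OF zU, folded x_def y_def, folded n_def]
  \<comment> \<open>Inversion sends the points inside the unit circle and outside the circles \<open>\<bar>z \<plusminus> 1\<bar> = 1\<close> to the open face.\<close>
  have Sface: "mob ?S z \<in> region Face" if "n < 1" "- n < 2 * x" "2 * x < n"
  proof -
    have "- 1 / 2 < - x / n" "- x / n < 1 / 2" "1 < 1 / n" "0 < y / n"
      using that Sz(3) y by (simp_all add: field_simps)
    then show ?thesis unfolding region.simps mem_Collect_eq Sz(4) unfolding Sz(1,2) by blast
  qed
  have nm: "(x - 1)\<^sup>2 + y\<^sup>2 = n - 2 * x + 1" "(x + 1)\<^sup>2 + y\<^sup>2 = n + 2 * x + 1"
    by (simp_all add: n_def power2_eq_square algebra_simps)
  show ?thesis
  proof (cases c)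
    case Face
    then show ?thesis using assms by simp
  next
    case Line
    have h: "0 < x" "x < 1" "1 < n" "1 < n - 2 * x + 1" "x \<noteq> 1 / 2"
      using assms Line nm by (auto simp: x_def y_def n_def)
    show ?thesis
    proof (cases "x < 1 / 2")
      case True
      then have "mob (Mat 1 0 0 1) z \<in> region Face" using h y by (simp add: x_def y_def n_def)
      then show ?thesis using id Line by (intro exI[of _ Face] exI[of _ "Mat 1 0 0 1"]) auto
    next
      case False
      then have "mob (Mat 1 (-1) 0 1) z \<in> region Face"
        using h y nm by (simp add: x_def y_def n_def)
      then show ?thesis using id Line by (intro exI[of _ Face] exI[of _ "Mat 1 (-1) 0 1"]) auto
    qed
  next
    case Arc
    have h: "0 < x" "x < 1 / 2" "2 * x < n" "n \<noteq> 1"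
      using assms Arc nm by (auto simp: x_def y_def n_def)
    show ?thesis
    proof (cases "n < 1")
      case True
      then have "mob ?S z \<in> region Face" using h by (intro Sface) auto
      then show ?thesis using S Arc by (intro exI[of _ Face] exI[of _ ?S]) auto
    next
      case False
      then have "mob (Mat 1 0 0 1) z \<in> region Face" using h y by (simp add: x_def y_def n_def)
      then show ?thesis using id Arc by (intro exI[of _ Face] exI[of _ "Mat 1 0 0 1"]) auto
    qed
  next
    case PtI
    have h: "- 1 / 2 < x" "x < 1 / 2" "2 * x < n" "- n < 2 * x" "z \<noteq> \<i>"
      using assms PtI nm by (auto simp: x_def y_def n_def)
    consider "n < 1" | "n > 1" | "n = 1" "x > 0" | "n = 1" "x < 0" | "n = 1" "x = 0" by linarith
    then show ?thesis
    proof cases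
      case 1
      then have "mob ?S z \<in> region Face" using h by (intro Sface) auto
      then show ?thesis using S PtI by (intro exI[of _ Face] exI[of _ ?S]) auto
    next
      case 2
      then have "mob (Mat 1 0 0 1) z \<in> region Face" using h y by (simp add: x_def y_def n_def)
      then show ?thesis using id PtI by (intro exI[of _ Face] exI[of _ "Mat 1 0 0 1"]) auto
    next
      case 3
      then have "mob (Mat 1 0 0 1) z \<in> region Arc" using h y by (simp add: x_def y_def n_def)
      then show ?thesis using id PtI by (intro exI[of _ Arc] exI[of _ "Mat 1 0 0 1"]) auto
    next
      case 4
      then have "mob ?S z \<in> region Arc" using Sz h y by (simp del: mob.simps)
      then show ?thesis using S PtI by (intro exI[of _ Arc] exI[of _ ?S]) auto
    next
      case 5
      then have "y = 1" using y by (simp add: n_def power2_eq_1_iff)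
      then show ?thesis using 5 h by (simp add: x_def y_def complex_eq_iff)
    qed
  next
    case PtRho
    let ?R = "region Face \<union> region Line \<union> region Arc"
    \<comment> \<open>The facts \<open>A\<close>, \<open>B\<close> and \<open>AB\<close> treat the points of the triangle outside both unit circles around \<open>0\<close> and \<open>1\<close>.\<close>
    have A: "w \<in> ?R" if "0 < Re w" "Re w \<le> 1 / 2" "1 \<le> (Re w)\<^sup>2 + (Im w)\<^sup>2" "0 < Im w" "w \<noteq> rho" for w
    proof -
      have "w \<in> fundamental_domain" using that by (simp add: fundamental_domain_def uhp_def)
      then obtain c where c: "w \<in> region c" using fundamental_domain_regions by blast
      then show ?thesis using that by (cases c) auto
    qed
    have B: "\<exists>g\<in>SL2. mob g w \<in> ?R"
      if w: "1 / 2 < Re w" "Re w < 1" "1 \<le> (Re w - 1)\<^sup>2 + (Im w)\<^sup>2" "0 < Im w" for w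
    proof -
      have wU: "w \<in> uhp" using w by (simp add: uhp_def)
      define v where "v = mob (Mat 1 (-1) 0 1) w"
      have v: "Re v = Re w - 1" "Im v = Im w" by (simp_all add: v_def)
      have vU: "v \<in> uhp" using w v by (simp add: uhp_def)
      have "\<exists>g\<in>SL2. mob g v \<in> ?R"
      proof (cases "(Re v)\<^sup>2 + (Im v)\<^sup>2 = 1")
        case True
        then have "mob ?S v \<in> region Arc" using mob_S[OF vU] w v by (simp del: mob.simps)
        then show ?thesis using S by blast
      next
        case False
        then have "mob (Mat 1 0 0 1) v \<in> region Face" using w v by simp
        then show ?thesis using id(1) by blast
      qed
      then show ?thesis using orbit_meets_regions_trans[OF id(2) wU] v_def by blast
    qed
    have AB: "\<exists>g\<in>SL2. mob g w \<in> ?R"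
      if "0 < Re w" "Re w < 1" "1 \<le> (Re w)\<^sup>2 + (Im w)\<^sup>2" "1 \<le> (Re w - 1)\<^sup>2 + (Im w)\<^sup>2" "0 < Im w" "w \<noteq> rho" for w
    proof (cases "Re w \<le> 1 / 2")
      case True
      then have "mob (Mat 1 0 0 1) w \<in> ?R" using A[of w] that by simp
      then show ?thesis using id(1) by blast
    next
      case False
      then show ?thesis using B[of w] that by simp
    qed
    have h: "0 < x" "x < 1" "x < n" "z \<noteq> rho"
      using assms PtRho by (auto simp: x_def y_def n_def)
    have "\<exists>g\<in>SL2. mob g z \<in> ?R"
    proof -
      \<comment> \<open>Points inside the circle around \<open>0\<close> or \<open>1\<close> are brought outside both circles by an order \<open>3\<close> rotation about the corner.\<close>
      consider "x \<le> 1 / 2" "1 \<le> n" | "1 / 2 < x" "1 \<le> n - 2 * x + 1"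
        | "x \<le> 1 / 2" "n < 1" | "1 / 2 < x" "n - 2 * x + 1 < 1" by linarith
      then show ?thesis
      proof cases
        case 1
        then have "mob (Mat 1 0 0 1) z \<in> ?R" using A[of z] h y by (simp add: x_def y_def n_def)
        then show ?thesis using id(1) by blast
      next
        case 2
        then show ?thesis using B[of z] h y nm by (simp add: x_def y_def n_def)
      next
        case 3
        define v where "v = mob (Mat 1 1 0 1) (mob ?S z)"
        have re: "Re v = 1 - x / n" and im: "Im v = y / n"
          using Sz by (simp_all add: v_def del: mob.simps add: mob_translation)
        have v1: "(Re v - 1)\<^sup>2 + (Im v)\<^sup>2 = 1 / n"
        proof -
          have "Re v - 1 = - x / n" using re by simp
          then show ?thesis using Sz(4) unfolding Sz(1,2) by (simp only: im)
        qed
        have "(Re v)\<^sup>2 + (Im v)\<^sup>2 = (Re v - 1)\<^sup>2 + (Im v)\<^sup>2 + 2 * Re v - 1"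
          by (simp add: power2_diff)
        also have "\<dots> = (n - 2 * x + 1) / n" unfolding v1 unfolding re using Sz(3) by (simp add: field_simps)
        finally have v0: "(Re v)\<^sup>2 + (Im v)\<^sup>2 = (n - 2 * x + 1) / n" .
        have "0 < x / n" "x / n < 1" "1 < 1 / n" "1 \<le> (n - 2 * x + 1) / n" "0 < y / n"
          using 3 h y Sz(3) by (simp_all add: field_simps)
        moreover from this have "v \<noteq> rho" using v1 by (auto simp: rho_squares power_divide)
        ultimately have "\<exists>g\<in>SL2. mob g v \<in> ?R" using v0 v1 re im by (intro AB) simp_all
        then have "\<exists>g\<in>SL2. mob g (mob ?S z) \<in> ?R"
          using orbit_meets_regions_trans[OF id(3) mob_uhp[OF S zU]] v_def by blast
        then show ?thesis using orbit_meets_regions_trans[OF S zU] by blast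
      next
        case 4
        define u where "u = mob (Mat 1 (-1) 0 1) z"
        have u: "Re u = x - 1" "Im u = y" by (simp_all add: u_def x_def y_def)
        have uU: "u \<in> uhp" using u y by (simp add: uhp_def)
        define m where "m = n - 2 * x + 1"
        have um: "(x - 1)\<^sup>2 + y\<^sup>2 = m" using nm m_def by simp
        define v where "v = mob ?S u"
        note Su = mob_S[OF uU, folded v_def, unfolded u um]
        have re: "Re v = (1 - x) / m" using Su(1) by simp
        have im: "Im v = y / m" and v0: "(Re v)\<^sup>2 + (Im v)\<^sup>2 = 1 / m"
          using Su(2,4) by simp_all
        have "(Re v - 1)\<^sup>2 + (Im v)\<^sup>2 = (Re v)\<^sup>2 + (Im v)\<^sup>2 - 2 * Re v + 1"
          by (simp add: power2_diff)
        also have "\<dots> = n / m" unfolding v0 unfolding re using Su(3) by (simp add: field_simps m_def)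
        finally have v1: "(Re v - 1)\<^sup>2 + (Im v)\<^sup>2 = n / m" .
        have "0 < (1 - x) / m" "(1 - x) / m < 1" "1 < 1 / m" "1 \<le> n / m" "0 < y / m"
          using 4 h y Su(3) by (simp_all add: field_simps m_def)
        moreover from this have "v \<noteq> rho" using v0 by (auto simp: rho_squares power_divide)
        ultimately have "\<exists>g\<in>SL2. mob g v \<in> ?R" using v0 v1 re im by (intro AB) simp_all
        then have "\<exists>g\<in>SL2. mob g u \<in> ?R"
          using orbit_meets_regions_trans[OF S uU] v_def by blast
        then show ?thesis using orbit_meets_regions_trans[OF id(2) zU] u_def by blast
      qed
    qed
    then obtain g where "g \<in> SL2" "mob g z \<in> ?R" by blast
    then consider "mob g z \<in> region Face" | "mob g z \<in> region Line" | "mob g z \<in> region Arc" by blast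
    then show ?thesis using \<open>g \<in> SL2\<close> PtRho 
    proof cases
      case 1
      with \<open>g \<in> SL2\<close> PtRho show ?thesis by (intro exI[of _ Face] exI[of _ g]) (simp del: mob.simps region.simps)
    next
      case 2
      with \<open>g \<in> SL2\<close> PtRho show ?thesis by (intro exI[of _ Line] exI[of _ g]) (simp del: mob.simps region.simps)
    next
      case 3
      with \<open>g \<in> SL2\<close> PtRho show ?thesis by (intro exI[of _ Arc] exI[of _ g]) (simp del: mob.simps region.simps)
    qed
  qed
qed

section \<open>The strata are open cells\<close>

lemma homeomorphic_Euclidean_spaceI:
  fixes C :: "complex set" and f :: "complex \<Rightarrow> nat \<Rightarrow> real" and h :: "(nat \<Rightarrow> real) \<Rightarrow> complex"
  assumes f: "\<And>i. i < n \<Longrightarrow> continuous_on C (\<lambda>z. f z i)"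
    and h: "continuous_on UNIV h" "\<And>v. h v \<in> C"
    and hf: "\<And>z. z \<in> C \<Longrightarrow> h (\<lambda>i. if i < n then f z i else 0) = z"
    and fh: "\<And>v i. i < n \<Longrightarrow> f (h v) i = v i"
  shows "top_of_set C homeomorphic_space Euclidean_space n"
  unfolding homeomorphic_space_def homeomorphic_maps_def
proof (intro exI conjI ballI)
  let ?f = "\<lambda>z i. if i < n then f z i else 0"
  show "continuous_map (top_of_set C) (Euclidean_space n) ?f"
    unfolding continuous_map_componentwise_Euclidean_space using f by simp
  have "continuous_map (Euclidean_space n) euclidean h"
    unfolding continuous_map_Euclidean_space_iff using h(1) continuous_on_subset by blast
  then show "continuous_map (Euclidean_space n) (top_of_set C) h"
    using h(2) by (simp add: continuous_map_in_subtopology image_subset_iff)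
  show "h (?f z) = z" if "z \<in> topspace (top_of_set C)" for z using that hf by simp
  show "?f (h v) = v" if "v \<in> topspace (Euclidean_space n)" for v
    using that fh by (auto simp: topspace_Euclidean_space fun_eq_iff)
qed

lemma continuous_on_coordinate [continuous_intros]: "continuous_on S (\<lambda>v :: nat \<Rightarrow> real. v i)"
  by (rule continuous_on_subset[OF continuous_on_product_coordinates]) auto

lemma tan_pi_arctan: "tan (pi * (arctan t / pi)) = t"
  by (simp add: tan_arctan)

lemma arctan_tan_pi: "- 1 / 2 < x \<Longrightarrow> x < 1 / 2 \<Longrightarrow> arctan (tan (pi * x)) / pi = x"
  using mult_strict_left_mono[of "- 1 / 2" x pi] mult_strict_left_mono[of x "1 / 2" pi] pi_gt_zero
  by (subst arctan_tan) auto

lemma arctan_pi_bounds: "- 1 / 2 < arctan t / pi" "arctan t / pi < 1 / 2"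
  using arctan_bounded[of t] by (simp_all add: field_simps)

lemma continuous_on_tan_pi:
  fixes g :: "complex \<Rightarrow> real"
  assumes "continuous_on C g" "\<And>z. z \<in> C \<Longrightarrow> - 1 / 2 < g z \<and> g z < 1 / 2"
  shows "continuous_on C (\<lambda>z. tan (pi * g z))"
  unfolding tan_def
proof (intro continuous_on_divide continuous_on_sin continuous_on_cos continuous_on_mult_left assms(1) ballI)
  fix z assume "z \<in> C"
  then have "- 1 / 2 < g z" "g z < 1 / 2" using assms by auto
  then have "- (pi / 2) < pi * g z" "pi * g z < pi / 2"
    using mult_strict_left_mono[of "- 1 / 2" "g z" pi] mult_strict_left_mono[of "g z" "1 / 2" pi]
      pi_gt_zero by auto
  then show "cos (pi * g z) \<noteq> 0" using cos_gt_zero_pi by fastforce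
qed

lemma one_minus_square_pos: "- 1 / 2 < (x :: real) \<Longrightarrow> x < 1 / 2 \<Longrightarrow> 0 < 1 - x\<^sup>2"
  using abs_square_less_1[of x] by auto

text \<open>On the face the coordinates are \<open>tan (\<pi> x)\<close>, for the strip of width \<open>1\<close>, and the logarithm of the
height above the unit circle. The line is parametrized by the logarithm of the height above the
corner, and the arc by its real part.\<close>

lemma region_homeomorphic_Euclidean_space:
  "top_of_set (region c) homeomorphic_space Euclidean_space (stratum_dim c)"
proof (cases c)
  case Face
  let ?f = "\<lambda>z i. if i = (0 :: nat) then tan (pi * Re z) else ln (Im z - sqrt (1 - (Re z)\<^sup>2))"
  let ?h = "\<lambda>v :: nat \<Rightarrow> real. Complex (arctan (v 0) / pi) (exp (v 1) + sqrt (1 - (arctan (v 0) / pi)\<^sup>2))"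
  have pos: "sqrt (1 - (Re z)\<^sup>2) < Im z" if "z \<in> region Face" for z
  proof -
    have "1 - (Re z)\<^sup>2 < (Im z)\<^sup>2" "0 < Im z" using that by auto
    then show ?thesis using real_less_lsqrt by simp
  qed
  have "top_of_set (region Face) homeomorphic_space Euclidean_space 2"
  proof (rule homeomorphic_Euclidean_spaceI[of _ _ ?f ?h])
    fix i :: nat
    show "continuous_on (region Face) (\<lambda>z. ?f z i)"
    proof (cases "i = 0")
      case True
      then show ?thesis by (auto intro!: continuous_on_tan_pi continuous_intros)
    next
      case False
      have "continuous_on (region Face) (\<lambda>z. ln (Im z - sqrt (1 - (Re z)\<^sup>2)))"
      proof (intro continuous_on_ln ballI)
        show "continuous_on (region Face) (\<lambda>z. Im z - sqrt (1 - (Re z)\<^sup>2))" by (intro continuous_intros)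
        show "Im z - sqrt (1 - (Re z)\<^sup>2) \<noteq> 0" if "z \<in> region Face" for z using pos[OF that] by simp
      qed
      then show ?thesis using False by simp
    qed
  next
    show "continuous_on UNIV ?h" unfolding Complex_eq by (intro continuous_intros) auto
    fix v :: "nat \<Rightarrow> real"
    define x where "x = arctan (v 0) / pi"
    have x: "- 1 / 2 < x" "x < 1 / 2" unfolding x_def by (rule arctan_pi_bounds)+
    define s where "s = sqrt (1 - x\<^sup>2)"
    have s: "0 < s" "s\<^sup>2 = 1 - x\<^sup>2" using one_minus_square_pos[OF x] by (simp_all add: s_def)
    have "s\<^sup>2 < (exp (v 1) + s)\<^sup>2" using s by (intro power_strict_mono) auto
    then have "1 < x\<^sup>2 + (exp (v 1) + s)\<^sup>2" using s by simp
    moreover have "0 < exp (v 1) + s" using s exp_gt_zero[of "v 1"] by linarith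
    ultimately have "Complex x (exp (v 1) + s) \<in> region Face" using x by simp
    then show "?h v \<in> region Face" unfolding s_def x_def .
    show "?f (?h v) i = v i" if "i < 2" for i
    proof (cases "i = 0")
      case True
      then show ?thesis using tan_pi_arctan by simp
    next
      case False
      then have "i = 1" using that by simp
      then show ?thesis by simp
    qed
  next
    fix z assume z: "z \<in> region Face"
    have a: "arctan (tan (pi * Re z)) / pi = Re z" using z by (intro arctan_tan_pi) auto
    show "?h (\<lambda>i. if i < 2 then ?f z i else 0) = z"
      using pos[OF z] a by (simp add: complex_eq_iff)
  qed
  then show ?thesis by (simp only: Face stratum_dim.simps)
next
  case Line
  let ?f = "\<lambda>z (i :: nat). ln (Im z - Im rho)"
  let ?h = "\<lambda>v :: nat \<Rightarrow> real. Complex (1 / 2) (exp (v 0) + Im rho)"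
  have mem: "z \<in> region Line \<longleftrightarrow> Re z = 1 / 2 \<and> Im rho < Im z" for z
  proof (rule iffI)
    assume "z \<in> region Line"
    then have z: "Re z = 1 / 2" "1 < (Re z)\<^sup>2 + (Im z)\<^sup>2" "0 < Im z" by simp_all
    have "1 < (1 / 2)\<^sup>2 + (Im z)\<^sup>2" using z(2) by (simp only: z(1))
    then have "(Im rho)\<^sup>2 < (Im z)\<^sup>2" "0 < Im z" "Re z = 1 / 2"
      using z by (simp_all add: rho_squares power_divide)
    then show "Re z = 1 / 2 \<and> Im rho < Im z" using power2_less_imp_less by fastforce
  next
    assume *: "Re z = 1 / 2 \<and> Im rho < Im z"
    then have "(Im rho)\<^sup>2 < (Im z)\<^sup>2" using rho_squares(3) by (intro power_strict_mono) auto
    then have "1 < (1 / 2)\<^sup>2 + (Im z)\<^sup>2" using rho_squares(2) by (simp add: power_divide)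
    moreover have re: "Re z = 1 / 2" using * ..
    ultimately have "1 < (Re z)\<^sup>2 + (Im z)\<^sup>2" by (simp only:)
    moreover have "0 < Im z" using * rho_squares(3) by linarith
    ultimately show "z \<in> region Line" unfolding region.simps using re by blast
  qed
  have "top_of_set (region Line) homeomorphic_space Euclidean_space 1"
  proof (rule homeomorphic_Euclidean_spaceI[of _ _ ?f ?h])
    show "continuous_on (region Line) (\<lambda>z. ?f z i)" for i
      by (intro continuous_intros) (simp add: mem del: region.simps)
    show "continuous_on UNIV ?h" unfolding Complex_eq by (intro continuous_intros)
    show "?h v \<in> region Line" for v by (simp add: mem del: region.simps)
    show "?h (\<lambda>i. if i < 1 then ?f z i else 0) = z" if "z \<in> region Line" for z
      using that by (simp add: mem complex_eq_iff del: region.simps)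
    show "?f (?h v) i = v i" if "i < 1" for v i using that by simp
  qed
  then show ?thesis by (simp only: Line stratum_dim.simps)
next
  case Arc
  let ?f = "\<lambda>z (i :: nat). tan (pi * (2 * Re z - 1 / 2))"
  let ?x = "\<lambda>v :: nat \<Rightarrow> real. (arctan (v 0) / pi + 1 / 2) / 2"
  let ?h = "\<lambda>v :: nat \<Rightarrow> real. Complex (?x v) (sqrt (1 - (?x v)\<^sup>2))"
  have "top_of_set (region Arc) homeomorphic_space Euclidean_space 1"
  proof (rule homeomorphic_Euclidean_spaceI[of _ _ ?f ?h])
    show "continuous_on (region Arc) (\<lambda>z. ?f z i)" for i
      by (rule continuous_on_tan_pi) (auto intro!: continuous_intros)
    show "continuous_on UNIV ?h" unfolding Complex_eq by (intro continuous_intros) auto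
    fix v :: "nat \<Rightarrow> real"
    define x where "x = ?x v"
    have x: "0 < x" "x < 1 / 2" unfolding x_def using arctan_pi_bounds[of "v 0"] by simp_all
    then have "0 < 1 - x\<^sup>2" by (intro one_minus_square_pos) auto
    then have "Complex x (sqrt (1 - x\<^sup>2)) \<in> region Arc" using x by simp
    then show "?h v \<in> region Arc" unfolding x_def .
    show "?f (?h v) i = v i" if "i < 1" for i
    proof -
      have "2 * Re (?h v) - 1 / 2 = arctan (v 0) / pi" by (simp add: add_divide_distrib)
      then show ?thesis using that tan_pi_arctan by simp
    qed
  next
    fix z assume z: "z \<in> region Arc"
    have "arctan (tan (pi * (2 * Re z - 1 / 2))) / pi = 2 * Re z - 1 / 2"
      using z by (intro arctan_tan_pi) auto
    then have x: "?x (\<lambda>i. if i < 1 then ?f z i else 0) = Re z" by simp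
    have "1 - (Re z)\<^sup>2 = (Im z)\<^sup>2" "0 < Im z" using z by auto
    then have "sqrt (1 - (Re z)\<^sup>2) = Im z" by simp
    then show "?h (\<lambda>i. if i < 1 then ?f z i else 0) = z" unfolding x by (simp add: complex_eq_iff)
  qed
  then show ?thesis by (simp only: Arc stratum_dim.simps)
next
  case PtI
  have "top_of_set (region PtI) homeomorphic_space Euclidean_space 0"
    by (rule homeomorphic_Euclidean_spaceI[of _ _ _ "\<lambda>_. \<i>"]) auto
  then show ?thesis by (simp only: PtI stratum_dim.simps)
next
  case PtRho
  have "top_of_set (region PtRho) homeomorphic_space Euclidean_space 0"
    by (rule homeomorphic_Euclidean_spaceI[of _ _ _ "\<lambda>_. rho"]) auto
  then show ?thesis by (simp only: PtRho stratum_dim.simps)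
qed

lemma stabilizer_subset_SL2: "stabilizer c \<subseteq> SL2"
  using region_nonempty region_stabilizer by blast

lemma stabilizer_mmul: "g \<in> stabilizer c \<Longrightarrow> h \<in> stabilizer c \<Longrightarrow> mmul g h \<in> stabilizer c"
  and stabilizer_minv: "g \<in> stabilizer c \<Longrightarrow> minv g \<in> stabilizer c"
  and stabilizer_mneg: "g \<in> stabilizer c \<Longrightarrow> mneg g \<in> stabilizer c"
  by (cases c; auto)+

section \<open>Euler characteristics of finite covers of the modular curve\<close>

text \<open>A quotient of \<open>S \<times> \<HH>\<close> by \<open>SL(2,\<int>)\<close>, for a finite \<open>SL(2,\<int>)\<close>-set \<open>S\<close> on which \<open>-1\<close> acts trivially,
described by its projection \<open>\<kappa>\<close> (one map on \<open>\<HH>\<close> for each element of \<open>S\<close>), by its quotient topology and by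
its isotropy orders.\<close>

locale modular_quotient =
  fixes S :: "'s set" and act :: "mat2 \<Rightarrow> 's \<Rightarrow> 's" and \<kappa> :: "'s \<Rightarrow> complex \<Rightarrow> 'w"
    and T :: "'w topology" and ord :: "'w \<Rightarrow> nat"
  assumes finite_S: "finite S"
    and act_closed: "\<And>g s. g \<in> SL2 \<Longrightarrow> s \<in> S \<Longrightarrow> act g s \<in> S"
    and act_mmul: "\<And>g h s. g \<in> SL2 \<Longrightarrow> h \<in> SL2 \<Longrightarrow> s \<in> S \<Longrightarrow> act (mmul g h) s = act g (act h s)"
    and act_one: "\<And>s. s \<in> S \<Longrightarrow> act (Mat 1 0 0 1) s = s"
    and act_minus_one: "\<And>s. s \<in> S \<Longrightarrow> act (Mat (-1) 0 0 (-1)) s = s"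
    and openin_T: "\<And>U. openin T U \<longleftrightarrow>
      U \<subseteq> (\<Union>s\<in>S. \<kappa> s ` uhp) \<and> (\<forall>s\<in>S. open {z \<in> uhp. \<kappa> s z \<in> U})"
    and \<kappa>_eq_iff: "\<And>s s' z z'. s \<in> S \<Longrightarrow> s' \<in> S \<Longrightarrow> z \<in> uhp \<Longrightarrow> z' \<in> uhp \<Longrightarrow>
      \<kappa> s z = \<kappa> s' z' \<longleftrightarrow> (\<exists>g\<in>SL2. mob g z = z' \<and> act g s = s')"
    and ord_\<kappa>: "\<And>s z. s \<in> S \<Longrightarrow> z \<in> uhp \<Longrightarrow>
      ord (\<kappa> s z) = card {g \<in> SL2. mob g z = z \<and> act g s = s} div 2"
begin

lemma topspace_T: "topspace T = (\<Union>s\<in>S. \<kappa> s ` uhp)"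
proof -
  have "{z \<in> uhp. \<kappa> s z \<in> (\<Union>s\<in>S. \<kappa> s ` uhp)} = uhp" if "s \<in> S" for s using that by auto
  then have "openin T (\<Union>s\<in>S. \<kappa> s ` uhp)" unfolding openin_T using open_uhp by auto
  then show ?thesis using openin_T openin_subset openin_topspace by blast
qed

lemma continuous_\<kappa>:
  assumes "s \<in> S" shows "continuous_map (top_of_set uhp) T (\<kappa> s)"
  unfolding continuous_map_def
proof (intro conjI allI impI)
  show "\<kappa> s \<in> topspace (top_of_set uhp) \<rightarrow> topspace T" using assms topspace_T by auto
  fix U assume "openin T U"
  then have "open {z \<in> uhp. \<kappa> s z \<in> U}" using assms openin_T by blast
  then show "openin (top_of_set uhp) {x \<in> topspace (top_of_set uhp). \<kappa> s x \<in> U}"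
    using open_uhp by (simp add: openin_open_eq)
qed

text \<open>The preimage of \<open>\<kappa> s ` V\<close> in the copy of \<open>\<HH>\<close> with index \<open>t\<close> is the union of the sets \<open>{z. g z \<in> V}\<close> over the
\<open>g\<close> that carry \<open>t\<close> to \<open>s\<close>.\<close>

lemma open_\<kappa>_image:
  assumes s: "s \<in> S" and V: "open V" "V \<subseteq> uhp"
  shows "openin T (\<kappa> s ` V)"
  unfolding openin_T
proof (intro conjI ballI)
  show "\<kappa> s ` V \<subseteq> (\<Union>s\<in>S. \<kappa> s ` uhp)" using assms by auto
  fix t assume t: "t \<in> S"
  have "{z \<in> uhp. \<kappa> t z \<in> \<kappa> s ` V} = (\<Union>g\<in>{g \<in> SL2. act g t = s}. {z \<in> uhp. mob g z \<in> V})"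
  proof (intro equalityI subsetI)
    fix z assume "z \<in> {z \<in> uhp. \<kappa> t z \<in> \<kappa> s ` V}"
    then obtain v where "z \<in> uhp" "v \<in> V" "\<kappa> t z = \<kappa> s v" by auto
    then show "z \<in> (\<Union>g\<in>{g \<in> SL2. act g t = s}. {z \<in> uhp. mob g z \<in> V})"
      using \<kappa>_eq_iff[OF t s, of z v] V by auto
  next
    fix z assume "z \<in> (\<Union>g\<in>{g \<in> SL2. act g t = s}. {z \<in> uhp. mob g z \<in> V})"
    then obtain g where g: "g \<in> SL2" "act g t = s" "z \<in> uhp" "mob g z \<in> V" by auto
    then have "\<kappa> t z = \<kappa> s (mob g z)" using \<kappa>_eq_iff[OF t s, of z "mob g z"] V by auto
    then show "z \<in> {z \<in> uhp. \<kappa> t z \<in> \<kappa> s ` V}" using g by auto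
  qed
  then show "open {z \<in> uhp. \<kappa> t z \<in> \<kappa> s ` V}" using open_mob_vimage V by auto
qed

lemma region_uhp: "z \<in> region c \<Longrightarrow> z \<in> uhp"
  using region_subset_star star_subset_uhp by blast

lemma \<kappa>_act: "s \<in> S \<Longrightarrow> z \<in> uhp \<Longrightarrow> g \<in> SL2 \<Longrightarrow> \<kappa> (act g s) (mob g z) = \<kappa> s z"
  using \<kappa>_eq_iff[of s "act g s" z "mob g z"] act_closed mob_uhp by auto

lemma \<kappa>_region_eq:
  assumes "s \<in> S" "t \<in> S" "z \<in> region c" "w \<in> region c'" "\<kappa> s z = \<kappa> t w"
  shows "c' = c" "w = z" "\<exists>g\<in>stabilizer c. act g s = t"
proof -
  obtain g where g: "g \<in> SL2" "mob g z = w" "act g s = t"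
    using assms \<kappa>_eq_iff region_uhp by blast
  show "w = z"
    using fundamental_domain_unique(1)[of z w g] g region_subset_fundamental_domain assms by blast
  then show "c' = c" using assms region_disjoint by blast
  show "\<exists>g\<in>stabilizer c. act g s = t"
    using g \<open>w = z\<close> region_stabilizer[OF assms(3)] by blast
qed

lemma \<kappa>_region_act:
  assumes "s \<in> S" "g \<in> stabilizer c"
  shows "\<kappa> (act g s) ` region c = \<kappa> s ` region c"
proof (rule image_cong[OF refl])
  fix z assume z: "z \<in> region c"
  then have "g \<in> SL2" "mob g z = z" using assms region_stabilizer by blast+
  then show "\<kappa> (act g s) z = \<kappa> s z" using \<kappa>_act[of s z g] assms z region_uhp by auto
qed

lemma cells_eq_or_disjoint:
  assumes "s \<in> S" "t \<in> S" "y \<in> \<kappa> s ` region c" "y \<in> \<kappa> t ` region c'"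
  shows "c' = c" "\<kappa> t ` region c' = \<kappa> s ` region c"
  using assms \<kappa>_region_eq \<kappa>_region_act by (smt (verit) imageE)+

lemma cells_eq_iff:
  assumes "s \<in> S" "t \<in> S"
  shows "\<kappa> t ` region c = \<kappa> s ` region c \<longleftrightarrow> (\<exists>g\<in>stabilizer c. act g s = t)"
proof
  assume eq: "\<kappa> t ` region c = \<kappa> s ` region c"
  obtain z where z: "z \<in> region c" using region_nonempty by blast
  then have "\<kappa> t z \<in> \<kappa> s ` region c" using eq by blast
  then obtain w where "w \<in> region c" "\<kappa> s w = \<kappa> t z" by force
  then show "\<exists>g\<in>stabilizer c. act g s = t" using \<kappa>_region_eq(3) assms z by blast
next
  assume "\<exists>g\<in>stabilizer c. act g s = t"
  then show "\<kappa> t ` region c = \<kappa> s ` region c" using \<kappa>_region_act assms by blast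
qed

text \<open>The restriction of \<open>\<kappa> s\<close> is injective because the fundamental domain contains each orbit once. It is
open onto its image: an open subset of the stratum is extended to the star, on which \<open>\<kappa> s\<close> is open,
and the added points lie over strata of other dimensions (\<open>star_reduces\<close>), so that they do not
enlarge the trace on the cell.\<close>

lemma cell_homeomorphic_region:
  assumes s: "s \<in> S"
  shows "top_of_set (region c) homeomorphic_space subtopology T (\<kappa> s ` region c)"
proof -
  let ?C = "region c"
  have sub: "?C \<subseteq> uhp" using region_uhp by blast
  have "homeomorphic_map (top_of_set ?C) (subtopology T (\<kappa> s ` ?C)) (\<kappa> s)"
  proof (rule bijective_open_imp_homeomorphic_map)
    have "continuous_map (subtopology (top_of_set uhp) ?C) T (\<kappa> s)"
      by (rule continuous_map_from_subtopology[OF continuous_\<kappa>[OF s]])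
    then show "continuous_map (top_of_set ?C) (subtopology T (\<kappa> s ` ?C)) (\<kappa> s)"
      using sub by (simp add: continuous_map_in_subtopology subtopology_subtopology Int_absorb1)
    have "\<kappa> s ` ?C \<subseteq> topspace T" using s sub topspace_T by auto
    then show "\<kappa> s ` topspace (top_of_set ?C) = topspace (subtopology T (\<kappa> s ` ?C))" by auto
    show "inj_on (\<kappa> s) (topspace (top_of_set ?C))"
      using \<kappa>_region_eq(2)[OF s s] by (auto simp: inj_on_def)
    show "open_map (top_of_set ?C) (subtopology T (\<kappa> s ` ?C)) (\<kappa> s)"
      unfolding open_map_def
    proof (intro allI impI)
      fix U assume "openin (top_of_set ?C) U"
      then obtain V where V: "open V" "U = ?C \<inter> V" unfolding openin_open by blast
      let ?V = "V \<inter> star c"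
      have "openin T (\<kappa> s ` ?V)" using s V open_star star_subset_uhp by (intro open_\<kappa>_image) auto
      moreover have "\<kappa> s ` U = \<kappa> s ` ?V \<inter> \<kappa> s ` ?C"
      proof (intro equalityI subsetI)
        fix y assume "y \<in> \<kappa> s ` U"
        then show "y \<in> \<kappa> s ` ?V \<inter> \<kappa> s ` ?C" using V region_subset_star by blast
      next
        fix y assume "y \<in> \<kappa> s ` ?V \<inter> \<kappa> s ` ?C"
        then obtain v w where vw: "v \<in> V" "v \<in> star c" "w \<in> ?C" "y = \<kappa> s v" "y = \<kappa> s w" by blast
        have "v \<in> ?C"
        proof (rule ccontr)
          assume "v \<notin> ?C"
          then obtain c' g where g: "g \<in> SL2" "mob g v \<in> region c'" "stratum_dim c < stratum_dim c'"
            using star_reduces vw by blast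
          have "\<kappa> (act g s) (mob g v) = \<kappa> s w"
            using \<kappa>_act[OF s subsetD[OF star_subset_uhp vw(2)] g(1)] vw(4,5) by simp
          then have "c = c'" using \<kappa>_region_eq(1)[OF act_closed[OF g(1) s] s g(2) vw(3)] by simp
          then show False using g by simp
        qed
        then show "y \<in> \<kappa> s ` U" using vw V by blast
      qed
      ultimately show "openin (subtopology T (\<kappa> s ` ?C)) (\<kappa> s ` U)"
        unfolding openin_subtopology by blast
    qed
  qed
  then show ?thesis using homeomorphic_map_imp_homeomorphic_space by blast
qed

text \<open>A point of the closure lies over some stratum \<open>c'\<close>. The image of the star of \<open>c'\<close> is a neighbourhood
of it that meets only the cell of the point itself and cells of dimension larger than that of \<open>c'\<close>.\<close>

lemma cell_frontier:
  assumes s: "s \<in> S" and y: "y \<in> T closure_of (\<kappa> s ` region c) - \<kappa> s ` region c"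
  obtains t c' where "t \<in> S" "stratum_dim c' < stratum_dim c" "y \<in> \<kappa> t ` region c'"
proof -
  have "y \<in> topspace T" using y in_closure_of by fastforce
  then obtain t z where t: "t \<in> S" "z \<in> uhp" "y = \<kappa> t z" using topspace_T by auto
  obtain g where g: "g \<in> SL2" "mob g z \<in> fundamental_domain"
    using reduction_to_fundamental_domain[OF t(2)] .
  define t' w where "t' = act g t" and "w = mob g z"
  obtain c' where w: "w \<in> region c'" using fundamental_domain_regions g w_def by blast
  have t': "t' \<in> S" "y = \<kappa> t' w" using act_closed g t \<kappa>_act t'_def w_def by auto
  have "stratum_dim c' < stratum_dim c"
  proof (rule ccontr)
    assume dim: "\<not> stratum_dim c' < stratum_dim c"
    have "openin T (\<kappa> t' ` star c')"
      using t' open_star star_subset_uhp by (intro open_\<kappa>_image) auto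
    moreover have "y \<in> \<kappa> t' ` star c'" using t' w region_subset_star by blast
    moreover have "\<forall>U. y \<in> U \<and> openin T U \<longrightarrow> (\<exists>x. x \<in> \<kappa> s ` region c \<and> x \<in> U)"
      using DiffD1[OF y] unfolding in_closure_of by (rule conjunct2)
    ultimately obtain x where "x \<in> \<kappa> s ` region c" "x \<in> \<kappa> t' ` star c'" by meson
    then obtain a b where ab: "a \<in> region c" "b \<in> star c'" "\<kappa> s a = \<kappa> t' b" by (metis imageE)
    show False
    proof (cases "b \<in> region c'")
      case True
      then have "\<kappa> s a \<in> \<kappa> s ` region c" "\<kappa> s a \<in> \<kappa> t' ` region c'" using ab by blast+
      then have "\<kappa> t' ` region c' = \<kappa> s ` region c" by (rule cells_eq_or_disjoint(2)[OF s t'(1)])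
      then show False using y t'(2) w by blast
    next
      case False
      then obtain c'' h where h: "h \<in> SL2" "mob h b \<in> region c''" "stratum_dim c' < stratum_dim c''"
        using star_reduces ab by blast
      have "\<kappa> s a = \<kappa> (act h t') (mob h b)"
        using \<kappa>_act[OF t'(1) subsetD[OF star_subset_uhp ab(2)] h(1)] ab(3) by simp
      then have "c'' = c" using \<kappa>_region_eq(1)[OF s act_closed[OF h(1) t'(1)] ab(1) h(2)] by simp
      then show False using h dim by simp
    qed
  qed
  then show thesis using that t' w by blast
qed

definition isotropy :: "stratum \<Rightarrow> 's \<Rightarrow> mat2 set" where
  "isotropy c s = {g \<in> stabilizer c. act g s = s}"

lemma ord_cell: "s \<in> S \<Longrightarrow> y \<in> \<kappa> s ` region c \<Longrightarrow> ord y = card (isotropy c s) div 2"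
proof -
  assume s: "s \<in> S" and "y \<in> \<kappa> s ` region c"
  then obtain z where z: "z \<in> region c" "y = \<kappa> s z" by blast
  have "{g \<in> SL2. mob g z = z \<and> act g s = s} = isotropy c s"
    unfolding isotropy_def using region_stabilizer[OF z(1)] by blast
  then show ?thesis using ord_\<kappa>[OF s region_uhp[OF z(1)]] z by simp
qed

text \<open>The isotropy group is closed under the fixed point free involution \<open>g \<mapsto> -g\<close>, because \<open>-1\<close> acts trivially.\<close>

lemma even_card_isotropy:
  assumes s: "s \<in> S" shows "even (card (isotropy c s))"
proof -
  \<comment> \<open>\<open>P\<close> selects one of \<open>g\<close> and \<open>-g\<close>.\<close>
  define P where "P = (\<lambda>g. m21 g > 0 \<or> m21 g = 0 \<and> m22 g > 0)"
  let ?X = "isotropy c s"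
  have fin: "finite ?X" using finite_stabilizer by (simp add: isotropy_def)
  have neg: "mneg g \<in> ?X" if "g \<in> ?X" for g
  proof -
    have g: "g \<in> stabilizer c" "act g s = s" "g \<in> SL2" using that stabilizer_subset_SL2 by (auto simp: isotropy_def)
    have "mneg g = mmul (Mat (-1) 0 0 (-1)) g" by (cases g) simp
    then have "act (mneg g) s = s" using g s act_mmul[of "Mat (-1) 0 0 (-1)" g s] act_minus_one by simp
    then show ?thesis using g stabilizer_mneg by (simp add: isotropy_def)
  qed
  have P: "P (mneg g) \<longleftrightarrow> \<not> P g" if "g \<in> ?X" for g
  proof -
    have "g \<in> SL2" using that stabilizer_subset_SL2 by (auto simp: isotropy_def)
    then have "m21 g \<noteq> 0 \<or> m22 g \<noteq> 0" by (cases g) auto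
    moreover have "m21 (mneg g) = - m21 g" "m22 (mneg g) = - m22 g" by (cases g, simp)+
    ultimately show ?thesis unfolding P_def by linarith
  qed
  have invol: "mneg (mneg g) = g" for g by (cases g) simp
  have "bij_betw mneg {g \<in> ?X. P g} {g \<in> ?X. \<not> P g}"
    by (rule bij_betw_byWitness[where f' = mneg]) (use neg P invol in auto)
  then have "card {g \<in> ?X. P g} = card {g \<in> ?X. \<not> P g}" by (rule bij_betw_same_card)
  moreover have "card ?X = card {g \<in> ?X. P g} + card {g \<in> ?X. \<not> P g}"
    using fin by (subst card_Un_disjoint[symmetric]) (auto intro: arg_cong[where f = card])
  ultimately show ?thesis by simp
qed

lemma isotropy_nonempty: "s \<in> S \<Longrightarrow> card (isotropy c s) > 0"
proof -
  assume "s \<in> S"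
  then have "Mat 1 0 0 1 \<in> isotropy c s" using act_one by (cases c) (auto simp: isotropy_def)
  then show ?thesis using finite_stabilizer by (auto simp: isotropy_def card_gt_0_iff)
qed

text \<open>The indices \<open>t\<close> that give the same cell as \<open>s\<close> form the orbit of \<open>s\<close> under the stabilizer of the
stratum.\<close>

lemma orbit_stabilizer:
  assumes s: "s \<in> S"
  shows "card (stabilizer c) = card {t \<in> S. \<kappa> t ` region c = \<kappa> s ` region c} * card (isotropy c s)"
proof -
  let ?G = "stabilizer c"
  have orbit: "(\<lambda>g. act g s) ` ?G = {t \<in> S. \<kappa> t ` region c = \<kappa> s ` region c}"
  proof (intro equalityI subsetI)
    fix t assume "t \<in> (\<lambda>g. act g s) ` ?G"
    then obtain g where g: "g \<in> ?G" "t = act g s" by (rule imageE)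
    then have "t \<in> S" using act_closed[OF _ s] stabilizer_subset_SL2 by (simp add: subset_iff)
    then show "t \<in> {t \<in> S. \<kappa> t ` region c = \<kappa> s ` region c}"
      using \<kappa>_region_act[OF s g(1)] g(2) by simp
  next
    fix t assume "t \<in> {t \<in> S. \<kappa> t ` region c = \<kappa> s ` region c}"
    then have "\<exists>g\<in>?G. act g s = t" using cells_eq_iff[OF s, of t c] by simp
    then show "t \<in> (\<lambda>g. act g s) ` ?G" by (rule bexE) (rule image_eqI, rule sym)
  qed
  have "card ?G = (\<Sum>g\<in>?G. 1)" by simp
  also have "\<dots> = (\<Sum>t\<in>(\<lambda>g. act g s) ` ?G. \<Sum>g\<in>{g \<in> ?G. act g s = t}. 1)"
    by (rule sum.image_gen[OF finite_stabilizer])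
  also have "\<dots> = (\<Sum>t\<in>(\<lambda>g. act g s) ` ?G. card (isotropy c s))"
  proof (rule sum.cong[OF refl])
    fix t assume "t \<in> (\<lambda>g. act g s) ` ?G"
    then obtain g where g: "g \<in> ?G" "t = act g s" by blast
    have gS: "g \<in> SL2" "minv g \<in> SL2" using g stabilizer_subset_SL2 minv_SL2 by auto
    have undo: "act (minv g) t = s"
      using act_mmul[OF gS(2,1) s] minv_mmul[OF gS(1)] act_one[OF s] g by simp
    have "bij_betw (mmul g) (isotropy c s) {h \<in> ?G. act h s = t}"
    proof (rule bij_betw_byWitness[where f' = "mmul (minv g)"])
      show "\<forall>h\<in>isotropy c s. mmul (minv g) (mmul g h) = h"
        using mmul_assoc minv_mmul[OF gS(1)] mmul_one by metis
      show "\<forall>h\<in>{h \<in> ?G. act h s = t}. mmul g (mmul (minv g) h) = h"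
        using mmul_assoc mmul_minv[OF gS(1)] mmul_one by metis
      show "mmul g ` isotropy c s \<subseteq> {h \<in> ?G. act h s = t}"
      proof (rule image_subsetI)
        fix h assume "h \<in> isotropy c s"
        then have h: "h \<in> ?G" "act h s = s" by (simp_all add: isotropy_def)
        then have "h \<in> SL2" using stabilizer_subset_SL2 by (rule_tac subsetD)
        then have "act (mmul g h) s = t" using act_mmul[OF gS(1) _ s, of h] h g by simp
        then show "mmul g h \<in> {h \<in> ?G. act h s = t}" using stabilizer_mmul[OF g(1) h(1)] by simp
      qed
      show "mmul (minv g) ` {h \<in> ?G. act h s = t} \<subseteq> isotropy c s"
      proof (rule image_subsetI)
        fix h assume "h \<in> {h \<in> ?G. act h s = t}"
        then have h: "h \<in> ?G" "act h s = t" by simp_all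
        then have "h \<in> SL2" using stabilizer_subset_SL2 by (rule_tac subsetD)
        then have "act (mmul (minv g) h) s = s" using act_mmul[OF gS(2) _ s, of h] h undo by simp
        then show "mmul (minv g) h \<in> isotropy c s"
          using stabilizer_mmul[OF stabilizer_minv[OF g(1)] h(1)] by (simp add: isotropy_def)
      qed
    qed
    then show "(\<Sum>g\<in>{g \<in> ?G. act g s = t}. 1) = card (isotropy c s)"
      using bij_betw_same_card by force
  qed
  also have "\<dots> = card ((\<lambda>g. act g s) ` ?G) * card (isotropy c s)" by simp
  finally show ?thesis unfolding orbit .
qed

definition cells :: "stratum \<Rightarrow> 'w set set" where
  "cells c = (\<lambda>s. \<kappa> s ` region c) ` S"

text \<open>By the orbit-stabilizer theorem a cell contributes \<open>2 / \<bar>stabilizer\<bar>\<close> for each index \<open>s\<close> that gives it; the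
factor \<open>2\<close> is the trivially acting group \<open>{1, -1}\<close>.\<close>

lemma sum_inverse_ord_cells:
  assumes n: "\<And>C s. s \<in> S \<Longrightarrow> C = \<kappa> s ` region c \<Longrightarrow> n C = card (isotropy c s) div 2"
  shows "(\<Sum>C\<in>cells c. 1 / real (n C)) = 2 * real (card S) / real (card (stabilizer c))"
proof -
  have "(\<Sum>C\<in>cells c. 1 / real (n C)) =
    (\<Sum>C\<in>cells c. 2 / real (card (stabilizer c)) * (\<Sum>s\<in>{s \<in> S. \<kappa> s ` region c = C}. 1))"
  proof (rule sum.cong[OF refl])
    fix C assume "C \<in> cells c"
    then obtain s where s: "s \<in> S" "C = \<kappa> s ` region c" by (auto simp: cells_def)
    define N where "N = card (isotropy c s)"
    have N: "N > 0" "real (n C) = real N / 2"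
      using isotropy_nonempty[OF s(1), of c] n[OF s] even_card_isotropy[OF s(1), of c]
      by (auto simp: N_def elim!: evenE)
    define k where "k = (\<Sum>s\<in>{s \<in> S. \<kappa> s ` region c = C}. 1 :: real)"
    have k: "real (card (stabilizer c)) = k * real N"
      using orbit_stabilizer[OF s(1), of c] by (simp add: N_def s(2) k_def)
    moreover have "card (stabilizer c) > 0" by (cases c) auto
    ultimately have "0 < k * real N" by (metis of_nat_0_less_iff)
    then have "k > 0" using N(1) by (simp add: zero_less_mult_iff)
    then show "1 / real (n C) = 2 / real (card (stabilizer c)) * (\<Sum>s\<in>{s \<in> S. \<kappa> s ` region c = C}. 1)"
      unfolding k_def[symmetric] k N(2) using N(1) by (simp add: field_simps)
  qed
  also have "\<dots> = 2 / real (card (stabilizer c)) * (\<Sum>C\<in>cells c. \<Sum>s\<in>{s \<in> S. \<kappa> s ` region c = C}. 1)"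
    by (simp only: sum_distrib_left)
  also have "(\<Sum>C\<in>cells c. \<Sum>s\<in>{s \<in> S. \<kappa> s ` region c = C}. 1) = (\<Sum>s\<in>S. 1 :: real)"
    unfolding cells_def by (rule sum.image_gen[OF finite_S, symmetric])
  finally show ?thesis by simp
qed

text \<open>The stabilizers of the five strata have orders \<open>2, 2, 2, 4, 6\<close>, so that the alternating sum is
\<open>\<bar>S\<bar> (1 - 1 - 1 + 1/2 + 1/3) = -\<bar>S\<bar>/6\<close>.\<close>

theorem orbifold_euler_char: "has_orbifold_euler_char T ord (- real (card S) / 6)"
proof -
  \<comment> \<open>A cell, as a set, lies over a single stratum (\<open>label\<close> below), and all its points have the same isotropy order.\<close>
  define d where "d = (\<lambda>C. stratum_dim (THE c. C \<in> cells c))"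
  define n where "n = (\<lambda>C. ord (SOME y. y \<in> C))"
  have label: "c' = c" if "C \<in> cells c" "C \<in> cells c'" for C c c'
  proof -
    obtain s t where st: "s \<in> S" "t \<in> S" "C = \<kappa> s ` region c" "C = \<kappa> t ` region c'"
      using \<open>C \<in> cells c\<close> \<open>C \<in> cells c'\<close> by (auto simp: cells_def)
    obtain y where "y \<in> C" using region_nonempty[of c] st by blast
    then show ?thesis using cells_eq_or_disjoint(1) st by blast
  qed
  have d: "d C = stratum_dim c" if "C \<in> cells c" for C c
    unfolding d_def using the_equality[of "\<lambda>c. C \<in> cells c" c] that label by metis
  have n: "n C = card (isotropy c s) div 2" if "s \<in> S" "C = \<kappa> s ` region c" for C s c
  proof -
    have "C \<noteq> {}" using region_nonempty[of c] that by blast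
    then have "(SOME y. y \<in> C) \<in> C" using some_in_eq by blast
    then show ?thesis unfolding n_def using ord_cell that by blast
  qed
  have fin: "finite (cells c)" for c using finite_S by (simp add: cells_def)
  have finU: "finite (UNIV :: stratum set)" unfolding UNIV_stratum by simp
  let ?\<C> = "\<Union>c. cells c"
  have "finite ?\<C>" using fin finU by blast
  moreover have "disjoint ?\<C>"
  proof (rule disjointI)
    fix C C' assume C: "C \<in> ?\<C>" and C': "C' \<in> ?\<C>" and ne: "C \<noteq> C'"
    obtain c s where s: "s \<in> S" "C = \<kappa> s ` region c" using C unfolding cells_def by blast
    obtain c' t where t: "t \<in> S" "C' = \<kappa> t ` region c'" using C' unfolding cells_def by blast
    from s t show "C \<inter> C' = {}" using cells_eq_or_disjoint(2) ne by blast
  qed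
  moreover have "\<Union>?\<C> = topspace T"
  proof (intro equalityI subsetI)
    fix y assume "y \<in> \<Union>?\<C>"
    then obtain c s z where "s \<in> S" "z \<in> region c" "y = \<kappa> s z" unfolding cells_def by blast
    then show "y \<in> topspace T" unfolding topspace_T using region_uhp by blast
  next
    fix y assume "y \<in> topspace T"
    then obtain t z where t: "t \<in> S" "z \<in> uhp" "y = \<kappa> t z" using topspace_T by auto
    obtain g where g: "g \<in> SL2" "mob g z \<in> fundamental_domain"
      using reduction_to_fundamental_domain[OF t(2)] .
    obtain c where "mob g z \<in> region c" using fundamental_domain_regions g by blast
    moreover have "y = \<kappa> (act g t) (mob g z)" using \<kappa>_act t g by simp
    ultimately have "y \<in> \<kappa> (act g t) ` region c" by blast
    then show "y \<in> \<Union>?\<C>" using act_closed[OF g(1) t(1)] unfolding cells_def by blast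
  qed
  moreover have "\<forall>C\<in>?\<C>. subtopology T C homeomorphic_space Euclidean_space (d C) \<and>
      T closure_of C - C \<subseteq> \<Union>{C'\<in>?\<C>. d C' < d C} \<and> n C > 0 \<and> (\<forall>y\<in>C. ord y = n C)"
  proof
    fix C assume C: "C \<in> ?\<C>"
    obtain c s where s: "s \<in> S" "C = \<kappa> s ` region c" using C by (auto simp: cells_def)
    have dC: "d C = stratum_dim c" using d s by (auto simp: cells_def)
    have nC: "n C = card (isotropy c s) div 2" using n s by blast
    have "subtopology T C homeomorphic_space Euclidean_space (d C)"
      using cell_homeomorphic_region[OF s(1), of c] region_homeomorphic_Euclidean_space[of c] dC s(2)
        homeomorphic_space_sym homeomorphic_space_trans by metis
    moreover have "T closure_of C - C \<subseteq> \<Union>{C'\<in>?\<C>. d C' < d C}"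
    proof
      fix y assume "y \<in> T closure_of C - C"
      then obtain t c' where t: "t \<in> S" "stratum_dim c' < stratum_dim c" "y \<in> \<kappa> t ` region c'"
        using cell_frontier[OF s(1)] s(2) by metis
      then have "\<kappa> t ` region c' \<in> cells c'" by (auto simp: cells_def)
      then show "y \<in> \<Union>{C'\<in>?\<C>. d C' < d C}" using t d dC by fastforce
    qed
    moreover have "n C > 0"
    proof -
      obtain k where "card (isotropy c s) = 2 * k" using even_card_isotropy[OF s(1), of c] by (rule evenE)
      then show ?thesis using isotropy_nonempty[OF s(1), of c] nC by simp
    qed
    moreover have "\<forall>y\<in>C. ord y = n C"
    proof
      fix y assume "y \<in> C"
      then show "ord y = n C" using ord_cell[OF s(1), of y c] s(2) nC by simp
    qed
    ultimately show "subtopology T C homeomorphic_space Euclidean_space (d C) \<and>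
      T closure_of C - C \<subseteq> \<Union>{C'\<in>?\<C>. d C' < d C} \<and> n C > 0 \<and> (\<forall>y\<in>C. ord y = n C)"
      by (intro conjI)
  qed
  moreover have "- real (card S) / 6 = (\<Sum>C\<in>?\<C>. (- 1) ^ d C / real (n C))"
  proof -
    have "(\<Sum>C\<in>?\<C>. (- 1) ^ d C / real (n C)) = (\<Sum>c\<in>UNIV. \<Sum>C\<in>cells c. (- 1) ^ d C / real (n C))"
      using fin finU label by (intro sum.UNION_disjoint) auto
    also have "\<dots> = (\<Sum>c\<in>UNIV. (- 1) ^ stratum_dim c * (2 * real (card S) / real (card (stabilizer c))))"
    proof (rule sum.cong[OF refl])
      fix c
      have "(\<Sum>C\<in>cells c. (- 1) ^ d C / real (n C)) = (- 1) ^ stratum_dim c * (\<Sum>C\<in>cells c. 1 / real (n C))"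
        unfolding sum_distrib_left by (intro sum.cong refl) (simp add: d)
      then show "(\<Sum>C\<in>cells c. (- 1) ^ d C / real (n C)) =
          (- 1) ^ stratum_dim c * (2 * real (card S) / real (card (stabilizer c)))"
        using sum_inverse_ord_cells[of c n] n by simp
    qed
    also have "\<dots> = - real (card S) / 6" unfolding UNIV_stratum by simp
    finally show ?thesis ..
  qed
  ultimately show ?thesis unfolding has_orbifold_euler_char_def
    by - (rule exI[of _ ?\<C>], rule exI[of _ d], rule exI[of _ n], intro conjI)
qed

end

section \<open>Counting Hermite normal forms\<close>

text \<open>The triple \<open>(a, b, d)\<close> stands for the matrix with rows \<open>(a, b)\<close> and \<open>(0, d)\<close>, in Hermite normal form.\<close>

definition hnf_triples :: "nat \<Rightarrow> (nat \<times> nat \<times> nat) set" where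
  "hnf_triples n = {(a, b, d). a * d = n \<and> b < d}"

definition triple_content :: "nat \<times> nat \<times> nat \<Rightarrow> nat" where
  "triple_content = (\<lambda>(a, b, d). gcd (gcd a b) d)"

lemma finite_hnf_triples:
  assumes "n > 0" shows "finite (hnf_triples n)"
proof -
  have "hnf_triples n \<subseteq> {..n} \<times> {..n} \<times> {..n}"
  proof (rule subsetI)
    fix t assume "t \<in> hnf_triples n"
    then obtain a b d where t: "t = (a, b, d)" "a * d = n" "b < d" by (auto simp: hnf_triples_def)
    have "a dvd n" "d dvd n" using t by auto
    then have "a \<le> n" "d \<le> n" using assms by (auto intro: dvd_imp_le)
    then show "t \<in> {..n} \<times> {..n} \<times> {..n}" using t by simp
  qed
  then show ?thesis by (rule finite_subset) simp
qed

text \<open>Coprimality to \<open>g\<close> depends only on the residue modulo \<open>g\<close>, and \<open>{0..<g * k}\<close> consists of \<open>k\<close> full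
periods.\<close>

lemma card_coprime_below_multiple:
  fixes g k :: nat
  assumes "g > 0"
  shows "card {b. b < g * k \<and> coprime b g} = k * totient g"
proof -
  have base: "card {r. r < g \<and> coprime r g} = totient g"
  proof (cases "g = 1")
    case True
    then have "{r. r < g \<and> coprime r g} = {0}" by auto
    then show ?thesis using True by simp
  next
    case False
    then have "{r. r < g \<and> coprime r g} = totatives g"
      using assms by (auto simp: totatives_def intro: Nat.gr0I le_neq_trans)
    then show ?thesis by (simp add: totient_def)
  qed
  have "bij_betw (\<lambda>(i, r). g * i + r) ({..<k} \<times> {r. r < g \<and> coprime r g}) {b. b < g * k \<and> coprime b g}"
  proof (rule bij_betw_byWitness[where f' = "\<lambda>b. (b div g, b mod g)"])
    show "\<forall>x\<in>{..<k} \<times> {r. r < g \<and> coprime r g}.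
        (\<lambda>b. (b div g, b mod g)) ((\<lambda>(i, r). g * i + r) x) = x" using assms by auto
    show "\<forall>b\<in>{b. b < g * k \<and> coprime b g}. (\<lambda>(i, r). g * i + r) (b div g, b mod g) = b" by simp
    show "(\<lambda>(i, r). g * i + r) ` ({..<k} \<times> {r. r < g \<and> coprime r g}) \<subseteq> {b. b < g * k \<and> coprime b g}"
    proof clarify
      fix i r assume *: "i < k" "r < g" "coprime r g"
      have "g * i + r < g * i + g" using * by simp
      also have "\<dots> = g * Suc i" by simp
      also have "\<dots> \<le> g * k" using * by (intro mult_le_mono) auto
      finally have "g * i + r < g * k" .
      moreover have "coprime (g * i + r) g"
        using * by (metis coprime_iff_gcd_eq_1 gcd.commute gcd_add_mult mult.commute add.commute)
      ultimately show "g * i + r < g * k \<and> coprime (g * i + r) g" ..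
    qed
    show "(\<lambda>b. (b div g, b mod g)) ` {b. b < g * k \<and> coprime b g} \<subseteq> {..<k} \<times> {r. r < g \<and> coprime r g}"
      using assms by (auto simp: less_mult_imp_div_less mult.commute coprime_mod_left_iff)
  qed
  from bij_betw_same_card[OF this] base show ?thesis by (simp add: card_cartesian_product)
qed

text \<open>The number of \<open>b < d\<close> for which \<open>(a, b, d)\<close> is primitive: \<open>b\<close> has to be coprime to \<open>gcd d a\<close>.\<close>

definition cusp_weight :: "nat \<Rightarrow> nat \<Rightarrow> nat" where
  "cusp_weight d a = d div gcd d a * totient (gcd d a)"

text \<open>Dedekind's function \<open>n \<Prod>\<^sub>p\<^sub>|\<^sub>n (1 + 1/p)\<close>, in the form in which the count of primitive matrices of
determinant \<open>n\<close> produces it.\<close>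

definition dedekind_psi :: "nat \<Rightarrow> nat" where
  "dedekind_psi n = (\<Sum>d | d dvd n. cusp_weight d (n div d))"

lemma card_primitive_hnf_triples:
  assumes n: "n > 0"
  shows "card {t \<in> hnf_triples n. triple_content t = 1} = dedekind_psi n"
proof -
  let ?B = "\<lambda>d. {b. b < d \<and> coprime b (gcd d (n div d))}"
  have eq: "{t \<in> hnf_triples n. triple_content t = 1} = (\<lambda>(d, b). (n div d, b, d)) ` (SIGMA d:{d. d dvd n}. ?B d)"
  proof (intro equalityI subsetI)
    fix t assume "t \<in> {t \<in> hnf_triples n. triple_content t = 1}"
    then obtain a b d where t: "t = (a, b, d)" "a * d = n" "b < d" "gcd (gcd a b) d = 1"
      by (auto simp: hnf_triples_def triple_content_def)
    have "d > 0" using t by simp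
    then have a: "n div d = a" "d dvd n" using t(2) by auto
    have "coprime b (gcd d a)" using t(4) by (simp add: coprime_iff_gcd_eq_1 gcd.commute gcd.left_commute)
    then have "(d, b) \<in> (SIGMA d:{d. d dvd n}. ?B d)" using a t by simp
    then show "t \<in> (\<lambda>(d, b). (n div d, b, d)) ` (SIGMA d:{d. d dvd n}. ?B d)"
      using a t by (intro image_eqI[of _ _ "(d, b)"]) auto
  next
    fix t assume "t \<in> (\<lambda>(d, b). (n div d, b, d)) ` (SIGMA d:{d. d dvd n}. ?B d)"
    then obtain d b where t: "t = (n div d, b, d)" "d dvd n" "b < d" "coprime b (gcd d (n div d))" by auto
    then have "gcd (gcd (n div d) b) d = 1"
      by (simp add: coprime_iff_gcd_eq_1 gcd.commute gcd.left_commute)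
    then show "t \<in> {t \<in> hnf_triples n. triple_content t = 1}"
      using t by (simp add: hnf_triples_def triple_content_def)
  qed
  have "card {t \<in> hnf_triples n. triple_content t = 1} = card (SIGMA d:{d. d dvd n}. ?B d)"
    unfolding eq by (rule card_image) (auto simp: inj_on_def)
  also have "\<dots> = (\<Sum>d | d dvd n. card (?B d))"
    using n by (intro card_SigmaI) (auto simp: finite_divisors_nat)
  also have "\<dots> = dedekind_psi n" unfolding dedekind_psi_def
  proof (rule sum.cong[OF refl])
    fix d assume "d \<in> {d. d dvd n}"
    then have d: "d > 0" using n by (auto intro: Nat.gr0I)
    let ?g = "gcd d (n div d)"
    have "?g * (d div ?g) = d" by simp
    then show "card (?B d) = cusp_weight d (n div d)"
      using card_coprime_below_multiple[of ?g "d div ?g"] d by (simp add: cusp_weight_def)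
  qed
  finally show ?thesis .
qed

lemma cusp_weight_mult:
  assumes "coprime (d1 * a1) (d2 * a2)"
  shows "cusp_weight (d1 * d2) (a1 * a2) = cusp_weight d1 a1 * cusp_weight d2 a2"
proof -
  have co: "coprime d1 d2" "coprime d1 a2" "coprime a1 d2" "coprime a1 a2" using assms by auto
  have g: "gcd (d1 * d2) (a1 * a2) = gcd d1 a1 * gcd d2 a2"
  proof (rule dvd_antisym)
    obtain g1 g2 where g: "gcd (d1 * d2) (a1 * a2) = g1 * g2" "g1 dvd d1" "g2 dvd d2"
      using division_decomp gcd_dvd1 by meson
    have "g1 * g2 dvd a1 * a2" by (metis g(1) gcd_dvd2)
    then have "g1 dvd a1 * a2" "g2 dvd a1 * a2" using dvd_mult_left dvd_mult_right by blast+
    moreover have "coprime g1 a2" "coprime g2 a1"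
      using co g coprime_divisors[OF _ dvd_refl] coprime_commute by metis+
    ultimately have "g1 dvd a1" "g2 dvd a2"
      by (simp_all add: coprime_dvd_mult_left_iff coprime_dvd_mult_right_iff)
    then show "gcd (d1 * d2) (a1 * a2) dvd gcd d1 a1 * gcd d2 a2"
      unfolding g(1) using g(2,3) by (intro mult_dvd_mono gcd_greatest)
    show "gcd d1 a1 * gcd d2 a2 dvd gcd (d1 * d2) (a1 * a2)" by (simp add: mult_dvd_mono)
  qed
  have co': "coprime (gcd d1 a1) (gcd d2 a2)"
    using co(1) by (rule coprime_divisors[rotated 2]) auto
  have "d1 * d2 div (gcd d1 a1 * gcd d2 a2) = (d1 div gcd d1 a1) * (d2 div gcd d2 a2)"
    by (rule div_mult_div_if_dvd[symmetric]) auto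
  then show ?thesis unfolding cusp_weight_def g using totient_mult_coprime[OF co'] by simp
qed

text \<open>The divisors of \<open>m n\<close> are the products of a divisor of \<open>m\<close> and one of \<open>n\<close>, and the weights are
multiplicative.\<close>

lemma dedekind_psi_mult:
  assumes "coprime m n" "m > 0" "n > 0"
  shows "dedekind_psi (m * n) = dedekind_psi m * dedekind_psi n"
proof -
  let ?D = "\<lambda>n. {d. d dvd n} :: nat set"
  have inj: "inj_on (\<lambda>(c, d). c * d) (?D m \<times> ?D n)"
  proof (rule inj_onI, clarify)
    fix c d c' d' assume *: "c dvd m" "d dvd n" "c' dvd m" "d' dvd n" "c * d = c' * d'"
    have co: "coprime c d'" "coprime c' d" using * assms(1) coprime_divisors by blast+
    have "c dvd c' * d'" "c' dvd c * d" using *(5) by (metis dvd_triv_left)+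
    then have "c dvd c'" "c' dvd c" using co by (simp_all add: coprime_dvd_mult_left_iff)
    then have "c = c'" by (rule dvd_antisym)
    moreover have "c > 0" using * assms by (auto intro: Nat.gr0I)
    ultimately show "c = c' \<and> d = d'" using * by simp
  qed
  have img: "(\<lambda>(c, d). c * d) ` (?D m \<times> ?D n) = ?D (m * n)"
  proof (intro equalityI subsetI)
    fix x assume "x \<in> ?D (m * n)"
    then obtain c d where "x = c * d" "c dvd m" "d dvd n" using division_decomp[of x m n] by auto
    then show "x \<in> (\<lambda>(c, d). c * d) ` (?D m \<times> ?D n)" by force
  qed (auto intro: mult_dvd_mono)
  have "dedekind_psi (m * n) = (\<Sum>(c, d)\<in>?D m \<times> ?D n. cusp_weight (c * d) (m * n div (c * d)))"
    unfolding dedekind_psi_def img[symmetric] by (subst sum.reindex[OF inj]) (simp add: case_prod_unfold)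
  also have "\<dots> = (\<Sum>(c, d)\<in>?D m \<times> ?D n. cusp_weight c (m div c) * cusp_weight d (n div d))"
  proof (rule sum.cong[OF refl], clarify)
    fix c d assume *: "c dvd m" "d dvd n"
    have "m * n div (c * d) = (m div c) * (n div d)" using * by (rule div_mult_div_if_dvd[symmetric])
    moreover have "coprime (c * (m div c)) (d * (n div d))" using * assms(1) by simp
    ultimately show "cusp_weight (c * d) (m * n div (c * d)) = cusp_weight c (m div c) * cusp_weight d (n div d)"
      using cusp_weight_mult by simp
  qed
  also have "\<dots> = dedekind_psi m * dedekind_psi n"
    unfolding dedekind_psi_def by (simp add: sum_product sum.cartesian_product)
  finally show ?thesis .
qed

text \<open>For \<open>0 < i < k\<close> the divisor \<open>p\<^sup>i\<close> has weight \<open>p\<^sup>i - p\<^bsup>i-1\<^esup>\<close>, whatever the gcd is, so the sum over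
\<open>i < k\<close> telescopes to \<open>p\<^bsup>k-1\<^esup>\<close>; the divisor \<open>p\<^sup>k\<close> has weight \<open>p\<^sup>k\<close>.\<close>

lemma dedekind_psi_prime_power:
  assumes p: "prime p" and k: "k > 0"
  shows "dedekind_psi (p ^ k) = p ^ k + p ^ (k - 1)"
proof -
  have p1: "p > 1" using p by (rule prime_gt_1_nat)
  have "{d. d dvd p ^ k} = (\<lambda>i. p ^ i) ` {..k}" using divides_primepow_nat[OF p] by auto
  moreover have "inj_on (\<lambda>i. p ^ i) {..k}" using p1 by (auto simp: inj_on_def)
  ultimately have "dedekind_psi (p ^ k) = (\<Sum>i\<le>k. cusp_weight (p ^ i) (p ^ k div p ^ i))"
    unfolding dedekind_psi_def by (simp add: sum.reindex)
  also have "\<dots> = (\<Sum>i\<le>k. if i = 0 then 1 else if i = k then p ^ k else p ^ i - p ^ (i - 1))"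
  proof (rule sum.cong[OF refl])
    fix i assume "i \<in> {..k}"
    then have i: "i \<le> k" by simp
    then have div: "p ^ k div p ^ i = p ^ (k - i)" using p1 by (simp add: power_diff)
    define j where "j = min i (k - i)"
    have g: "gcd (p ^ i) (p ^ (k - i)) = p ^ j"
    proof (cases "i \<le> k - i")
      case True
      then have "p ^ i dvd p ^ (k - i)" by (rule le_imp_power_dvd)
      then show ?thesis using True by (simp add: j_def gcd_proj1_iff min_def)
    next
      case False
      then have "p ^ (k - i) dvd p ^ i" by (intro le_imp_power_dvd) simp
      then show ?thesis using False by (simp add: j_def gcd_proj2_iff min_def)
    qed
    show "cusp_weight (p ^ i) (p ^ k div p ^ i) =
        (if i = 0 then 1 else if i = k then p ^ k else p ^ i - p ^ (i - 1))"
    proof (cases "i = 0 \<or> i = k")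
      case True
      then show ?thesis using p1 unfolding cusp_weight_def div by auto
    next
      case False
      then have j: "j > 0" "j \<le> i" using i by (auto simp: j_def)
      have "cusp_weight (p ^ i) (p ^ k div p ^ i) = p ^ (i - j) * (p ^ (j - 1) * (p - 1))"
        unfolding cusp_weight_def div g using p j p1 by (simp add: totient_prime_power power_diff)
      also have "\<dots> = p ^ (i - j + (j - 1)) * (p - 1)" by (simp add: power_add)
      also have "i - j + (j - 1) = i - 1" using j by simp
      also have "p ^ (i - 1) * (p - 1) = p ^ i - p ^ (i - 1)"
        using j by (cases i) (simp_all add: algebra_simps)
      finally show ?thesis using False by simp
    qed
  qed
  also have "\<dots> = p ^ k + p ^ (k - 1)"
  proof -
    have tele: "(\<Sum>i\<le>m. if i = 0 then 1 else p ^ i - p ^ (i - 1)) = p ^ m" for m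
      using p1 by (induction m) (auto simp: power_increasing le_add_diff_inverse2 add.commute)
    obtain l where l: "k = Suc l" using k by (cases k) auto
    have "(\<Sum>i\<le>k. if i = 0 then 1 else if i = k then p ^ k else p ^ i - p ^ (i - 1))
       = (\<Sum>i\<le>l. if i = 0 then 1 else p ^ i - p ^ (i - 1)) + p ^ k"
      unfolding l by (simp add: sum.atMost_Suc) (rule sum.cong, auto)
    then show ?thesis using tele[of l] l by simp
  qed
  finally show ?thesis .
qed

lemma c_fun_mult:
  assumes "coprime m n" "m > 0" "n > 0"
  shows "c_fun (m * n) = c_fun m * c_fun n"
proof -
  have "prime_factors (m * n) = prime_factors m \<union> prime_factors n"
    using assms by (intro prime_factors_product) auto
  moreover have "prime_factors m \<inter> prime_factors n = {}"
    using coprime_common_divisor[OF assms(1)] not_prime_unit by (auto simp: prime_factors_dvd)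
  ultimately show ?thesis
    unfolding c_fun_def by (simp add: prod.union_disjoint)
qed

text \<open>Both sides are multiplicative and agree on prime powers; the induction splits off the full power of
one prime.\<close>

lemma dedekind_psi_eq_c_fun:
  assumes "n > 0" shows "real (dedekind_psi n) = c_fun n"
  using assms
proof (induction n rule: less_induct)
  case (less n)
  show ?case
  proof (cases "n = 1")
    case True
    have "dedekind_psi 1 = 1" by (simp add: dedekind_psi_def cusp_weight_def)
    then show ?thesis using True by (simp add: c_fun_def)
  next
    case False
    then obtain p where p: "prime p" "p dvd n" using prime_factor_nat by blast
    define k where "k = multiplicity p n"
    obtain m where m: "n = p ^ k * m" "\<not> p dvd m"
      using multiplicity_decompose'[of n p] less.prems p k_def by (metis not_prime_unit not_gr_zero)
    have k: "k > 0" using p less.prems unfolding k_def by (simp add: prime_multiplicity_gt_zero_iff)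
    have m0: "m > 0" using less.prems m by (auto intro: Nat.gr0I)
    have pk: "p ^ k > 1" using prime_gt_1_nat[OF p(1)] k by (rule one_less_power)
    then have "m < n" using m(1) m0 by simp
    then have IH: "real (dedekind_psi m) = c_fun m" using less.IH m0 by blast
    have co: "coprime (p ^ k) m" using m(2) p(1) by (simp add: prime_imp_coprime)
    have "prime_factors (p ^ k) = {p}" using p(1) k by (simp add: prime_factors_power prime_prime_factors)
    then have "c_fun (p ^ k) = real (p ^ k) * (1 + 1 / real p)" by (simp add: c_fun_def)
    also have "\<dots> = real (p ^ k) + real (p ^ (k - 1))"
      using k prime_gt_0_nat[OF p(1)] by (cases k) (simp_all add: field_simps)
    also have "\<dots> = real (dedekind_psi (p ^ k))" using dedekind_psi_prime_power[OF p(1) k] by simp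
    finally have cp: "c_fun (p ^ k) = real (dedekind_psi (p ^ k))" .
    have pk0: "p ^ k > 0" using pk by linarith
    have "real (dedekind_psi n) = c_fun (p ^ k) * c_fun m"
      unfolding m(1) dedekind_psi_mult[OF co pk0 m0] cp IH[symmetric] by simp
    then show ?thesis unfolding m(1) c_fun_mult[OF co pk0 m0] .
  qed
qed

text \<open>Division by the content \<open>r\<close> maps these triples bijectively to the primitive ones of determinant
\<open>n / r\<^sup>2\<close>.\<close>

lemma card_hnf_triples_content:
  assumes n: "n > 0" and r: "r\<^sup>2 dvd n" "r > 0"
  shows "card {t \<in> hnf_triples n. triple_content t = r} = dedekind_psi (n div r\<^sup>2)"
proof -
  let ?f = "\<lambda>(a, b, d). (r * a, r * b, r * d) :: nat \<times> nat \<times> nat"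
  have "{t \<in> hnf_triples n. triple_content t = r} = ?f ` {t \<in> hnf_triples (n div r\<^sup>2). triple_content t = 1}"
  proof (intro equalityI subsetI)
    fix t assume "t \<in> {t \<in> hnf_triples n. triple_content t = r}"
    then obtain a b d where t: "t = (a, b, d)" "a * d = n" "b < d" "gcd (gcd a b) d = r"
      by (auto simp: hnf_triples_def triple_content_def)
    have "r dvd gcd a b" "r dvd d"
      unfolding t(4)[symmetric] by (rule gcd_dvd1, rule gcd_dvd2)
    then have "r dvd a" "r dvd b" "r dvd d" using gcd_dvd1 gcd_dvd2 dvd_trans by blast+
    then obtain a' b' d' where *: "a = r * a'" "b = r * b'" "d = r * d'" by (metis dvdE)
    have "n = r\<^sup>2 * (a' * d')" unfolding t(2)[symmetric] * by (simp add: power2_eq_square)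
    then have "a' * d' = n div r\<^sup>2" using r by simp
    moreover have "r * gcd (gcd a' b') d' = r" using t(4) unfolding * by (simp add: gcd_mult_distrib_nat)
    ultimately have "(a', b', d') \<in> {t \<in> hnf_triples (n div r\<^sup>2). triple_content t = 1}"
      using r t(3) * by (simp add: hnf_triples_def triple_content_def)
    then show "t \<in> ?f ` {t \<in> hnf_triples (n div r\<^sup>2). triple_content t = 1}"
      using t * by (intro image_eqI[of _ _ "(a', b', d')"]) auto
  next
    fix t assume "t \<in> ?f ` {t \<in> hnf_triples (n div r\<^sup>2). triple_content t = 1}"
    then obtain a b d where t: "t = (r * a, r * b, r * d)" "a * d = n div r\<^sup>2" "b < d" "gcd (gcd a b) d = 1"
      by (auto simp: hnf_triples_def triple_content_def)
    have "r * a * (r * d) = r\<^sup>2 * (a * d)" by (simp add: power2_eq_square)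
    also have "\<dots> = n" using t(2) r by simp
    finally have "r * a * (r * d) = n" .
    moreover have "gcd (gcd (r * a) (r * b)) (r * d) = r * gcd (gcd a b) d"
      by (simp add: gcd_mult_distrib_nat)
    ultimately show "t \<in> {t \<in> hnf_triples n. triple_content t = r}"
      using t r by (simp add: hnf_triples_def triple_content_def)
  qed
  moreover have "inj_on ?f {t \<in> hnf_triples (n div r\<^sup>2). triple_content t = 1}"
    using r by (auto simp: inj_on_def)
  ultimately have "card {t \<in> hnf_triples n. triple_content t = r} = card {t \<in> hnf_triples (n div r\<^sup>2). triple_content t = 1}"
    by (simp add: card_image)
  also have "n div r\<^sup>2 > 0" using n r by (simp add: dvd_imp_le div_greater_zero_iff)
  then have "card {t \<in> hnf_triples (n div r\<^sup>2). triple_content t = 1} = dedekind_psi (n div r\<^sup>2)"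
    by (rule card_primitive_hnf_triples)
  finally show ?thesis .
qed

text \<open>The square of the content divides the determinant, hence the content runs through divisors of the
square part of \<open>n\<close>, which is the \<open>f\<close> in \<open>n = f\<^sup>2 q\<close>.\<close>

lemma card_hnf_triples_coprime:
  assumes n: "n > 0"
  shows "real (card {t \<in> hnf_triples n. coprime (int (triple_content t)) e}) =
    (\<Sum>r | r dvd square_part n \<and> coprime (int r) e. c_fun (n div r\<^sup>2))"
proof -
  let ?T = "{t \<in> hnf_triples n. coprime (int (triple_content t)) e}"
  let ?R = "{r. r dvd square_part n \<and> coprime (int r) e}"
  have finT: "finite ?T" using finite_hnf_triples[OF n] by simp
  have "square_part n > 0" using n by (auto intro: Nat.gr0I)
  then have finR: "finite ?R" using finite_divisors_nat by auto
  have maps: "triple_content ` ?T \<subseteq> ?R"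
  proof
    fix r assume "r \<in> triple_content ` ?T"
    then obtain a b d where *: "a * d = n" "r = gcd (gcd a b) d" "coprime (int r) e"
      by (auto simp: hnf_triples_def triple_content_def)
    have "r dvd gcd a b" "r dvd d" unfolding *(2) by (rule gcd_dvd1, rule gcd_dvd2)
    then have "r dvd a" "r dvd d" using gcd_dvd1 dvd_trans by blast+
    then have "r * r dvd a * d" by (rule mult_dvd_mono)
    then show "r \<in> ?R" using * by (simp add: dvd_square_part_iff power2_eq_square)
  qed
  have "real (card ?T) = (\<Sum>t\<in>?T. 1)" by simp
  also have "\<dots> = (\<Sum>r\<in>?R. \<Sum>t\<in>{t \<in> ?T. triple_content t = r}. 1)"
    by (rule sum.group[OF finT finR maps, symmetric])
  also have "\<dots> = (\<Sum>r\<in>?R. c_fun (n div r\<^sup>2))"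
  proof (rule sum.cong[OF refl])
    fix r assume r: "r \<in> ?R"
    then have r2: "r\<^sup>2 dvd n" by (simp add: dvd_square_part_iff)
    then have r0: "r > 0" using n by (auto intro: Nat.gr0I)
    have "{t \<in> ?T. triple_content t = r} = {t \<in> hnf_triples n. triple_content t = r}" using r by auto
    then have "(\<Sum>t\<in>{t \<in> ?T. triple_content t = r}. 1) = real (dedekind_psi (n div r\<^sup>2))"
      using card_hnf_triples_content[OF n r2 r0] by simp
    also have "\<dots> = c_fun (n div r\<^sup>2)"
      using n r2 r0 by (intro dedekind_psi_eq_c_fun) (simp add: dvd_imp_le div_greater_zero_iff)
    finally show "(\<Sum>t\<in>{t \<in> ?T. triple_content t = r}. 1) = c_fun (n div r\<^sup>2)" .
  qed
  finally show ?thesis .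
qed

section \<open>Sublattices of the square lattice and their content\<close>

definition row_lattice :: "mat2 \<Rightarrow> (int \<times> int) set" where
  "row_lattice M = {(m * m11 M + n * m21 M, m * m12 M + n * m22 M) | m n. True}"

definition mdet :: "mat2 \<Rightarrow> int" where
  "mdet M = m11 M * m22 M - m12 M * m21 M"

definition content :: "mat2 \<Rightarrow> int" where
  "content M = gcd (gcd (m11 M) (m12 M)) (gcd (m21 M) (m22 M))"

definition sublattices :: "int \<Rightarrow> int \<Rightarrow> (int \<times> int) set set" where
  "sublattices N e = row_lattice ` {M. mdet M = N \<and> coprime (content M) e}"

lemma mdet_SL2: "g \<in> SL2 \<longleftrightarrow> mdet g = 1"
  by (simp add: SL2_def mdet_def)

lemma mdet_mmul: "mdet (mmul g h) = mdet g * mdet h"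
  by (cases g; cases h) (simp add: mdet_def algebra_simps)

lemma row_lattice_mmul_subset: "row_lattice (mmul U M) \<subseteq> row_lattice M"
proof
  fix p assume "p \<in> row_lattice (mmul U M)"
  then obtain m n where p: "p = (m * m11 (mmul U M) + n * m21 (mmul U M), m * m12 (mmul U M) + n * m22 (mmul U M))"
    by (auto simp: row_lattice_def)
  obtain a b c d x y z w where U: "U = Mat a b c d" and M: "M = Mat x y z w" by (cases U, cases M)
  have "p = ((m * a + n * c) * m11 M + (m * b + n * d) * m21 M, (m * a + n * c) * m12 M + (m * b + n * d) * m22 M)"
    by (simp add: p U M algebra_simps)
  then show "p \<in> row_lattice M" unfolding row_lattice_def by blast
qed

lemma row_lattice_mmul:
  assumes "U \<in> SL2" shows "row_lattice (mmul U M) = row_lattice M"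
proof
  have "M = mmul (minv U) (mmul U M)"
    using minv_mmul[OF assms] mmul_assoc mmul_one by metis
  then show "row_lattice M \<subseteq> row_lattice (mmul U M)"
    using row_lattice_mmul_subset[of "minv U" "mmul U M"] by simp
qed (rule row_lattice_mmul_subset)

lemma dvd_content_iff: "k dvd content M \<longleftrightarrow> k dvd m11 M \<and> k dvd m12 M \<and> k dvd m21 M \<and> k dvd m22 M"
  by (auto simp: content_def)

text \<open>This expresses the content by the sublattice alone, so that it does not depend on the choice of the
basis.\<close>

lemma dvd_content_iff_row_lattice:
  "k dvd content M \<longleftrightarrow> (\<forall>(x, y)\<in>row_lattice M. k dvd x \<and> k dvd y)"
proof
  assume "k dvd content M"
  then show "\<forall>(x, y)\<in>row_lattice M. k dvd x \<and> k dvd y"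
    unfolding dvd_content_iff by (auto simp: row_lattice_def)
next
  assume *: "\<forall>(x, y)\<in>row_lattice M. k dvd x \<and> k dvd y"
  have "(1 * m11 M + 0 * m21 M, 1 * m12 M + 0 * m22 M) \<in> row_lattice M"
    "(0 * m11 M + 1 * m21 M, 0 * m12 M + 1 * m22 M) \<in> row_lattice M"
    unfolding row_lattice_def by blast+
  then show "k dvd content M" using * unfolding dvd_content_iff by auto
qed

lemma content_cong: "row_lattice M = row_lattice M' \<Longrightarrow> content M = content M'"
proof -
  assume eq: "row_lattice M = row_lattice M'"
  have *: "k dvd content M \<longleftrightarrow> k dvd content M'" for k
    unfolding dvd_content_iff_row_lattice eq ..
  have "content M dvd content M'" "content M' dvd content M"
    using *[of "content M"] *[of "content M'"] by simp_all
  moreover have "content M \<ge> 0" "content M' \<ge> 0" by (simp_all add: content_def)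
  ultimately show ?thesis by (simp add: zdvd_antisym_nonneg)
qed

definition hnf :: "nat \<times> nat \<times> nat \<Rightarrow> mat2" where
  "hnf = (\<lambda>(a, b, d). Mat (int a) (int b) 0 (int d))"

lemma content_hnf: "content (hnf t) = int (triple_content t)"
  by (cases t) (simp add: content_def hnf_def triple_content_def)

text \<open>A Bezout relation for the first column clears the lower left entry, and a multiple of the second row
then reduces the upper right entry modulo \<open>d\<close>. Both steps are left multiplications by elements of
\<open>SL2\<close>, which do not change the lattice of rows.\<close>

lemma exists_hnf:
  assumes "mdet M > 0"
  shows "\<exists>t\<in>hnf_triples (nat (mdet M)). row_lattice (hnf t) = row_lattice M"
proof -
  obtain x y z w where M: "M = Mat x y z w" by (cases M)
  have det: "x * w - y * z > 0" using assms by (simp add: M mdet_def)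
  define g where "g = gcd x z"
  obtain u v where uv: "u * x + v * z = g" using bezout_int g_def by blast
  obtain x' z' where xz: "x = g * x'" "z = g * z'" using g_def by (metis dvdE gcd_dvd1 gcd_dvd2)
  have "g \<noteq> 0"
  proof
    assume "g = 0"
    then show False using det unfolding xz by simp
  qed
  then have g: "g > 0" using gcd_ge_0_int[of x z] unfolding g_def by linarith
  have "g * (u * x' + v * z') = g * 1" using uv xz by (simp add: algebra_simps)
  then have U1: "u * x' + v * z' = 1" using g by simp
  define U where "U = Mat u v (- z') x'"
  have U: "U \<in> SL2" using U1 by (simp add: U_def)
  define b d where "b = u * y + v * w" and "d = x' * w - z' * y"
  have UM: "mmul U M = Mat g b 0 d"
    using uv xz by (simp add: U_def M b_def d_def algebra_simps)
  have gd: "g * d = mdet M"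
    using mdet_mmul[of U M] U unfolding UM by (simp add: mdet_SL2) (simp add: mdet_def)
  then have d: "d > 0" using assms g by (metis zero_less_mult_pos)
  define V where "V = Mat 1 (- (b div d)) 0 1"
  have V: "V \<in> SL2" by (simp add: V_def)
  have VUM: "mmul V (mmul U M) = Mat g (b mod d) 0 d"
    unfolding UM by (simp add: V_def minus_mult_div_eq_mod[symmetric] mult.commute)
  define t where "t = (nat g, nat (b mod d), nat d)"
  have "hnf t = mmul V (mmul U M)"
    using g d by (simp add: hnf_def t_def VUM)
  then have "row_lattice (hnf t) = row_lattice M"
    using row_lattice_mmul[OF V] row_lattice_mmul[OF U] by simp
  moreover have "nat g * nat d = nat (mdet M)" using gd g by (simp add: nat_mult_distrib[symmetric])
  then have "t \<in> hnf_triples (nat (mdet M))"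
    using d by (simp add: t_def hnf_triples_def)
  ultimately show ?thesis by blast
qed

text \<open>The lattice determines \<open>a\<close> as the generator of its first coordinates, \<open>d\<close> as the generator of its
elements \<open>(0, y)\<close>, and then \<open>b\<close> modulo \<open>d\<close>.\<close>

lemma inj_on_row_lattice_hnf:
  assumes "n > 0"
  shows "inj_on (\<lambda>t. row_lattice (hnf t)) (hnf_triples n)"
proof (rule inj_onI)
  fix s t assume s: "s \<in> hnf_triples n" and t: "t \<in> hnf_triples n"
    and eq: "row_lattice (hnf s) = row_lattice (hnf t)"
  have sub: "int a' dvd int a \<and> (\<exists>n. int b - int b' * (int a div int a') = n * int d') \<and> int d' dvd int d"
    if "row_lattice (hnf (a, b, d)) \<subseteq> row_lattice (hnf (a', b', d'))" "a' > 0"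
    for a b d a' b' d' :: nat
  proof -
    have "(1 * int a + 0 * 0, 1 * int b + 0 * int d) \<in> row_lattice (hnf (a, b, d))"
      "(0 * int a + 1 * 0, 0 * int b + 1 * int d) \<in> row_lattice (hnf (a, b, d))"
      unfolding row_lattice_def hnf_def by force+
    then have "(int a, int b) \<in> row_lattice (hnf (a', b', d'))" "(0, int d) \<in> row_lattice (hnf (a', b', d'))"
      using that(1) by auto
    then obtain m n m2 n2 where "int a = m * int a'" "int b = m * int b' + n * int d'"
      "0 = m2 * int a'" "int d = m2 * int b' + n2 * int d'"
      by (auto simp: row_lattice_def hnf_def)
    then show ?thesis using that(2) by (auto simp: algebra_simps)
  qed
  obtain a b d where s': "s = (a, b, d)" by (cases s)
  obtain a' b' d' where t': "t = (a', b', d')" by (cases t)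
  have pos: "a * d = n" "b < d" "a' * d' = n" "b' < d'" using s t s' t' by (auto simp: hnf_triples_def)
  then have "a > 0" "a' > 0" using assms by (auto intro: Nat.gr0I)
  note 1 = sub[of a b d a' b' d', OF _ \<open>a' > 0\<close>] and 2 = sub[of a' b' d' a b d, OF _ \<open>a > 0\<close>]
  have "a = a'" "d = d'" using 1 2 eq s' t' by (auto intro: dvd_antisym)
  then obtain k where k: "int b - int b' = k * int d" using 1 eq s' t' \<open>a > 0\<close> by auto
  have "\<bar>k * int d\<bar> < int d" using pos \<open>d = d'\<close> unfolding k[symmetric] by linarith
  then have "k = 0" using pos by (auto simp: abs_mult)
  then show "s = t" using k s' t' \<open>a = a'\<close> \<open>d = d'\<close> by simp
qed

lemma sublattices_eq_hnf:
  assumes "N > 0"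
  shows "sublattices N e = (\<lambda>t. row_lattice (hnf t)) ` {t \<in> hnf_triples (nat N). coprime (int (triple_content t)) e}"
proof (intro equalityI subsetI)
  fix K assume "K \<in> sublattices N e"
  then obtain M where M: "K = row_lattice M" "mdet M = N" "coprime (content M) e"
    by (auto simp: sublattices_def)
  obtain t where t: "t \<in> hnf_triples (nat N)" "row_lattice (hnf t) = row_lattice M"
    using exists_hnf[of M] assms M(2) by auto
  then have "coprime (int (triple_content t)) e"
    using M(3) content_cong[OF t(2)] by (simp add: content_hnf)
  then show "K \<in> (\<lambda>t. row_lattice (hnf t)) ` {t \<in> hnf_triples (nat N). coprime (int (triple_content t)) e}"
    using t M by auto
next
  fix K assume "K \<in> (\<lambda>t. row_lattice (hnf t)) ` {t \<in> hnf_triples (nat N). coprime (int (triple_content t)) e}"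
  then obtain t where t: "K = row_lattice (hnf t)" "t \<in> hnf_triples (nat N)" "coprime (content (hnf t)) e"
    by (auto simp: content_hnf)
  obtain a b d where t': "t = (a, b, d)" by (cases t)
  have "a * d = nat N" using t t' by (simp add: hnf_triples_def)
  then have "int a * int d = N" using assms by (metis of_nat_mult nat_0_le less_imp_le)
  then have "mdet (hnf t) = N" by (simp add: mdet_def hnf_def t')
  then show "K \<in> sublattices N e" using t by (auto simp: sublattices_def)
qed

lemma finite_sublattices: "N > 0 \<Longrightarrow> finite (sublattices N e)"
  using finite_hnf_triples[of "nat N"] by (simp add: sublattices_eq_hnf)

lemma card_sublattices:
  assumes "N > 0"
  shows "real (card (sublattices N e)) =
    (\<Sum>r | r dvd square_part (nat N) \<and> coprime (int r) e. c_fun (nat N div r\<^sup>2))"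
proof -
  have "inj_on (\<lambda>t. row_lattice (hnf t)) {t \<in> hnf_triples (nat N). coprime (int (triple_content t)) e}"
    using inj_on_row_lattice_hnf[of "nat N"] assms by (auto intro: inj_on_subset)
  then have "card (sublattices N e) = card {t \<in> hnf_triples (nat N). coprime (int (triple_content t)) e}"
    unfolding sublattices_eq_hnf[OF assms] by (rule card_image)
  then show ?thesis using card_hnf_triples_coprime[of "nat N" e] assms by simp
qed

section \<open>Level data\<close>

text \<open>The integers \<open>e\<close> over which the sum in the Euler characteristic runs.\<close>

definition admissible :: "int \<Rightarrow> int set" where
  "admissible D = {e. e\<^sup>2 < D \<and> 8 dvd D - e\<^sup>2}"

definition level_index :: "int \<Rightarrow> int \<Rightarrow> int" where
  "level_index D e = (D - e\<^sup>2) div 8"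

definition level_data :: "int \<Rightarrow> (int \<times> (int \<times> int) set) set" where
  "level_data D = (SIGMA e:admissible D. sublattices (level_index D e) e)"

lemma level_index_pos: "e \<in> admissible D \<Longrightarrow> level_index D e > 0"
  by (auto simp: admissible_def level_index_def elim!: dvdE)

lemma finite_admissible: "finite (admissible D)"
proof -
  have "admissible D \<subseteq> {- \<bar>D\<bar>..\<bar>D\<bar>}"
  proof
    fix e assume "e \<in> admissible D"
    then have "e\<^sup>2 < D" by (simp add: admissible_def)
    moreover have "\<bar>e\<bar> \<le> \<bar>e\<bar>\<^sup>2"
    proof (cases "e = 0")
      case False
      then have "1 \<le> \<bar>e\<bar>" by linarith
      then show ?thesis by (rule self_le_power) simp
    qed simp
    then have "\<bar>e\<bar> \<le> e\<^sup>2" by simp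
    ultimately show "e \<in> {- \<bar>D\<bar>..\<bar>D\<bar>}" by auto
  qed
  then show ?thesis by (rule finite_subset) simp
qed

lemma finite_level_data: "finite (level_data D)"
  unfolding level_data_def using finite_admissible finite_sublattices level_index_pos by blast

lemma card_level_data: "real (card (level_data D)) = (\<Sum>e\<in>admissible D. m_fun D e)"
proof -
  have "card (level_data D) = (\<Sum>e\<in>admissible D. card (sublattices (level_index D e) e))"
    unfolding level_data_def using finite_admissible finite_sublattices level_index_pos
    by (intro card_SigmaI) auto
  then have "real (card (level_data D)) = (\<Sum>e\<in>admissible D. real (card (sublattices (level_index D e) e)))"
    by simp
  also have "\<dots> = (\<Sum>e\<in>admissible D. m_fun D e)"
    using level_index_pos by (intro sum.cong refl) (simp add: card_sublattices m_fun_def level_index_def Let_def)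
  finally show ?thesis .
qed

text \<open>The transpose, conjugated by \<open>diag(1, -1)\<close>. It reverses products, so that multiplying row vectors by it
on the right, as in \<open>sublattice_act\<close>, is a left action; the signs are those that make
\<open>(m + n\<tau>) / (c\<tau> + d) = m' + n' g\<tau>\<close> hold for the image \<open>(m', n')\<close> of \<open>(m, n)\<close>.\<close>

fun twist :: "mat2 \<Rightarrow> mat2" where
  "twist (Mat a b c d) = Mat a (- c) (- b) d"

fun sublattice_act :: "mat2 \<Rightarrow> int \<times> int \<Rightarrow> int \<times> int" where
  "sublattice_act (Mat a b c d) (m, n) = (a * m - b * n, - c * m + d * n)"

lemma sublattice_act_mmul: "sublattice_act (mmul g h) p = sublattice_act g (sublattice_act h p)"
  by (cases g; cases h; cases p) (simp add: algebra_simps)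

lemma image_row_lattice: "sublattice_act g ` row_lattice M = row_lattice (mmul M (twist g))"
proof -
  obtain a b c d x y z w where g: "g = Mat a b c d" and M: "M = Mat x y z w" by (cases g, cases M)
  have key: "sublattice_act g (m * m11 M + n * m21 M, m * m12 M + n * m22 M) =
      (m * m11 (mmul M (twist g)) + n * m21 (mmul M (twist g)),
       m * m12 (mmul M (twist g)) + n * m22 (mmul M (twist g)))" for m n
    by (simp add: g M algebra_simps)
  have "sublattice_act g ` row_lattice M =
      {sublattice_act g (m * m11 M + n * m21 M, m * m12 M + n * m22 M) | m n. True}"
    unfolding row_lattice_def by blast
  then show ?thesis unfolding key row_lattice_def .
qed

text \<open>Multiplying by an integral matrix can only enlarge the content, and here the inverse matrix is integral
as well.\<close>

lemma content_twist:
  assumes "g \<in> SL2" shows "content (mmul M (twist g)) = content M"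
proof -
  have 1: "content M dvd content (mmul M h)" for M h
  proof -
    obtain a b c d x y z w where g: "h = Mat a b c d" and M: "M = Mat x y z w" by (cases h, cases M)
    have "content M dvd x" "content M dvd y" "content M dvd z" "content M dvd w"
      using dvd_content_iff[of "content M" M] by (simp_all add: M)
    then show ?thesis unfolding dvd_content_iff by (simp add: g M)
  qed
  have "twist g \<in> SL2" using assms by (cases g) (simp add: mult.commute)
  then have "mmul (mmul M (twist g)) (minv (twist g)) = M"
    using mmul_minv mmul_assoc mmul_one_right by metis
  then have "content (mmul M (twist g)) dvd content M" using 1 by metis
  moreover have "content M \<ge> 0" "content (mmul M (twist g)) \<ge> 0" by (simp_all add: content_def)
  ultimately show ?thesis using 1 by (simp add: zdvd_antisym_nonneg)
qed

lemma sublattice_act_closed: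
  assumes "g \<in> SL2" "K \<in> sublattices N e"
  shows "sublattice_act g ` K \<in> sublattices N e"
proof -
  obtain M where M: "K = row_lattice M" "mdet M = N" "coprime (content M) e"
    using assms by (auto simp: sublattices_def)
  have "mdet (twist g) = 1" using assms by (cases g) (simp add: mdet_def mult.commute)
  then have "mdet (mmul M (twist g)) = N" using M by (simp add: mdet_mmul)
  moreover have "coprime (content (mmul M (twist g))) e" using M content_twist[OF assms(1)] by simp
  ultimately show ?thesis unfolding M(1) image_row_lattice sublattices_def by blast
qed

definition level_act :: "mat2 \<Rightarrow> int \<times> (int \<times> int) set \<Rightarrow> int \<times> (int \<times> int) set" where
  "level_act g s = (fst s, sublattice_act g ` snd s)"

lemma level_act_closed: "g \<in> SL2 \<Longrightarrow> s \<in> level_data D \<Longrightarrow> level_act g s \<in> level_data D"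
  using sublattice_act_closed by (auto simp: level_data_def level_act_def)

lemma level_act_mmul: "level_act (mmul g h) s = level_act g (level_act h s)"
  by (simp add: level_act_def image_image sublattice_act_mmul)

lemma level_act_one: "level_act (Mat 1 0 0 1) s = s"
proof -
  have "sublattice_act (Mat 1 0 0 1) = id" by (auto simp: fun_eq_iff)
  then show ?thesis by (simp add: level_act_def)
qed

lemma level_act_minus_one:
  assumes "s \<in> level_data D" shows "level_act (Mat (-1) 0 0 (-1)) s = s"
proof -
  obtain M where M: "snd s = row_lattice M" using assms by (auto simp: level_data_def sublattices_def)
  have "mmul M (twist (Mat (-1) 0 0 (-1))) = mmul (Mat (-1) 0 0 (-1)) M" by (cases M) simp
  then have "sublattice_act (Mat (-1) 0 0 (-1)) ` snd s = snd s"
    unfolding M image_row_lattice by (simp add: row_lattice_mmul)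
  then show ?thesis by (simp add: level_act_def)
qed

section \<open>Lattices in the complex plane\<close>

text \<open>The oriented area of the parallelogram spanned by \<open>x\<close> and \<open>y\<close>. Intersection numbers, coordinates in a
basis, indices and determinants are all expressed by it.\<close>

definition wedge :: "complex \<Rightarrow> complex \<Rightarrow> real" where
  "wedge x y = Im (cnj x * y)"

lemma wedge_simps [simp]:
  "wedge (x + y) z = wedge x z + wedge y z" "wedge x (y + z) = wedge x y + wedge x z"
  "wedge (x - y) z = wedge x z - wedge y z" "wedge x (y - z) = wedge x y - wedge x z"
  "wedge (- x) y = - wedge x y" "wedge x (- y) = - wedge x y"
  "wedge (of_real r * x) y = r * wedge x y" "wedge x (of_real r * y) = r * wedge x y"
  "wedge (of_int n * x) y = of_int n * wedge x y" "wedge x (of_int n * y) = of_int n * wedge x y"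
  "wedge x x = 0" "wedge 0 x = 0" "wedge x 0 = 0"
  by (simp_all add: wedge_def algebra_simps)

lemma wedge_commute: "wedge x y = - wedge y x"
  by (simp add: wedge_def)

lemma wedge_mult: "wedge (k * x) (k * y) = (cmod k)\<^sup>2 * wedge x y"
  unfolding cmod_power2 by (simp add: wedge_def power2_eq_square algebra_simps)

lemma abs_wedge_le: "\<bar>wedge x y\<bar> \<le> cmod x * cmod y"
  unfolding wedge_def using abs_Im_le_cmod[of "cnj x * y"] by (simp add: norm_mult)

lemma wedge_coordinates:
  assumes "wedge u v > 0"
  shows "z = of_real (wedge z v / wedge u v) * u + of_real (wedge u z / wedge u v) * v"
proof -
  have "of_real (wedge u v) * z = of_real (wedge z v) * u + of_real (wedge u z) * v"
    by (simp add: wedge_def complex_eq_iff algebra_simps)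
  then have "z = (of_real (wedge z v) * u + of_real (wedge u z) * v) / of_real (wedge u v)"
    using assms by (simp add: field_simps)
  then show ?thesis by (simp add: add_divide_distrib)
qed

lemma wedge_independent:
  assumes "wedge u v > 0" "of_real x * u + of_real y * v = of_real x' * u + of_real y' * v"
  shows "x = x'" "y = y'"
proof -
  have "wedge u (of_real x * u + of_real y * v) = wedge u (of_real x' * u + of_real y' * v)"
    "wedge (of_real x * u + of_real y * v) v = wedge (of_real x' * u + of_real y' * v) v"
    using assms(2) by simp_all
  then show "x = x'" "y = y'" using assms(1) by simp_all
qed

lemma wedge_independent_int:
  assumes "wedge u v > 0" "of_int m * u + of_int n * v = of_int m' * u + of_int n' * v"
  shows "m = m'" "n = n'"
  using wedge_independent[of u v "of_int m" "of_int n" "of_int m'" "of_int n'"] assms by simp_all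

lemma wedge_int_combination:
  "wedge (of_int m * u + of_int n * v) (of_int m' * u + of_int n' * v) = of_int (m * n' - n * m') * wedge u v"
  by (simp only: wedge_simps wedge_commute[of v u] of_int_diff of_int_mult) (simp add: algebra_simps)

lemma lattice_basis_wedge: "lattice_basis L u v \<longleftrightarrow> wedge u v > 0 \<and> L = {of_int m * u + of_int n * v | m n. True}"
  by (simp add: lattice_basis_def wedge_def)

lemma lattice_basis_pos: "lattice_basis L u v \<Longrightarrow> wedge u v > 0"
  by (simp add: lattice_basis_wedge)

lemma mem_lattice: "lattice_basis L u v \<Longrightarrow> z \<in> L \<longleftrightarrow> (\<exists>m n. z = of_int m * u + of_int n * v)"
  by (auto simp: lattice_basis_wedge)

lemma lattice_basis_mem: "lattice_basis L u v \<Longrightarrow> u \<in> L" "lattice_basis L u v \<Longrightarrow> v \<in> L"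
proof -
  assume *: "lattice_basis L u v"
  have "u = of_int 1 * u + of_int 0 * v" "v = of_int 0 * u + of_int 1 * v" by simp_all
  then show "u \<in> L" "v \<in> L" unfolding mem_lattice[OF *] by blast+
qed

lemma lattice_closed:
  assumes "is_lattice L"
  shows "0 \<in> L" "x \<in> L \<Longrightarrow> y \<in> L \<Longrightarrow> x + y \<in> L" "x \<in> L \<Longrightarrow> - x \<in> L"
    "x \<in> L \<Longrightarrow> y \<in> L \<Longrightarrow> x - y \<in> L" "x \<in> L \<Longrightarrow> of_int k * x \<in> L"
proof -
  obtain u v where b: "lattice_basis L u v" using assms by (auto simp: is_lattice_def)
  have "0 = of_int 0 * u + of_int 0 * v" by simp
  then show "0 \<in> L" unfolding mem_lattice[OF b] by blast
  assume "x \<in> L"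
  then obtain m n where x: "x = of_int m * u + of_int n * v" using mem_lattice[OF b] by blast
  have "- x = of_int (- m) * u + of_int (- n) * v" by (simp add: x)
  then show "- x \<in> L" unfolding mem_lattice[OF b] by blast
  have "of_int k * x = of_int (k * m) * u + of_int (k * n) * v" by (simp add: x algebra_simps)
  then show "of_int k * x \<in> L" unfolding mem_lattice[OF b] by blast
  assume "y \<in> L"
  then obtain m' n' where y: "y = of_int m' * u + of_int n' * v" using mem_lattice[OF b] by blast
  have "x + y = of_int (m + m') * u + of_int (n + n') * v"
    "x - y = of_int (m - m') * u + of_int (n - n') * v" by (simp_all add: x y algebra_simps)
  then show "x + y \<in> L" "x - y \<in> L" unfolding mem_lattice[OF b] by blast+
qed

lemma lattice_wedge_multiple:
  assumes "lattice_basis L u v" "x \<in> L" "y \<in> L"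
  shows "\<exists>k :: int. wedge x y = of_int k * wedge u v"
proof -
  obtain m n m' n' where xy: "x = of_int m * u + of_int n * v" "y = of_int m' * u + of_int n' * v"
    using assms mem_lattice by meson
  have "wedge x y = of_int (m * n' - n * m') * wedge u v"
    unfolding xy by (rule wedge_int_combination)
  then show ?thesis by blast
qed

text \<open>Each area is a positive integral multiple of the other.\<close>

lemma lattice_basis_same_area:
  assumes "lattice_basis L u v" "lattice_basis L a b"
  shows "wedge a b = wedge u v"
proof -
  obtain k l :: int where kl: "wedge a b = of_int k * wedge u v" "wedge u v = of_int l * wedge a b"
    using lattice_wedge_multiple lattice_basis_mem assms by meson
  have pos: "wedge a b > 0" "wedge u v > 0" using assms lattice_basis_pos by auto
  have "of_int (k * l) * wedge u v = 1 * wedge u v" using kl by (simp add: mult.assoc)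
  then have "real_of_int (k * l) = 1" using pos by (subst (asm) mult_cancel_right) auto
  then have "k * l = 1" by linarith
  moreover have "k > 0" using kl(1) pos by (metis of_int_0_less_iff zero_less_mult_pos2)
  ultimately have "k = 1" by (simp add: zmult_eq_1_iff)
  then show ?thesis using kl by simp
qed

text \<open>A definite description becomes an area here: the determinant of coordinates is the area divided by
that of the basis, which is the same for all positively oriented bases.\<close>

lemma torus_intersection_wedge:
  assumes b: "lattice_basis L u v" and "x \<in> L" "y \<in> L"
  shows "of_int (torus_intersection L x y) = wedge x y / wedge u v"
proof -
  have pos: "wedge u v > 0" using b lattice_basis_pos by auto
  obtain m n m' n' where xy: "x = of_int m * u + of_int n * v" "y = of_int m' * u + of_int n' * v"
    using assms mem_lattice by meson
  have "torus_intersection L x y = m * n' - n * m'" unfolding torus_intersection_def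
  proof (rule the_equality)
    show "\<exists>w1 w2 i j i' j'. lattice_basis L w1 w2 \<and> x = of_int i * w1 + of_int j * w2 \<and>
       y = of_int i' * w1 + of_int j' * w2 \<and> m * n' - n * m' = i * j' - j * i'"
      using b xy by blast
  next
    fix k assume "\<exists>w1 w2 i j i' j'. lattice_basis L w1 w2 \<and> x = of_int i * w1 + of_int j * w2 \<and>
       y = of_int i' * w1 + of_int j' * w2 \<and> k = i * j' - j * i'"
    then obtain w1 w2 i j i' j' where *: "lattice_basis L w1 w2" "x = of_int i * w1 + of_int j * w2"
       "y = of_int i' * w1 + of_int j' * w2" "k = i * j' - j * i'" by blast
    have "wedge x y = of_int k * wedge w1 w2"
      unfolding *(2-4) by (rule wedge_int_combination)
    also have "wedge w1 w2 = wedge u v" by (rule lattice_basis_same_area[OF b *(1)])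
    finally have "wedge x y = of_int k * wedge u v" .
    moreover have "wedge x y = of_int (m * n' - n * m') * wedge u v"
      unfolding xy by (rule wedge_int_combination)
    ultimately have "real_of_int k = of_int (m * n' - n * m')" using pos by simp
    then show "k = m * n' - n * m'" by (simp only: of_int_eq_iff)
  qed
  moreover have "wedge x y = of_int (m * n' - n * m') * wedge u v"
    unfolding xy by (rule wedge_int_combination)
  ultimately show ?thesis using pos by simp
qed

lemma lattice_basis_scale:
  assumes "lattice_basis L u v" "k \<noteq> 0"
  shows "lattice_basis ((\<lambda>z. k * z) ` L) (k * u) (k * v)"
proof -
  have "wedge (k * u) (k * v) > 0" using assms lattice_basis_pos by (simp add: wedge_mult)
  moreover have "(\<lambda>z. k * z) ` L = {of_int m * (k * u) + of_int n * (k * v) | m n. True}"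
  proof (intro equalityI subsetI)
    fix x assume "x \<in> (\<lambda>z. k * z) ` L"
    then obtain z where z: "x = k * z" "z \<in> L" by blast
    then obtain m n where "z = of_int m * u + of_int n * v" using mem_lattice[OF assms(1)] by blast
    then have "x = k * (of_int m * u + of_int n * v)" using z by simp
    then have "x = of_int m * (k * u) + of_int n * (k * v)" by (simp add: algebra_simps)
    then show "x \<in> {of_int m * (k * u) + of_int n * (k * v) | m n. True}" by blast
  next
    fix x assume "x \<in> {of_int m * (k * u) + of_int n * (k * v) | m n. True}"
    then obtain m n where "x = k * (of_int m * u + of_int n * v)" by (auto simp: algebra_simps)
    then show "x \<in> (\<lambda>z. k * z) ` L" using mem_lattice[OF assms(1)] by blast
  qed
  ultimately show ?thesis by (simp add: lattice_basis_wedge)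
qed

lemma is_lattice_scale: "is_lattice L \<Longrightarrow> k \<noteq> 0 \<Longrightarrow> is_lattice ((\<lambda>z. k * z) ` L)"
  unfolding is_lattice_def using lattice_basis_scale by blast

text \<open>The area spanned by \<open>l\<close> and a basis vector is an integral multiple of the area \<open>A\<close> of the basis, and it
is at most \<open>\<bar>l\<bar>\<close> times the length of that vector.\<close>

lemma lattice_discrete:
  assumes "is_lattice L"
  shows "\<exists>e>0. \<forall>l\<in>L. l \<noteq> 0 \<longrightarrow> e \<le> cmod l"
proof -
  obtain u v where b: "lattice_basis L u v" using assms by (auto simp: is_lattice_def)
  define A where "A = wedge u v"
  have A: "A > 0" using lattice_basis_pos[OF b] by (simp add: A_def)
  have nz: "u \<noteq> 0" "v \<noteq> 0" using A by (auto simp: A_def)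
  define N where "N = cmod u + cmod v"
  have N: "N > 0" using nz by (simp add: N_def add_pos_pos)
  have "A / N \<le> cmod l" if "l \<in> L" "l \<noteq> 0" for l
  proof -
    obtain m n where l: "l = of_int m * u + of_int n * v" using mem_lattice[OF b] \<open>l \<in> L\<close> by blast
    have "\<bar>of_int m * A\<bar> \<le> cmod l * cmod v" "\<bar>of_int n * A\<bar> \<le> cmod u * cmod l"
      using abs_wedge_le[of l v] abs_wedge_le[of u l] by (simp_all add: l A_def)
    moreover have "cmod l * cmod v \<le> cmod l * N" "cmod u * cmod l \<le> cmod l * N"
      by (simp_all add: N_def algebra_simps)
    ultimately have mn: "\<bar>of_int m\<bar> * A \<le> cmod l * N" "\<bar>of_int n\<bar> * A \<le> cmod l * N"
      using A by (simp_all add: abs_mult)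
    have "m \<noteq> 0 \<or> n \<noteq> 0" using \<open>l \<noteq> 0\<close> l by auto
    then have "1 \<le> \<bar>of_int m :: real\<bar> \<or> 1 \<le> \<bar>of_int n :: real\<bar>" by linarith
    then have "1 * A \<le> cmod l * N"
      using mn mult_right_mono[of 1 "\<bar>of_int m\<bar>" A] mult_right_mono[of 1 "\<bar>of_int n\<bar>" A] A by linarith
    then show ?thesis using N by (simp add: field_simps)
  qed
  then show ?thesis using A N by (intro exI[of _ "A / N"]) auto
qed

lemma half_period_not_in_lattice:
  assumes "lattice_basis L u v" shows "u / 2 \<notin> L"
proof
  assume "u / 2 \<in> L"
  then obtain m n where "u / 2 = of_int m * u + of_int n * v" using mem_lattice[OF assms] by blast
  then have "of_real (1 / 2) * u + of_real 0 * v = of_real (of_int m) * u + of_real (of_int n) * v" by simp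
  then have "1 / 2 = real_of_int m" by (rule wedge_independent(1)[OF lattice_basis_pos[OF assms]])
  then have "2 * m = 1" by linarith
  then show False by presburger
qed

lemma torus_point_eq_iff:
  assumes "is_lattice L"
  shows "torus_point L z = torus_point L w \<longleftrightarrow> z - w \<in> L"
proof
  assume "torus_point L z = torus_point L w"
  moreover have "z + 0 \<in> torus_point L z" unfolding torus_point_def using lattice_closed(1)[OF assms] by blast
  ultimately obtain l where "z + 0 = w + l" "l \<in> L" unfolding torus_point_def by blast
  then show "z - w \<in> L" by simp
next
  assume *: "z - w \<in> L"
  show "torus_point L z = torus_point L w" unfolding torus_point_def
  proof (intro equalityI image_subsetI)
    fix l assume "l \<in> L"
    then have "(z - w) + l \<in> L" "l - (z - w) \<in> L" using * lattice_closed[OF assms] by blast+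
    moreover have "z + l = w + ((z - w) + l)" "w + l = z + (l - (z - w))" by simp_all
    ultimately show "z + l \<in> (\<lambda>l. w + l) ` L" "w + l \<in> (\<lambda>l. z + l) ` L" by blast+
  qed
qed

section \<open>Holomorphic maps between complex tori\<close>

lemma lattice_valued_constant:
  fixes g :: "complex \<Rightarrow> complex"
  assumes L: "is_lattice L" and g: "continuous_on UNIV g" "\<And>z. g z \<in> L"
  shows "g z = g w"
proof -
  obtain e where e: "e > 0" "\<And>l. l \<in> L \<Longrightarrow> l \<noteq> 0 \<Longrightarrow> e \<le> cmod l"
    using lattice_discrete[OF L] by blast
  have "g constant_on UNIV"
  proof (rule continuous_discrete_range_constant[OF connected_UNIV g(1)])
    fix x
    show "\<exists>e>0. \<forall>y. y \<in> UNIV \<and> g y \<noteq> g x \<longrightarrow> e \<le> cmod (g y - g x)"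
      using e lattice_closed(4)[OF L] g(2) by (intro exI[of _ e]) auto
  qed
  then show ?thesis by (auto simp: constant_on_def)
qed

lemma lattice_reduce_to_parallelogram:
  assumes b: "lattice_basis L u v"
  shows "\<exists>x\<in>{0..1}. \<exists>y\<in>{0..1}. \<exists>l\<in>L. z = (of_real x * u + of_real y * v) + l"
proof -
  define s t where "s = wedge z v / wedge u v" and "t = wedge u z / wedge u v"
  have z: "z = of_real s * u + of_real t * v"
    unfolding s_def t_def by (rule wedge_coordinates[OF lattice_basis_pos[OF b]])
  have "z = (of_real (frac s) * u + of_real (frac t) * v) + (of_int \<lfloor>s\<rfloor> * u + of_int \<lfloor>t\<rfloor> * v)"
    unfolding z frac_def by (simp add: algebra_simps)
  moreover have "of_int \<lfloor>s\<rfloor> * u + of_int \<lfloor>t\<rfloor> * v \<in> L" unfolding mem_lattice[OF b] by blast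
  moreover have "frac s \<in> {0..1}" "frac t \<in> {0..1}" by (auto intro: less_imp_le frac_lt_1)
  ultimately show ?thesis by blast
qed

text \<open>The difference \<open>F(z + l) - F(z)\<close> lies in a discrete set and is therefore constant in \<open>z\<close>. Hence the derivative
of \<open>F\<close> is periodic, so it is bounded by its values on a compact parallelogram and constant by
Liouville's theorem.\<close>

lemma lift_affine:
  assumes L: "is_lattice L" and L': "is_lattice L'" and lift: "is_lift L L' \<phi> F"
  obtains \<alpha> \<beta> where "F = (\<lambda>z. \<alpha> * z + \<beta>)" "\<And>l. l \<in> L \<Longrightarrow> \<alpha> * l \<in> L'"
proof -
  have hol: "F holomorphic_on UNIV" and F: "\<And>z. \<phi> (torus_point L z) = torus_point L' (F z)"
    using lift by (auto simp: is_lift_def)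
  have cont: "continuous_on UNIV F" using hol by (rule holomorphic_on_imp_continuous_on)
  have diff: "F (z + l) - F z \<in> L'" if "l \<in> L" for z l
  proof -
    have "torus_point L (z + l) = torus_point L z" using torus_point_eq_iff[OF L] that by simp
    then have "torus_point L' (F (z + l)) = torus_point L' (F z)" using F by metis
    then show ?thesis using torus_point_eq_iff[OF L'] by simp
  qed
  have per: "F (z + l) - F z = F l - F 0" if l: "l \<in> L" for z l
  proof -
    have "continuous_on UNIV (\<lambda>z. F (z + l) - F z)"
      by (intro continuous_intros continuous_on_compose2[OF cont]) auto
    then have "F (z + l) - F z = F (0 + l) - F 0"
      using lattice_valued_constant[OF L', of "\<lambda>z. F (z + l) - F z" z 0] diff[OF l] by blast
    then show ?thesis by simp
  qed
  have hol': "deriv F holomorphic_on UNIV" using hol by (intro holomorphic_deriv) auto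
  have derper: "deriv F (z + l) = deriv F z" if l: "l \<in> L" for z l
  proof -
    have D: "(F has_field_derivative deriv F w) (at w)" for w
      using hol by (auto intro: holomorphic_derivI)
    have "((\<lambda>z. F (z + l)) has_field_derivative deriv F (z + l)) (at z)"
      using D[of "z + l"] by (simp add: DERIV_shift)
    moreover have "(\<lambda>z. F (z + l)) = (\<lambda>z. F z + (F l - F 0))"
      using per[OF l] by (auto simp: fun_eq_iff algebra_simps)
    moreover have "((\<lambda>z. F z + (F l - F 0)) has_field_derivative deriv F z) (at z)"
      by (auto intro!: derivative_eq_intros D)
    ultimately show ?thesis using DERIV_unique by metis
  qed
  obtain u v where b: "lattice_basis L u v" using L by (auto simp: is_lattice_def)
  define K where "K = (\<lambda>(x, y). of_real x * u + of_real y * v) ` ({0..1 :: real} \<times> {0..1 :: real})"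
  have "compact K" unfolding K_def
    by (intro compact_continuous_image compact_Times) (auto simp: case_prod_unfold intro!: continuous_intros)
  then have "compact (deriv F ` K)"
    using hol' by (intro compact_continuous_image) (auto intro: holomorphic_on_imp_continuous_on holomorphic_on_subset)
  then have "bounded (deriv F ` K)" by (rule compact_imp_bounded)
  moreover have "range (deriv F) \<subseteq> deriv F ` K"
  proof (rule image_subsetI)
    fix z
    obtain x y l where "x \<in> {0..1}" "y \<in> {0..1}" "l \<in> L" "z = (of_real x * u + of_real y * v) + l"
      using lattice_reduce_to_parallelogram[OF b] by blast
    then have "deriv F z = deriv F (of_real x * u + of_real y * v)" "of_real x * u + of_real y * v \<in> K"
      using derper by (auto simp: K_def)
    then show "deriv F z \<in> deriv F ` K" by blast
  qed
  ultimately have "bounded (range (deriv F))" by (rule bounded_subset)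
  then have "deriv F constant_on UNIV" by (rule Liouville_theorem[OF hol'])
  then obtain \<alpha> where \<alpha>: "\<And>z. deriv F z = \<alpha>" by (auto simp: constant_on_def)
  have "((\<lambda>z. F z - \<alpha> * z) has_field_derivative 0) (at z)" for z
  proof -
    have "(F has_field_derivative \<alpha>) (at z)" using hol \<alpha> by (metis holomorphic_derivI open_UNIV UNIV_I)
    then show ?thesis by (auto intro!: derivative_eq_intros)
  qed
  then have "\<exists>c. \<forall>z\<in>UNIV. F z - \<alpha> * z = c"
    by (intro has_field_derivative_zero_constant) auto
  then obtain \<beta> where \<beta>: "\<And>z. F z - \<alpha> * z = \<beta>" by auto
  then have F_eq: "F = (\<lambda>z. \<alpha> * z + \<beta>)" by (auto simp: fun_eq_iff algebra_simps)
  moreover have "\<alpha> * l \<in> L'" if "l \<in> L" for l using diff[OF that, of 0] by (simp add: F_eq)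
  ultimately show thesis using that by blast
qed

lemma torus_point_in_torus [simp]: "torus_point L z \<in> torus L"
  by (simp add: torus_def)

text \<open>Injectivity rules out \<open>\<alpha> = 0\<close>, since then a half period and \<open>0\<close> would have the same image; it also
gives the inclusion of \<open>L'\<close> in \<open>\<alpha> L\<close>.\<close>

lemma iso_affine:
  assumes L: "is_lattice L" and L': "is_lattice L'" and lift: "is_lift L L' \<phi> F"
    and bij: "bij_betw \<phi> (torus L) (torus L')"
  obtains \<alpha> \<beta> where "F = (\<lambda>z. \<alpha> * z + \<beta>)" "\<alpha> \<noteq> 0" "(\<lambda>z. \<alpha> * z) ` L = L'"
proof -
  obtain \<alpha> \<beta> where F: "F = (\<lambda>z. \<alpha> * z + \<beta>)" and sub: "\<And>l. l \<in> L \<Longrightarrow> \<alpha> * l \<in> L'"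
    using lift_affine[OF L L' lift] by blast
  have \<phi>: "\<phi> (torus_point L z) = torus_point L' (\<alpha> * z + \<beta>)" for z using lift F by (simp add: is_lift_def)
  have inj: "z - w \<in> L" if "\<alpha> * z - \<alpha> * w \<in> L'" for z w
  proof -
    have "\<phi> (torus_point L z) = \<phi> (torus_point L w)"
      unfolding \<phi> using that torus_point_eq_iff[OF L'] by simp
    then have "torus_point L z = torus_point L w"
      using bij by (auto simp: bij_betw_def dest: inj_onD)
    then show ?thesis using torus_point_eq_iff[OF L] by simp
  qed
  have nz: "\<alpha> \<noteq> 0"
  proof
    assume "\<alpha> = 0"
    obtain u v where b: "lattice_basis L u v" using L by (auto simp: is_lattice_def)
    have "u / 2 - 0 \<in> L" using \<open>\<alpha> = 0\<close> lattice_closed(1)[OF L'] by (intro inj) simp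
    then show False using half_period_not_in_lattice[OF b] by simp
  qed
  have "(\<lambda>z. \<alpha> * z) ` L = L'"
  proof (intro equalityI subsetI)
    fix l assume l: "l \<in> L'"
    then have "l / \<alpha> - 0 \<in> L" using nz by (intro inj) simp
    then show "l \<in> (\<lambda>z. \<alpha> * z) ` L" using nz by (intro image_eqI[of _ _ "l / \<alpha>"]) auto
  qed (use sub in blast)
  then show thesis using that F nz by blast
qed

lemma affine_image_torus_point:
  "(\<lambda>z. \<alpha> * z + \<beta>) ` torus_point L z = torus_point ((\<lambda>z. \<alpha> * z) ` L) (\<alpha> * z + \<beta>)"
  unfolding torus_point_def image_image by (intro image_cong refl) (simp add: algebra_simps)

lemma affine_iso:
  fixes \<alpha> \<beta> :: complex
  assumes nz: "\<alpha> \<noteq> 0" and eq: "(\<lambda>z. \<alpha> * z) ` L = L'"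
  defines "\<phi> \<equiv> (`) (\<lambda>z. \<alpha> * z + \<beta>)"
  shows "bij_betw \<phi> (torus L) (torus L')" "is_lift L L' \<phi> (\<lambda>z. \<alpha> * z + \<beta>)"
    "is_lift L' L (inv_into (torus L) \<phi>) (\<lambda>z. z / \<alpha> - \<beta> / \<alpha>)"
proof -
  have \<phi>: "\<phi> (torus_point L z) = torus_point L' (\<alpha> * z + \<beta>)" for z
    unfolding \<phi>_def affine_image_torus_point eq ..
  have inj: "inj \<phi>" 
  proof (rule injI)
    fix P Q assume "\<phi> P = \<phi> Q"
    moreover have "inj (\<lambda>z. \<alpha> * z + \<beta>)" using nz by (auto simp: inj_def)
    ultimately show "P = Q" unfolding \<phi>_def by (simp add: inj_image_eq_iff)
  qed
  have "\<phi> ` torus L = torus L'"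
  proof (intro equalityI subsetI)
    fix P assume "P \<in> \<phi> ` torus L"
    then show "P \<in> torus L'" using \<phi> by (auto simp: torus_def)
  next
    fix P assume "P \<in> torus L'"
    then obtain w where w: "P = torus_point L' w" by (auto simp: torus_def)
    then have "P = \<phi> (torus_point L ((w - \<beta>) / \<alpha>))" using nz by (simp add: \<phi>)
    then show "P \<in> \<phi> ` torus L" by simp
  qed
  then show bij: "bij_betw \<phi> (torus L) (torus L')"
    using inj by (auto simp: bij_betw_def intro: inj_on_subset)
  show "is_lift L L' \<phi> (\<lambda>z. \<alpha> * z + \<beta>)"
    unfolding is_lift_def using \<phi> by (auto intro!: holomorphic_intros)
  have "inv_into (torus L) \<phi> (torus_point L' z) = torus_point L (z / \<alpha> - \<beta> / \<alpha>)" for z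
  proof (rule inv_into_f_eq)
    show "inj_on \<phi> (torus L)" using bij by (simp add: bij_betw_def)
    show "\<phi> (torus_point L (z / \<alpha> - \<beta> / \<alpha>)) = torus_point L' z"
      using nz by (simp add: \<phi> right_diff_distrib)
  qed simp
  then show "is_lift L' L (inv_into (torus L) \<phi>) (\<lambda>z. z / \<alpha> - \<beta> / \<alpha>)"
    unfolding is_lift_def using nz by (auto intro!: holomorphic_intros)
qed

lemma deriv_affine: "deriv (\<lambda>z. \<alpha> * z + \<beta>) w = (\<alpha> :: complex)"
  by (rule DERIV_imp_deriv) (auto intro!: derivative_eq_intros)

definition period_lattice :: "elliptic_form \<Rightarrow> complex set" where
  "period_lattice E = (\<lambda>z. form E * z) ` lat E"

lemma elliptic_form_simps:
  assumes "elliptic_form E"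
  shows "is_lattice (lat E)" "form E \<noteq> 0" "marked E \<in> torus (lat E)" "is_lattice (period_lattice E)"
  using assms is_lattice_scale by (auto simp: elliptic_form_def period_lattice_def)

lemma scale_image_eq_iff:
  fixes c c' :: complex
  assumes "c' \<noteq> 0"
  shows "(\<lambda>z. c * z) ` L = (\<lambda>z. c' * z) ` L' \<longleftrightarrow> (\<lambda>z. c / c' * z) ` L = L'"
proof -
  have inj: "inj (\<lambda>z. c' * z)" using assms by (auto simp: inj_def)
  have "(\<lambda>z. c * z) ` L = (\<lambda>z. c' * z) ` ((\<lambda>z. c / c' * z) ` L)"
    unfolding image_image using assms by (intro image_cong refl) simp
  then show ?thesis using inj_image_eq_iff[OF inj] by simp
qed

text \<open>An isomorphism \<open>z \<mapsto> \<alpha> z + \<beta>\<close> pulls \<open>c' dz\<close> back to \<open>c' \<alpha> dz\<close>, so compatibility with the forms fixes \<open>\<alpha>\<close>, and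
\<open>\<alpha> L = L'\<close> becomes equality of the period lattices. The translation \<open>\<beta>\<close> is free to match the marked
points.\<close>

lemma pointed_iso_form_iff:
  assumes E: "elliptic_form E" and E': "elliptic_form E'"
  shows "(\<exists>\<phi> F. pointed_iso E E' \<phi> F \<and> pull F (form E') = form E) \<longleftrightarrow>
    period_lattice E = period_lattice E'"
proof
  assume "\<exists>\<phi> F. pointed_iso E E' \<phi> F \<and> pull F (form E') = form E"
  then obtain \<phi> F where *: "pointed_iso E E' \<phi> F" "pull F (form E') = form E" by blast
  obtain \<alpha> \<beta> where F: "F = (\<lambda>z. \<alpha> * z + \<beta>)" "\<alpha> \<noteq> 0" "(\<lambda>z. \<alpha> * z) ` lat E = lat E'"
    using * iso_affine[of "lat E" "lat E'" \<phi> F] elliptic_form_simps[OF E] elliptic_form_simps[OF E']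
    by (auto simp: pointed_iso_def)
  have "form E' * \<alpha> = form E" using *(2) by (simp add: pull_def F(1) deriv_affine)
  then show "period_lattice E = period_lattice E'"
    unfolding period_lattice_def F(3)[symmetric] image_image by (simp add: mult.assoc[symmetric])
next
  assume eq: "period_lattice E = period_lattice E'"
  define \<alpha> where "\<alpha> = form E / form E'"
  have \<alpha>: "\<alpha> \<noteq> 0" using elliptic_form_simps[OF E] elliptic_form_simps[OF E'] by (simp add: \<alpha>_def)
  have im: "(\<lambda>z. \<alpha> * z) ` lat E = lat E'"
    using eq scale_image_eq_iff[of "form E'" "form E"] elliptic_form_simps[OF E']
    unfolding period_lattice_def \<alpha>_def by blast
  obtain p p' where p: "marked E = torus_point (lat E) p" "marked E' = torus_point (lat E') p'"
    using elliptic_form_simps(3)[OF E] elliptic_form_simps(3)[OF E'] by (auto simp: torus_def)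
  define \<beta> where "\<beta> = p' - \<alpha> * p"
  note iso = affine_iso[OF \<alpha> im, of \<beta>]
  have "(\<lambda>z. \<alpha> * z + \<beta>) ` marked E = marked E'"
    unfolding p affine_image_torus_point im by (simp add: \<beta>_def)
  then have "pointed_iso E E' ((`) (\<lambda>z. \<alpha> * z + \<beta>)) (\<lambda>z. \<alpha> * z + \<beta>)"
    using iso by (simp add: pointed_iso_def)
  moreover have "pull (\<lambda>z. \<alpha> * z + \<beta>) (form E') = form E"
    unfolding pull_def deriv_affine using elliptic_form_simps(2)[OF E'] by (simp add: \<alpha>_def)
  ultimately show "\<exists>\<phi> F. pointed_iso E E' \<phi> F \<and> pull F (form E') = form E" by blast
qed

lemma triple_iso_iff:
  assumes "\<And>j. elliptic_form (X j)" "\<And>j. elliptic_form (Y j)"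
  shows "triple_iso X Y \<longleftrightarrow> (\<forall>j. period_lattice (X j) = period_lattice (Y j))"
  unfolding triple_iso_def using pointed_iso_form_iff assms by simp

lemma elliptic_form_scale: "elliptic_form (X j) \<Longrightarrow> k \<noteq> 0 \<Longrightarrow> elliptic_form (scale k X j)"
  by (simp add: elliptic_form_def scale_def)

lemma period_lattice_scale: "period_lattice (scale k X j) = (\<lambda>z. k * z) ` period_lattice (X j)"
  unfolding period_lattice_def scale_def image_image by (simp add: mult.assoc)

section \<open>The involution of a triple\<close>

lemma minus_image_lattice: "is_lattice L \<Longrightarrow> uminus ` L = L"
proof -
  assume L: "is_lattice L"
  then have "uminus ` L \<subseteq> L" using lattice_closed(3) by blast
  moreover have "L \<subseteq> uminus ` L"
  proof
    fix x assume "x \<in> L"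
    then have "- x \<in> L" by (rule lattice_closed(3)[OF L])
    then show "x \<in> uminus ` L" by (intro image_eqI[of _ _ "- x"]) simp_all
  qed
  ultimately show ?thesis by blast
qed

text \<open>The lift on \<open>X\<^sub>2\<close> is inverse to the one on \<open>X\<^sub>1\<close> up to a function with values in a lattice, which has to be
constant; hence its linear part is \<open>1/\<alpha>\<close>.\<close>

lemma involution_form:
  assumes ell: "\<And>j. elliptic_form (X j)" and inv: "is_involution X \<tau>"
  obtains p \<alpha> \<beta> \<delta> where "\<tau> 0 = (\<lambda>z. 2 * p - z)" "\<tau> 1 = (\<lambda>z. \<alpha> * z + \<beta>)" "\<tau> 2 = (\<lambda>z. z / \<alpha> + \<delta>)"
    "\<alpha> \<noteq> 0" "(\<lambda>z. \<alpha> * z) ` lat (X 1) = lat (X 2)" "form (X 2) * \<alpha> = - form (X 1)"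
proof -
  note L1 = elliptic_form_simps(1)[OF ell, of 1] and L2 = elliptic_form_simps(1)[OF ell, of 2]
  obtain p \<phi> where p: "\<tau> 0 = (\<lambda>z. 2 * p - z)" and iso: "pointed_iso (X 1) (X 2) \<phi> (\<tau> 1)"
    and pl: "pull (\<tau> 1) (form (X 2)) = - form (X 1)"
    and lift2: "is_lift (lat (X 2)) (lat (X 1)) (inv_into (torus (lat (X 1))) \<phi>) (\<tau> 2)"
    using inv unfolding is_involution_def by blast
  have bij: "bij_betw \<phi> (torus (lat (X 1))) (torus (lat (X 2)))"
    and lift1: "is_lift (lat (X 1)) (lat (X 2)) \<phi> (\<tau> 1)" using iso by (auto simp: pointed_iso_def)
  obtain \<alpha> \<beta> where \<alpha>: "\<tau> 1 = (\<lambda>z. \<alpha> * z + \<beta>)" "\<alpha> \<noteq> 0" "(\<lambda>z. \<alpha> * z) ` lat (X 1) = lat (X 2)"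
    using iso_affine[OF L1 L2 lift1 bij] by blast
  obtain \<gamma> \<delta> where \<gamma>: "\<tau> 2 = (\<lambda>z. \<gamma> * z + \<delta>)" using lift_affine[OF L2 L1 lift2] by blast
  have in2: "\<alpha> * (\<gamma> * z + \<delta>) + \<beta> - z \<in> lat (X 2)" for z
  proof -
    let ?P = "torus_point (lat (X 2)) z"
    have "?P \<in> \<phi> ` torus (lat (X 1))" using bij by (simp add: bij_betw_def)
    then have "\<phi> (inv_into (torus (lat (X 1))) \<phi> ?P) = ?P" by (rule f_inv_into_f)
    moreover have "inv_into (torus (lat (X 1))) \<phi> ?P = torus_point (lat (X 1)) (\<gamma> * z + \<delta>)"
      using lift2 \<gamma> by (simp add: is_lift_def)
    moreover have "\<phi> (torus_point (lat (X 1)) (\<gamma> * z + \<delta>)) = torus_point (lat (X 2)) (\<alpha> * (\<gamma> * z + \<delta>) + \<beta>)"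
      using lift1 \<alpha> by (simp add: is_lift_def)
    ultimately show ?thesis using torus_point_eq_iff[OF L2] by simp
  qed
  have "\<alpha> * (\<gamma> * 1 + \<delta>) + \<beta> - 1 = \<alpha> * (\<gamma> * 0 + \<delta>) + \<beta> - 0"
    by (rule lattice_valued_constant[OF L2, of "\<lambda>z. \<alpha> * (\<gamma> * z + \<delta>) + \<beta> - z"])
       (auto intro!: continuous_intros in2)
  then have "\<alpha> * \<gamma> = 1" by (simp add: algebra_simps)
  then have "\<gamma> = 1 / \<alpha>" using \<alpha>(2) by (simp add: field_simps)
  then have "\<tau> 2 = (\<lambda>z. z / \<alpha> + \<delta>)" using \<gamma> by simp
  moreover have "form (X 2) * \<alpha> = - form (X 1)" using pl by (simp add: pull_def \<alpha>(1) deriv_affine)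
  ultimately show thesis using that p \<alpha> by blast
qed

text \<open>The period lattices of \<open>\<omega>\<^sub>2\<close> and of \<open>-\<omega>\<^sub>1\<close> agree, and a lattice is symmetric.\<close>

lemma involution_period_lattice:
  assumes "\<And>j. elliptic_form (X j)" "is_involution X \<tau>"
  shows "period_lattice (X 2) = period_lattice (X 1)"
proof (rule involution_form[OF assms])
  fix \<alpha> assume *: "(\<lambda>z. \<alpha> * z) ` lat (X 1) = lat (X 2)" "form (X 2) * \<alpha> = - form (X 1)"
  have "period_lattice (X 2) = (\<lambda>z. - form (X 1) * z) ` lat (X 1)"
    unfolding period_lattice_def *(1)[symmetric] image_image by (simp add: mult.assoc[symmetric] *(2))
  also have "\<dots> = uminus ` period_lattice (X 1)"
    unfolding period_lattice_def image_image by simp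
  also have "\<dots> = period_lattice (X 1)"
    using elliptic_form_simps(4)[OF assms(1)] by (rule minus_image_lattice)
  finally show ?thesis .
qed

lemma exists_involution:
  assumes ell: "\<And>j. elliptic_form (X j)" and eq: "period_lattice (X 2) = period_lattice (X 1)"
  shows "\<exists>\<tau>. is_involution X \<tau>"
proof -
  note E1 = elliptic_form_simps[OF ell, of 1] and E2 = elliptic_form_simps[OF ell, of 2]
  define \<alpha> where "\<alpha> = - form (X 1) / form (X 2)"
  have \<alpha>: "\<alpha> \<noteq> 0" using E1 E2 by (simp add: \<alpha>_def)
  have "(\<lambda>z. - form (X 1) * z) ` lat (X 1) = uminus ` period_lattice (X 1)"
    unfolding period_lattice_def image_image by simp
  also have "\<dots> = (\<lambda>z. form (X 2) * z) ` lat (X 2)"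
    using minus_image_lattice[OF E1(4)] eq by (simp add: period_lattice_def)
  finally have im: "(\<lambda>z. \<alpha> * z) ` lat (X 1) = lat (X 2)"
    unfolding \<alpha>_def by (rule scale_image_eq_iff[OF E2(2), THEN iffD1])
  have "\<exists>p. marked (X j) = torus_point (lat (X j)) p" for j
    using elliptic_form_simps(3)[OF ell, of j] by (auto simp: torus_def)
  then obtain p0 p p' where p: "marked (X 0) = torus_point (lat (X 0)) p0"
    "marked (X 1) = torus_point (lat (X 1)) p" "marked (X 2) = torus_point (lat (X 2)) p'"
    by meson
  define \<beta> where "\<beta> = p' - \<alpha> * p"
  note iso = affine_iso[OF \<alpha> im, of \<beta>]
  define \<tau> :: "3 \<Rightarrow> complex \<Rightarrow> complex" where
    "\<tau> = (\<lambda>j. if j = 0 then (\<lambda>z. 2 * p0 - z) else if j = 1 then (\<lambda>z. \<alpha> * z + \<beta>) else (\<lambda>z. z / \<alpha> - \<beta> / \<alpha>))"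
  have \<tau>: "\<tau> 0 = (\<lambda>z. 2 * p0 - z)" "\<tau> 1 = (\<lambda>z. \<alpha> * z + \<beta>)" "\<tau> 2 = (\<lambda>z. z / \<alpha> - \<beta> / \<alpha>)"
    by (simp_all add: \<tau>_def)
  have "(\<lambda>z. \<alpha> * z + \<beta>) ` marked (X 1) = marked (X 2)"
    unfolding p affine_image_torus_point im by (simp add: \<beta>_def)
  then have "pointed_iso (X 1) (X 2) ((`) (\<lambda>z. \<alpha> * z + \<beta>)) (\<tau> 1)"
    using iso by (simp add: pointed_iso_def \<tau>)
  moreover have "pull (\<tau> 1) (form (X 2)) = - form (X 1)"
    unfolding pull_def \<tau> deriv_affine using E2(2) by (simp add: \<alpha>_def)
  moreover have "p0 \<in> marked (X 0)"
    unfolding p torus_point_def using lattice_closed(1)[OF elliptic_form_simps(1)[OF ell]]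
    by (intro image_eqI[of _ _ 0]) simp_all
  ultimately show ?thesis
    unfolding is_involution_def using \<tau>(1) iso(3)[folded \<tau>(3)]
    by (intro exI[of _ \<tau>] conjI bexI[of _ p0] exI[of _ "(`) (\<lambda>z. \<alpha> * z + \<beta>)"])
qed

section \<open>Matrices preserving a product of two lattices\<close>

lemma ring_iso_add_pow:
  assumes "ring R" "ring S" "h \<in> ring_iso R S" "x \<in> carrier R"
  shows "h (add_pow R (n :: int) x) = add_pow S n (h x)"
proof -
  interpret R: ring R by fact
  interpret S: ring S by fact
  have "h \<in> hom (add_monoid R) (add_monoid S)"
    using assms(3) by (auto simp: ring_iso_def ring_hom_def hom_def)
  then show ?thesis unfolding add_pow_def
    using assms(4) by (intro hom_int_pow R.a_group S.a_group) auto
qed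

lemma ring_iso_subring_image:
  assumes "ring R" "ring S" "h \<in> ring_iso R S" "subring K R"
  shows "subring (h ` K) S" "R\<lparr>carrier := K\<rparr> \<simeq> S\<lparr>carrier := h ` K\<rparr>"
proof -
  have hom: "h \<in> ring_hom R S" and inj: "inj_on h (carrier R)"
    using assms(3) by (auto simp: ring_iso_def bij_betw_def)
  interpret ring_hom_ring R S h by (rule ring_hom_ringI2[OF assms(1,2) hom])
  show "subring (h ` K) S" by (rule img_is_subring[OF assms(4)])
  have K: "K \<subseteq> carrier R" using subringE(1)[OF assms(4)] .
  have "h \<in> ring_iso (R\<lparr>carrier := K\<rparr>) (S\<lparr>carrier := h ` K\<rparr>)"
    using hom K inj by (auto simp: ring_iso_def ring_hom_def bij_betw_def subset_iff intro: inj_on_subset)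
  then show "R\<lparr>carrier := K\<rparr> \<simeq> S\<lparr>carrier := h ` K\<rparr>" unfolding is_ring_iso_def by blast
qed

lemma matrix_mult_add_right: "(B + C) ** A = B ** A + (C ** A :: 'a :: semiring_1 ^ 'm ^ 'n)"
  by (simp add: matrix_matrix_mult_def vec_eq_iff distrib_right sum.distrib)

definition product_lattice :: "complex set \<Rightarrow> complex set \<Rightarrow> (complex ^ 2) set" where
  "product_lattice L0 L1 = {v. v $ 1 \<in> L0 \<and> v $ 2 \<in> L1}"

definition matrix_ring :: "complex set \<Rightarrow> complex set \<Rightarrow> (complex ^ 2 ^ 2) ring" where
  "matrix_ring L0 L1 = \<lparr>
     carrier = {A. \<forall>v\<in>product_lattice L0 L1. A *v v \<in> product_lattice L0 L1},
     monoid.mult = (**), one = mat 1, zero = 0, add = (+)\<rparr>"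

text \<open>On \<open>H\<^sub>1(X,\<int>)\<^sup>-\<close> the intersection form of \<open>X\<^sub>1\<close> occurs twice, the second time through the isomorphic curve
\<open>X\<^sub>2\<close>. Therefore \<open>L1\<close> has weight \<open>2\<close>.\<close>

definition matrix_self_adjoint :: "complex set \<Rightarrow> complex set \<Rightarrow> complex ^ 2 ^ 2 \<Rightarrow> bool" where
  "matrix_self_adjoint L0 L1 A \<longleftrightarrow> (\<forall>v\<in>product_lattice L0 L1. \<forall>w\<in>product_lattice L0 L1.
     torus_intersection L0 ((A *v v) $ 1) (w $ 1) + 2 * torus_intersection L1 ((A *v v) $ 2) (w $ 2) =
     torus_intersection L0 (v $ 1) ((A *v w) $ 1) + 2 * torus_intersection L1 (v $ 2) ((A *v w) $ 2))"

text \<open>The functional \<open>(x, y) \<mapsto> x + 2 y\<close> is \<open>\<omega>\<close> in the coordinates of the Prym variety: the periods over \<open>X\<^sub>1\<close> and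
\<open>X\<^sub>2\<close> are equal for anti-invariant classes.\<close>

definition matrix_eigenform :: "complex ^ 2 ^ 2 \<Rightarrow> bool" where
  "matrix_eigenform A \<longleftrightarrow> (\<exists>\<mu>. \<forall>v. (A *v v) $ 1 + 2 * (A *v v) $ 2 = \<mu> * (v $ 1 + 2 * v $ 2))"

definition real_mult_matrices :: "int \<Rightarrow> complex set \<Rightarrow> complex set \<Rightarrow> (complex ^ 2 ^ 2) set \<Rightarrow> bool" where
  "real_mult_matrices D L0 L1 R \<longleftrightarrow>
     subring R (matrix_ring L0 L1) \<and>
     (matrix_ring L0 L1)\<lparr>carrier := R\<rparr> \<simeq> quadratic_order D \<and>
     (\<forall>A\<in>R. matrix_self_adjoint L0 L1 A \<and> matrix_eigenform A) \<and>
     (\<forall>A\<in>carrier (matrix_ring L0 L1). \<forall>n::int. n \<noteq> 0 \<longrightarrow> of_int n *\<^sub>R A \<in> R \<longrightarrow> A \<in> R)"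

lemma ring_matrix_ring:
  assumes L0: "is_lattice L0" and L1: "is_lattice L1"
  shows "ring (matrix_ring L0 L1)"
proof (rule ringI)
  have uminus: "- A \<in> carrier (matrix_ring L0 L1)" if "A \<in> carrier (matrix_ring L0 L1)" for A
  proof -
    have "(- A) *v v = - (A *v v)" for v :: "complex ^ 2"
      using matrix_vector_mult_diff_rdistrib[of 0 A v] by simp
    then show ?thesis using that lattice_closed(3)[OF L0] lattice_closed(3)[OF L1]
      by (simp add: matrix_ring_def product_lattice_def)
  qed
  show "abelian_group (matrix_ring L0 L1)"
  proof (rule abelian_groupI)
    show "\<exists>y\<in>carrier (matrix_ring L0 L1). y \<oplus>\<^bsub>matrix_ring L0 L1\<^esub> x = \<zero>\<^bsub>matrix_ring L0 L1\<^esub>"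
      if "x \<in> carrier (matrix_ring L0 L1)" for x
      using uminus[OF that] by (intro bexI[of _ "- x"]) (simp_all add: matrix_ring_def)
  qed (use lattice_closed[OF L0] lattice_closed[OF L1] in
      \<open>auto simp: matrix_ring_def product_lattice_def matrix_vector_mult_add_rdistrib\<close>)
  show "Group.monoid (matrix_ring L0 L1)"
    by (rule monoidI)
       (auto simp: matrix_ring_def matrix_vector_mul_assoc[symmetric] matrix_mul_assoc)
qed (auto simp: matrix_ring_def matrix_add_ldistrib matrix_mult_add_right)

lemma add_pow_matrix_ring:
  assumes L0: "is_lattice L0" and L1: "is_lattice L1" and A: "A \<in> carrier (matrix_ring L0 L1)"
  shows "add_pow (matrix_ring L0 L1) (n :: int) A = of_int n *\<^sub>R A"
proof -
  interpret ring "matrix_ring L0 L1" by (rule ring_matrix_ring[OF L0 L1])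
  have nat: "add_pow (matrix_ring L0 L1) (k :: nat) A = of_nat k *\<^sub>R A" for k
  proof (induction k)
    case 0
    have "add_pow (matrix_ring L0 L1) (0 :: nat) A = \<zero>\<^bsub>matrix_ring L0 L1\<^esub>" by simp
    also have "\<dots> = of_nat 0 *\<^sub>R A" by (simp add: matrix_ring_def)
    finally show ?case .
  next
    case (Suc k)
    have "add_pow (matrix_ring L0 L1) (Suc k) A = add_pow (matrix_ring L0 L1) k A \<oplus>\<^bsub>matrix_ring L0 L1\<^esub> A"
      using A by simp
    also have "\<dots> = of_nat k *\<^sub>R A + A" unfolding Suc by (simp add: matrix_ring_def)
    finally show ?case by (simp add: scaleR_left_distrib)
  qed
  have minus: "\<ominus>\<^bsub>matrix_ring L0 L1\<^esub> B = - B" if B: "B \<in> carrier (matrix_ring L0 L1)" for B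
  proof -
    have "B \<oplus>\<^bsub>matrix_ring L0 L1\<^esub> (\<ominus>\<^bsub>matrix_ring L0 L1\<^esub> B) = \<zero>\<^bsub>matrix_ring L0 L1\<^esub>"
      by (rule r_neg[OF B])
    then have "B + (\<ominus>\<^bsub>matrix_ring L0 L1\<^esub> B) = 0" by (simp add: matrix_ring_def)
    then show ?thesis by (simp add: add_eq_0_iff)
  qed
  show ?thesis
  proof (cases "n \<ge> 0")
    case True
    then show ?thesis using nat[of "nat n"] by (simp add: add_pow_int_ge)
  next
    case False
    have "add_pow (matrix_ring L0 L1) (nat (- n)) A \<in> carrier (matrix_ring L0 L1)" using A by simp
    then show ?thesis using nat[of "nat (- n)"] minus False by (simp add: add_pow_int_lt)
  qed
qed

section \<open>Coordinates on the Prym variety\<close>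

lemma type3: "(3 :: 3) = 0" "(- 1 :: 3) = 2" "(- 2 :: 3) = 1" "(1 :: 3) \<noteq> 0" "(2 :: 3) \<noteq> 0" "(1 :: 3) \<noteq> 2"
  by simp_all

lemma forall_3_zero: "(\<forall>j :: 3. P j) \<longleftrightarrow> P 0 \<and> P 1 \<and> P 2"
  using forall_3[of P] type3(1) by auto

lemma sum_3_zero: "(\<Sum>j\<in>(UNIV :: 3 set). f j) = f 0 + f 1 + (f 2 :: 'a :: comm_monoid_add)"
  using sum_3[of f] type3(1) by (simp add: add.commute add.left_commute)

lemma torus_intersection_scale:
  assumes L: "is_lattice L" and k: "k \<noteq> 0" and xy: "x \<in> L" "y \<in> L"
  shows "torus_intersection ((\<lambda>z. k * z) ` L) (k * x) (k * y) = torus_intersection L x y"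
proof -
  obtain u v where b: "lattice_basis L u v" using L by (auto simp: is_lattice_def)
  have "real_of_int (torus_intersection ((\<lambda>z. k * z) ` L) (k * x) (k * y)) =
      wedge (k * x) (k * y) / wedge (k * u) (k * v)"
    using xy by (intro torus_intersection_wedge lattice_basis_scale[OF b k]) auto
  also have "\<dots> = of_int (torus_intersection L x y)"
    unfolding wedge_mult torus_intersection_wedge[OF b xy] using k by simp
  finally show ?thesis by (simp only: of_int_eq_iff)
qed

text \<open>A triple with an involution, given by the explicit affine lifts of \<open>involution_form\<close>.\<close>

locale prym =
  fixes X :: triple and \<tau> :: "3 \<Rightarrow> complex \<Rightarrow> complex" and \<alpha> \<beta> \<delta> p :: complex
  assumes elliptic: "\<And>j. elliptic_form (X j)"
    and \<tau>0: "\<tau> 0 = (\<lambda>z. 2 * p - z)"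
    and \<tau>1: "\<tau> 1 = (\<lambda>z. \<alpha> * z + \<beta>)"
    and \<tau>2: "\<tau> 2 = (\<lambda>z. z / \<alpha> + \<delta>)"
    and \<alpha>_nonzero: "\<alpha> \<noteq> 0"
    and \<alpha>_lattice: "(\<lambda>z. \<alpha> * z) ` lat (X 1) = lat (X 2)"
    and \<alpha>_form: "form (X 2) * \<alpha> = - form (X 1)"
begin

abbreviation "w0 \<equiv> form (X 0)"
abbreviation "w1 \<equiv> form (X 1)"
abbreviation "L0 \<equiv> period_lattice (X 0)"
abbreviation "L1 \<equiv> period_lattice (X 1)"

lemma w_nonzero: "w0 \<noteq> 0" "w1 \<noteq> 0"
  using elliptic_form_simps(2)[OF elliptic] by auto

lemma is_lattice_L: "is_lattice L0" "is_lattice L1"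
  using elliptic_form_simps(4)[OF elliptic] by auto

lemma forms_minus_iff: "c \<in> forms_minus \<tau> \<longleftrightarrow> c $ 1 = - \<alpha> * c $ 2"
proof -
  have d0: "deriv (\<tau> 0) 0 = - 1"
    using deriv_affine[of "- 1" "2 * p" 0] by (simp add: \<tau>0)
  have d1: "deriv (\<tau> 1) 0 = \<alpha>" by (simp add: \<tau>1 deriv_affine)
  have d2: "deriv (\<tau> 2) 0 = 1 / \<alpha>" using deriv_affine[of "1 / \<alpha>" \<delta> 0] by (simp add: \<tau>2)
  have "c \<in> forms_minus \<tau> \<longleftrightarrow> c $ 2 * \<alpha> = - c $ 1 \<and> c $ 1 / \<alpha> = - c $ 2"
    by (simp add: forms_minus_def vec_eq_iff forall_3_zero pull_def d0 d1 d2 type3)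
  also have "\<dots> \<longleftrightarrow> c $ 1 = - \<alpha> * c $ 2" using \<alpha>_nonzero by (auto simp: field_simps)
  finally show ?thesis .
qed

lemma H1_minus_iff:
  "l \<in> H1_minus X \<tau> \<longleftrightarrow> l $ 0 \<in> lat (X 0) \<and> l $ 1 \<in> lat (X 1) \<and> l $ 2 = - \<alpha> * l $ 1"
proof -
  have p: "push (\<tau> 0) x = - x" "push (\<tau> 1) x = \<alpha> * x" "push (\<tau> 2) x = x / \<alpha>" for x
    by (simp_all add: push_def \<tau>0 \<tau>1 \<tau>2)
  have "l \<in> H1_minus X \<tau> \<longleftrightarrow> (l $ 0 \<in> lat (X 0) \<and> l $ 1 \<in> lat (X 1) \<and> l $ 2 \<in> lat (X 2)) \<and>
      l $ 2 / \<alpha> = - l $ 1 \<and> \<alpha> * l $ 1 = - l $ 2"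
    by (simp add: H1_minus_def vec_eq_iff forall_3_zero type3 p)
  also have "\<dots> \<longleftrightarrow> l $ 0 \<in> lat (X 0) \<and> l $ 1 \<in> lat (X 1) \<and> l $ 2 \<in> lat (X 2) \<and> l $ 2 = - \<alpha> * l $ 1"
    using \<alpha>_nonzero by (auto simp: field_simps)
  also have "\<dots> \<longleftrightarrow> l $ 0 \<in> lat (X 0) \<and> l $ 1 \<in> lat (X 1) \<and> l $ 2 = - \<alpha> * l $ 1"
  proof -
    have "- \<alpha> * l $ 1 \<in> lat (X 2)" if "l $ 1 \<in> lat (X 1)"
      using that lattice_closed(3)[OF elliptic_form_simps(1)[OF elliptic, of 2]] \<alpha>_lattice by fastforce
    then show ?thesis by auto
  qed
  finally show ?thesis .
qed

text \<open>The coordinates \<open>(x, y)\<close> on the dual of \<open>\<Omega>(X)\<^sup>-\<close> are normalized such that integration along a class becomes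
the pair of periods of \<open>\<omega>\<close> over its components on \<open>X\<^sub>0\<close> and \<open>X\<^sub>1\<close>. The factor \<open>2\<close> accounts for the
component on \<open>X\<^sub>2\<close>.\<close>

definition functional :: "complex ^ 2 \<Rightarrow> complex ^ 3 \<Rightarrow> complex" where
  "functional v = (\<lambda>c\<in>forms_minus \<tau>. c $ 0 * v $ 1 / w0 + 2 * c $ 1 * v $ 2 / w1)"

definition e0 :: "complex ^ 3" where "e0 = (\<chi> j. if j = 0 then 1 else 0)"
definition e1 :: "complex ^ 3" where "e1 = (\<chi> j. if j = 0 then 0 else if j = 1 then 1 else - 1 / \<alpha>)"

definition coords :: "(complex ^ 3 \<Rightarrow> complex) \<Rightarrow> complex ^ 2" where
  "coords f = vector [w0 * f e0, w1 / 2 * f e1]"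

lemma e_forms: "e0 \<in> forms_minus \<tau>" "e1 \<in> forms_minus \<tau>"
  using \<alpha>_nonzero by (simp_all add: forms_minus_iff e0_def e1_def type3)

lemma forms_minus_combination:
  assumes "c \<in> forms_minus \<tau>"
  shows "c = c $ 0 *s e0 + c $ 1 *s e1"
  using assms \<alpha>_nonzero by (simp add: forms_minus_iff vec_eq_iff forall_3_zero e0_def e1_def type3)

lemma forms_minus_closed: "c \<in> forms_minus \<tau> \<Longrightarrow> d \<in> forms_minus \<tau> \<Longrightarrow> a *s c + b *s d \<in> forms_minus \<tau>"
  by (simp add: forms_minus_iff algebra_simps)

lemma functional_in_dual: "functional v \<in> dual_forms \<tau>"
  unfolding dual_forms_def
proof (intro CollectI conjI allI ballI)
  show "functional v \<in> extensional (forms_minus \<tau>)" by (simp add: functional_def)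
  fix a b c d assume "c \<in> forms_minus \<tau>" "d \<in> forms_minus \<tau>"
  then show "functional v (a *s c + b *s d) = a * functional v c + b * functional v d"
    using forms_minus_closed by (simp add: functional_def add_divide_distrib algebra_simps)
qed

lemma coords_functional: "coords (functional v) = v"
  using w_nonzero e_forms by (simp add: coords_def functional_def vec_eq_iff forall_2 e0_def e1_def type3)

lemma functional_coords:
  assumes f: "f \<in> dual_forms \<tau>"
  shows "functional (coords f) = f"
proof (rule extensionalityI)
  show "functional (coords f) \<in> extensional (forms_minus \<tau>)" by (simp add: functional_def)
  show "f \<in> extensional (forms_minus \<tau>)" using f by (simp add: dual_forms_def)
  fix c assume c: "c \<in> forms_minus \<tau>"
  have "f c = f (c $ 0 *s e0 + c $ 1 *s e1)" using forms_minus_combination[OF c] by simp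
  also have "\<dots> = c $ 0 * f e0 + c $ 1 * f e1" using f e_forms unfolding dual_forms_def by blast
  finally show "functional (coords f) c = f c"
    using w_nonzero c by (simp add: functional_def coords_def)
qed

lemma functional_inject: "functional v = functional w \<longleftrightarrow> v = w"
  using coords_functional by metis

lemma functional_linear:
  "(\<lambda>c\<in>forms_minus \<tau>. a * functional v c + b * functional w c) = functional (a *s v + b *s w)"
  unfolding functional_def by (rule restrict_ext) (simp add: add_divide_distrib algebra_simps)

lemma integration_functional:
  assumes "l \<in> H1_minus X \<tau>"
  shows "integration \<tau> l = functional (vector [w0 * l $ 0, w1 * l $ 1])"
  unfolding integration_def functional_def
proof (rule restrict_ext)
  fix c assume "c \<in> forms_minus \<tau>"
  then show "(\<Sum>j\<in>UNIV. c $ j * l $ j) = c $ 0 * (vector [w0 * l $ 0, w1 * l $ 1] :: complex ^ 2) $ 1 / w0 +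
      2 * c $ 1 * (vector [w0 * l $ 0, w1 * l $ 1] :: complex ^ 2) $ 2 / w1"
    using assms w_nonzero by (simp add: sum_3_zero forms_minus_iff H1_minus_iff)
qed

lemma product_lattice_vector:
  assumes "l \<in> H1_minus X \<tau>"
  shows "vector [w0 * l $ 0, w1 * l $ 1] \<in> product_lattice L0 L1"
  using assms by (auto simp: product_lattice_def H1_minus_iff period_lattice_def)

lemma product_lattice_obtain:
  assumes "v \<in> product_lattice L0 L1"
  obtains l where "l \<in> H1_minus X \<tau>" "v = vector [w0 * l $ 0, w1 * l $ 1]"
proof -
  obtain x y where xy: "x \<in> lat (X 0)" "y \<in> lat (X 1)" "v $ 1 = w0 * x" "v $ 2 = w1 * y"
    using assms by (auto simp: product_lattice_def period_lattice_def)
  define l :: "complex ^ 3" where "l = (\<chi> j. if j = 0 then x else if j = 1 then y else - \<alpha> * y)"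
  have l: "l $ 0 = x" "l $ 1 = y" "l $ 2 = - \<alpha> * y" by (simp_all add: l_def type3)
  then have "l \<in> H1_minus X \<tau>" using xy by (simp add: H1_minus_iff)
  moreover have "v = vector [w0 * l $ 0, w1 * l $ 1]" using xy l by (simp add: vec_eq_iff forall_2)
  ultimately show thesis using that by blast
qed

lemma integration_image: "integration \<tau> ` H1_minus X \<tau> = functional ` product_lattice L0 L1"
proof (intro equalityI subsetI)
  fix f assume "f \<in> integration \<tau> ` H1_minus X \<tau>"
  then obtain l where l: "l \<in> H1_minus X \<tau>" "f = integration \<tau> l" by blast
  then show "f \<in> functional ` product_lattice L0 L1"
    using integration_functional[OF l(1)] product_lattice_vector[OF l(1)] by simp
next
  fix f assume "f \<in> functional ` product_lattice L0 L1"
  then obtain v where v: "v \<in> product_lattice L0 L1" "f = functional v" by blast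
  obtain l where l: "l \<in> H1_minus X \<tau>" "v = vector [w0 * l $ 0, w1 * l $ 1]"
    using product_lattice_obtain[OF v(1)] .
  then have "f = integration \<tau> l" using integration_functional[OF l(1)] v by simp
  then show "f \<in> integration \<tau> ` H1_minus X \<tau>" using l by blast
qed

definition endo :: "complex ^ 2 ^ 2 \<Rightarrow> (complex ^ 3 \<Rightarrow> complex) \<Rightarrow> complex ^ 3 \<Rightarrow> complex" where
  "endo A = (\<lambda>f\<in>dual_forms \<tau>. functional (A *v coords f))"

lemma endo_functional: "endo A (functional v) = functional (A *v v)"
  using functional_in_dual coords_functional by (simp add: endo_def)

lemma endo_preserves_iff:
  "endo A ` integration \<tau> ` H1_minus X \<tau> \<subseteq> integration \<tau> ` H1_minus X \<tau> \<longleftrightarrow> A \<in> carrier (matrix_ring L0 L1)"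
proof -
  have "endo A ` functional ` product_lattice L0 L1 = functional ` (\<lambda>v. A *v v) ` product_lattice L0 L1"
    unfolding image_image by (simp add: endo_functional)
  moreover have "inj functional" using functional_inject by (simp add: inj_def)
  ultimately show ?thesis
    unfolding integration_image by (auto simp: inj_image_subset_iff matrix_ring_def)
qed

lemma endo_in_prym_End:
  assumes "A \<in> carrier (matrix_ring L0 L1)"
  shows "endo A \<in> carrier (prym_End X \<tau>)"
  unfolding prym_End_def partial_object.simps
proof (intro CollectI conjI allI ballI)
  show "endo A \<in> dual_forms \<tau> \<rightarrow>\<^sub>E dual_forms \<tau>" using functional_in_dual by (auto simp: endo_def)
  show "endo A ` integration \<tau> ` H1_minus X \<tau> \<subseteq> integration \<tau> ` H1_minus X \<tau>"
    using endo_preserves_iff assms by blast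
  fix a b f g assume "f \<in> dual_forms \<tau>" "g \<in> dual_forms \<tau>"
  then obtain v w where fg: "f = functional v" "g = functional w" using functional_coords by metis
  show "endo A (\<lambda>c\<in>forms_minus \<tau>. a * f c + b * g c) = (\<lambda>c\<in>forms_minus \<tau>. a * endo A f c + b * endo A g c)"
    unfolding fg functional_linear endo_functional
    by (simp add: matrix_vector_right_distrib vector_scalar_commute)
qed

text \<open>An endomorphism is linear on the dual space by definition, so in coordinates it is a matrix.\<close>

lemma endo_surj:
  assumes "T \<in> carrier (prym_End X \<tau>)"
  obtains A where "A \<in> carrier (matrix_ring L0 L1)" "T = endo A"
proof -
  have T1: "T \<in> dual_forms \<tau> \<rightarrow>\<^sub>E dual_forms \<tau>"
    and T2: "\<And>a b f g. f \<in> dual_forms \<tau> \<Longrightarrow> g \<in> dual_forms \<tau> \<Longrightarrow>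
       T (\<lambda>c\<in>forms_minus \<tau>. a * f c + b * g c) = (\<lambda>c\<in>forms_minus \<tau>. a * T f c + b * T g c)"
    and T3: "T ` integration \<tau> ` H1_minus X \<tau> \<subseteq> integration \<tau> ` H1_minus X \<tau>"
    using assms by (auto simp: prym_End_def)
  define h where "h = (\<lambda>v. coords (T (functional v)))"
  have Th: "T (functional v) = functional (h v)" for v
    unfolding h_def using T1 functional_in_dual by (intro functional_coords[symmetric]) auto
  have lin: "h (a *s v + b *s w) = a *s h v + b *s h w" for a b v w
  proof -
    have "functional (h (a *s v + b *s w)) = functional (a *s h v + b *s h w)"
      using T2[OF functional_in_dual functional_in_dual, of a v b w]
      unfolding functional_linear Th .
    then show ?thesis by (simp only: functional_inject)
  qed
  have "Vector_Spaces.linear (*s) (*s) h"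
  proof unfold_locales
    show "h (v + w) = h v + h w" for v w using lin[of 1 v 1 w] by simp
    show "h (a *s v) = a *s h v" for a v using lin[of a v 0 0] by simp
  qed
  then have mat: "matrix h *v v = h v" for v by (rule matrix_works)
  have "T = endo (matrix h)"
  proof (rule extensionalityI[of _ "dual_forms \<tau>"])
    show "T \<in> extensional (dual_forms \<tau>)" using T1 by (simp add: PiE_def)
    show "endo (matrix h) \<in> extensional (dual_forms \<tau>)" by (simp add: endo_def)
    fix f assume "f \<in> dual_forms \<tau>"
    then have "f = functional (coords f)" by (simp add: functional_coords)
    then show "T f = endo (matrix h) f" using Th endo_functional mat by metis
  qed
  moreover from this have "matrix h \<in> carrier (matrix_ring L0 L1)"
    using T3 endo_preserves_iff by simp
  ultimately show thesis using that by blast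
qed

lemma endo_inject: "endo A = endo B \<longleftrightarrow> A = B"
proof
  assume "endo A = endo B"
  then have "functional (A *v v) = functional (B *v v)" for v using endo_functional by metis
  then show "A = B" unfolding matrix_eq functional_inject by blast
qed simp

lemma endo_ring_iso: "endo \<in> ring_iso (matrix_ring L0 L1) (prym_End X \<tau>)"
proof -
  have comp: "endo (A ** B) = compose (dual_forms \<tau>) (endo A) (endo B)" for A B
  proof (rule extensionalityI[of _ "dual_forms \<tau>"])
    show "endo (A ** B) \<in> extensional (dual_forms \<tau>)" by (simp add: endo_def)
    show "compose (dual_forms \<tau>) (endo A) (endo B) \<in> extensional (dual_forms \<tau>)" by (rule compose_extensional)
    fix f assume f: "f \<in> dual_forms \<tau>"
    then have ff: "f = functional (coords f)" by (simp add: functional_coords)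
    have "endo (A ** B) f = endo A (endo B f)"
      by (subst (1 2) ff) (simp only: endo_functional matrix_vector_mul_assoc)
    then show "endo (A ** B) f = compose (dual_forms \<tau>) (endo A) (endo B) f"
      using f by (simp add: compose_def)
  qed
  have add: "endo (A + B) = (\<lambda>f\<in>dual_forms \<tau>. \<lambda>c\<in>forms_minus \<tau>. endo A f c + endo B f c)" for A B
  proof (rule extensionalityI[of _ "dual_forms \<tau>"])
    show "endo (A + B) \<in> extensional (dual_forms \<tau>)" by (simp add: endo_def)
    fix f assume f: "f \<in> dual_forms \<tau>"
    then obtain v where v: "f = functional v" using functional_coords by metis
    show "endo (A + B) f = (\<lambda>f\<in>dual_forms \<tau>. \<lambda>c\<in>forms_minus \<tau>. endo A f c + endo B f c) f"
      using functional_linear[of 1 "A *v v" 1 "B *v v"] f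
      unfolding v by (simp add: endo_functional matrix_vector_mult_add_rdistrib)
  qed simp
  have one: "endo (mat 1) = (\<lambda>f\<in>dual_forms \<tau>. f)"
    unfolding endo_def by (rule restrict_ext) (simp add: functional_coords)
  have "endo \<in> ring_hom (matrix_ring L0 L1) (prym_End X \<tau>)"
    using endo_in_prym_End comp add one
    by (auto simp: ring_hom_def matrix_ring_def prym_End_def)
  moreover have "bij_betw endo (carrier (matrix_ring L0 L1)) (carrier (prym_End X \<tau>))"
    unfolding bij_betw_def
  proof
    show "inj_on endo (carrier (matrix_ring L0 L1))" by (simp add: inj_on_def endo_inject)
    show "endo ` carrier (matrix_ring L0 L1) = carrier (prym_End X \<tau>)"
      using endo_in_prym_End endo_surj by blast
  qed
  ultimately show ?thesis by (simp add: ring_iso_def)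
qed

lemma ring_prym_End: "ring (prym_End X \<tau>)"
proof -
  interpret ring "matrix_ring L0 L1" by (rule ring_matrix_ring[OF is_lattice_L])
  have "endo 0 = (\<lambda>f\<in>dual_forms \<tau>. \<lambda>c\<in>forms_minus \<tau>. 0)"
    unfolding endo_def by (rule restrict_ext) (simp add: functional_def)
  then have "(prym_End X \<tau>)\<lparr>zero := endo \<zero>\<^bsub>matrix_ring L0 L1\<^esub>\<rparr> = prym_End X \<tau>"
    by (simp add: matrix_ring_def prym_End_def)
  then show ?thesis using ring_iso_imp_img_ring[OF endo_ring_iso] by simp
qed

text \<open>The isomorphism \<open>z \<mapsto> -\<alpha> z\<close> carries the component on \<open>X\<^sub>1\<close> of an anti-invariant class to the one on \<open>X\<^sub>2\<close>
and preserves intersection numbers.\<close>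

lemma intersection_product_lattice:
  assumes a: "a \<in> H1_minus X \<tau>" and b: "b \<in> H1_minus X \<tau>"
  shows "intersection X a b = torus_intersection L0 (w0 * a $ 0) (w0 * b $ 0) +
    2 * torus_intersection L1 (w1 * a $ 1) (w1 * b $ 1)"
proof -
  have lat: "is_lattice (lat (X 0))" "is_lattice (lat (X 1))" using elliptic_form_simps(1)[OF elliptic] by auto
  have 0: "torus_intersection L0 (w0 * a $ 0) (w0 * b $ 0) = torus_intersection (lat (X 0)) (a $ 0) (b $ 0)"
    unfolding period_lattice_def using a b by (intro torus_intersection_scale lat w_nonzero) (simp_all add: H1_minus_iff)
  have 1: "torus_intersection L1 (w1 * a $ 1) (w1 * b $ 1) = torus_intersection (lat (X 1)) (a $ 1) (b $ 1)"
    unfolding period_lattice_def using a b by (intro torus_intersection_scale lat w_nonzero) (simp_all add: H1_minus_iff)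
  have "(\<lambda>z. - \<alpha> * z) ` lat (X 1) = uminus ` lat (X 2)"
    unfolding \<alpha>_lattice[symmetric] image_image by simp
  then have im: "(\<lambda>z. - \<alpha> * z) ` lat (X 1) = lat (X 2)"
    using minus_image_lattice[OF elliptic_form_simps(1)[OF elliptic, of 2]] by simp
  have "torus_intersection (lat (X 2)) (a $ 2) (b $ 2) = torus_intersection (lat (X 1)) (a $ 1) (b $ 1)"
    using torus_intersection_scale[OF lat(2), of "- \<alpha>" "a $ 1" "b $ 1"] a b \<alpha>_nonzero
    unfolding im by (simp add: H1_minus_iff)
  then show ?thesis using 0 1 by (simp add: intersection_def sum_3_zero)
qed

lemma self_adjoint_endo:
  assumes A: "A \<in> carrier (matrix_ring L0 L1)"
  shows "self_adjoint X \<tau> (endo A) \<longleftrightarrow> matrix_self_adjoint L0 L1 A"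
proof -
  let ?v = "\<lambda>l :: complex ^ 3. vector [w0 * l $ 0, w1 * l $ 1] :: complex ^ 2"
  have eq: "endo A (integration \<tau> a) = integration \<tau> a' \<longleftrightarrow> A *v ?v a = ?v a'"
    if "a \<in> H1_minus X \<tau>" "a' \<in> H1_minus X \<tau>" for a a'
    using that by (simp only: integration_functional endo_functional functional_inject)
  have int: "intersection X a b = torus_intersection L0 (?v a $ 1) (?v b $ 1) + 2 * torus_intersection L1 (?v a $ 2) (?v b $ 2)"
    if "a \<in> H1_minus X \<tau>" "b \<in> H1_minus X \<tau>" for a b
    using intersection_product_lattice[OF that] by simp
  have pres: "A *v v \<in> product_lattice L0 L1" if "v \<in> product_lattice L0 L1" for v
    using A that by (simp add: matrix_ring_def)
  show ?thesis
  proof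
    assume sa: "self_adjoint X \<tau> (endo A)"
    show "matrix_self_adjoint L0 L1 A" unfolding matrix_self_adjoint_def
    proof (intro ballI)
      fix v w assume v: "v \<in> product_lattice L0 L1" and w: "w \<in> product_lattice L0 L1"
      obtain a where a: "a \<in> H1_minus X \<tau>" "v = ?v a" using product_lattice_obtain[OF v] .
      obtain b where b: "b \<in> H1_minus X \<tau>" "w = ?v b" using product_lattice_obtain[OF w] .
      obtain a' where a': "a' \<in> H1_minus X \<tau>" "A *v v = ?v a'" using product_lattice_obtain[OF pres[OF v]] .
      obtain b' where b': "b' \<in> H1_minus X \<tau>" "A *v w = ?v b'" using product_lattice_obtain[OF pres[OF w]] .
      have "intersection X a' b = intersection X a b'"
        using sa a(1) b(1) a'(1) b'(1) eq[OF a(1) a'(1)] eq[OF b(1) b'(1)] a'(2) b'(2)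
        unfolding self_adjoint_def a(2) b(2) by blast
      then show "torus_intersection L0 ((A *v v) $ 1) (w $ 1) + 2 * torus_intersection L1 ((A *v v) $ 2) (w $ 2) =
         torus_intersection L0 (v $ 1) ((A *v w) $ 1) + 2 * torus_intersection L1 (v $ 2) ((A *v w) $ 2)"
        unfolding a'(2) b'(2) unfolding a(2) b(2) using int[OF a'(1) b(1)] int[OF a(1) b'(1)] by simp
    qed
  next
    assume ms: "matrix_self_adjoint L0 L1 A"
    show "self_adjoint X \<tau> (endo A)" unfolding self_adjoint_def
    proof (intro ballI impI)
      fix a b a' b' assume h: "a \<in> H1_minus X \<tau>" "b \<in> H1_minus X \<tau>" "a' \<in> H1_minus X \<tau>" "b' \<in> H1_minus X \<tau>"
        "endo A (integration \<tau> a) = integration \<tau> a'" "endo A (integration \<tau> b) = integration \<tau> b'"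
      have "A *v ?v a = ?v a'" "A *v ?v b = ?v b'" using h eq by blast+
      then show "intersection X a' b = intersection X a b'"
        using ms product_lattice_vector[OF h(1)] product_lattice_vector[OF h(2)] int[OF h(3,2)] int[OF h(1,4)]
        unfolding matrix_self_adjoint_def by metis
    qed
  qed
qed

lemma forms_in_forms_minus: "(\<chi> j. form (X j)) \<in> forms_minus \<tau>"
  using \<alpha>_form by (simp add: forms_minus_iff mult.commute minus_equation_iff)

lemma eigenform_endo: "eigenform \<tau> (endo A) (\<chi> j. form (X j)) \<longleftrightarrow> matrix_eigenform A"
proof -
  have f: "functional v (\<chi> j. form (X j)) = v $ 1 + 2 * v $ 2" for v
    using forms_in_forms_minus w_nonzero by (simp add: functional_def)
  have "(\<forall>f\<in>dual_forms \<tau>. endo A f (\<chi> j. form (X j)) = \<mu> * f (\<chi> j. form (X j))) \<longleftrightarrow>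
     (\<forall>v. (A *v v) $ 1 + 2 * (A *v v) $ 2 = \<mu> * (v $ 1 + 2 * v $ 2))" for \<mu>
  proof
    assume *: "\<forall>f\<in>dual_forms \<tau>. endo A f (\<chi> j. form (X j)) = \<mu> * f (\<chi> j. form (X j))"
    show "\<forall>v. (A *v v) $ 1 + 2 * (A *v v) $ 2 = \<mu> * (v $ 1 + 2 * v $ 2)"
    proof
      fix v
      show "(A *v v) $ 1 + 2 * (A *v v) $ 2 = \<mu> * (v $ 1 + 2 * v $ 2)"
        using bspec[OF * functional_in_dual[of v]] unfolding endo_functional f .
    qed
  next
    assume *: "\<forall>v. (A *v v) $ 1 + 2 * (A *v v) $ 2 = \<mu> * (v $ 1 + 2 * v $ 2)"
    show "\<forall>f\<in>dual_forms \<tau>. endo A f (\<chi> j. form (X j)) = \<mu> * f (\<chi> j. form (X j))"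
    proof
      fix g assume "g \<in> dual_forms \<tau>"
      then obtain v where v: "g = functional v" using functional_coords by metis
      show "endo A g (\<chi> j. form (X j)) = \<mu> * g (\<chi> j. form (X j))"
        unfolding v endo_functional f using * by blast
    qed
  qed
  then show ?thesis unfolding eigenform_def matrix_eigenform_def by simp
qed

text \<open>The isomorphism of rings \<open>endo\<close> translates every clause of the definition of real multiplication.\<close>

theorem real_mult_iff_matrices:
  "(\<exists>R. real_mult D X \<tau> R \<and> (\<forall>T\<in>R. eigenform \<tau> T (\<chi> j. form (X j)))) \<longleftrightarrow>
   (\<exists>R. real_mult_matrices D L0 L1 R)"
proof
  let ?M = "matrix_ring L0 L1" and ?P = "prym_End X \<tau>"
  note rM = ring_matrix_ring[OF is_lattice_L] and rP = ring_prym_End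
  assume "\<exists>R. real_mult D X \<tau> R \<and> (\<forall>T\<in>R. eigenform \<tau> T (\<chi> j. form (X j)))"
  then obtain R where R: "real_mult D X \<tau> R" "\<And>T. T \<in> R \<Longrightarrow> eigenform \<tau> T (\<chi> j. form (X j))" by blast
  have sub: "subring R ?P" using R(1) by (simp add: real_mult_def)
  define g where "g = inv_into (carrier ?M) endo"
  have g: "g \<in> ring_iso ?P ?M" unfolding g_def by (rule ring_iso_set_sym[OF rM endo_ring_iso])
  have RP: "R \<subseteq> carrier ?P" using subringE(1)[OF sub] .
  have endo_g: "endo (g T) = T" "g T \<in> carrier ?M" if "T \<in> carrier ?P" for T
  proof -
    have "T \<in> endo ` carrier ?M" using endo_ring_iso that by (simp add: ring_iso_def bij_betw_def)
    then show "endo (g T) = T" "g T \<in> carrier ?M"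
      unfolding g_def by (rule f_inv_into_f, rule inv_into_into)
  qed
  have iso: "?M\<lparr>carrier := g ` R\<rparr> \<simeq> quadratic_order D"
  proof -
    have "?P\<lparr>carrier := R\<rparr> \<simeq> ?M\<lparr>carrier := g ` R\<rparr>" by (rule ring_iso_subring_image(2)[OF rP rM g sub])
    then have "?M\<lparr>carrier := g ` R\<rparr> \<simeq> ?P\<lparr>carrier := R\<rparr>"
      by (rule ring_iso_sym[OF ring.subring_is_ring[OF rP sub]])
    then show ?thesis using R(1) ring_iso_trans by (auto simp: real_mult_def)
  qed
  have mem: "A \<in> g ` R" if "A \<in> carrier ?M" "endo A \<in> R" for A
  proof -
    have "g (endo A) = A"
      unfolding g_def using that(1) by (intro inv_into_f_f) (simp_all add: inj_on_def endo_inject)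
    then show ?thesis using that(2) by (metis imageI)
  qed
  have "real_mult_matrices D L0 L1 (g ` R)"
    unfolding real_mult_matrices_def
  proof (intro conjI ballI allI impI iso)
    show "subring (g ` R) ?M" by (rule ring_iso_subring_image(1)[OF rP rM g sub])
    fix A assume "A \<in> g ` R"
    then obtain T where T: "T \<in> R" "A = g T" by blast
    then have "endo A = T" "A \<in> carrier ?M" using endo_g RP by auto
    then show "matrix_self_adjoint L0 L1 A" "matrix_eigenform A"
      using self_adjoint_endo[of A] eigenform_endo[of A] R T by (auto simp: real_mult_def)
  next
    fix A and n :: int assume A: "A \<in> carrier ?M" "n \<noteq> 0" "of_int n *\<^sub>R A \<in> g ` R"
    then obtain T where T: "T \<in> R" "of_int n *\<^sub>R A = g T" by blast
    have "add_pow ?P n (endo A) = endo (add_pow ?M n A)"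
      by (rule ring_iso_add_pow[OF rM rP endo_ring_iso A(1), symmetric])
    also have "\<dots> = endo (g T)" using add_pow_matrix_ring[OF is_lattice_L A(1)] T(2) by simp
    also have "\<dots> = T" using endo_g T RP by blast
    finally have "add_pow ?P n (endo A) \<in> R" using T by simp
    then have "endo A \<in> R"
      using R(1) A(2) endo_in_prym_End[OF A(1)] unfolding real_mult_def by blast
    then show "A \<in> g ` R" by (rule mem[OF A(1)])
  qed
  then show "\<exists>R. real_mult_matrices D L0 L1 R" by blast
next
  let ?M = "matrix_ring L0 L1" and ?P = "prym_End X \<tau>"
  note rM = ring_matrix_ring[OF is_lattice_L] and rP = ring_prym_End
  assume "\<exists>R. real_mult_matrices D L0 L1 R"
  then obtain R where R: "real_mult_matrices D L0 L1 R" by blast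
  have sub: "subring R ?M" using R by (simp add: real_mult_matrices_def)
  have RM: "R \<subseteq> carrier ?M" using subringE(1)[OF sub] .
  have iso: "?P\<lparr>carrier := endo ` R\<rparr> \<simeq> quadratic_order D"
  proof -
    have "?M\<lparr>carrier := R\<rparr> \<simeq> ?P\<lparr>carrier := endo ` R\<rparr>"
      by (rule ring_iso_subring_image(2)[OF rM rP endo_ring_iso sub])
    then have "?P\<lparr>carrier := endo ` R\<rparr> \<simeq> ?M\<lparr>carrier := R\<rparr>"
      by (rule ring_iso_sym[OF ring.subring_is_ring[OF rM sub]])
    then show ?thesis using R ring_iso_trans by (auto simp: real_mult_matrices_def)
  qed
  have "real_mult D X \<tau> (endo ` R)"
    unfolding real_mult_def
  proof (intro conjI ballI allI impI iso)
    show "subring (endo ` R) ?P" by (rule ring_iso_subring_image(1)[OF rM rP endo_ring_iso sub])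
    fix T assume "T \<in> endo ` R"
    then obtain A where "A \<in> R" "T = endo A" by blast
    then show "self_adjoint X \<tau> T"
      using R RM self_adjoint_endo by (auto simp: real_mult_matrices_def)
  next
    fix T and n :: int assume T: "T \<in> carrier ?P" "n \<noteq> 0" "add_pow ?P n T \<in> endo ` R"
    obtain A where A: "A \<in> carrier ?M" "T = endo A" using endo_surj[OF T(1)] .
    have "add_pow ?P n T = endo (of_int n *\<^sub>R A)"
      using ring_iso_add_pow[OF rM rP endo_ring_iso A(1), of n] add_pow_matrix_ring[OF is_lattice_L A(1)] A(2) by simp
    then have "of_int n *\<^sub>R A \<in> R" using T(3) endo_inject by auto
    then have "A \<in> R" using R A(1) T(2) unfolding real_mult_matrices_def by blast
    then show "T \<in> endo ` R" using A(2) by blast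
  qed
  moreover have "\<forall>T\<in>endo ` R. eigenform \<tau> T (\<chi> j. form (X j))"
    using R eigenform_endo by (auto simp: real_mult_matrices_def)
  ultimately show "\<exists>R. real_mult D X \<tau> R \<and> (\<forall>T\<in>R. eigenform \<tau> T (\<chi> j. form (X j)))" by blast
qed

end

section \<open>Real multiplication in terms of the two period lattices\<close>

text \<open>The factor \<open>c\<close> with \<open>c \<Lambda>\<^sub>0 \<subseteq> \<Lambda>\<^sub>1\<close> that belongs to \<open>e\<close>. With \<open>q = \<surd>D + e\<close> it satisfies \<open>c q = (D - e\<^sup>2) / 4\<close>, which is
twice the index of \<open>c \<Lambda>\<^sub>0\<close> in \<open>\<Lambda>\<^sub>1\<close>.\<close>

definition multiplier :: "int \<Rightarrow> int \<Rightarrow> real" where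
  "multiplier D e = (sqrt (of_int D) - of_int e) / 4"

text \<open>\<open>M\<close> is the matrix of the isogeny \<open>x \<mapsto> c x\<close> with respect to the bases \<open>a, b\<close> and \<open>u, v\<close>, written as rows.\<close>

definition basis_relation :: "complex \<Rightarrow> mat2 \<Rightarrow> complex \<Rightarrow> complex \<Rightarrow> complex \<Rightarrow> complex \<Rightarrow> bool" where
  "basis_relation c M a b u v \<longleftrightarrow>
     c * a = of_int (m11 M) * u + of_int (m12 M) * v \<and> c * b = of_int (m21 M) * u + of_int (m22 M) * v"

definition real_mult_lattices :: "int \<Rightarrow> complex set \<Rightarrow> complex set \<Rightarrow> bool" where
  "real_mult_lattices D L0 L1 \<longleftrightarrow> (\<exists>e a b u v M. lattice_basis L0 a b \<and> lattice_basis L1 u v \<and>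
     e \<in> admissible D \<and> mdet M = level_index D e \<and> coprime (content M) e \<and>
     basis_relation (of_real (multiplier D e)) M a b u v)"

lemma level_index_8: "e \<in> admissible D \<Longrightarrow> 8 * level_index D e = D - e\<^sup>2"
  by (simp add: admissible_def level_index_def)

lemma admissible_less_sqrt:
  assumes "e \<in> admissible D"
  shows "\<bar>of_int e\<bar> < sqrt (of_int D)"
proof -
  have "real_of_int (e\<^sup>2) < of_int D" using assms unfolding admissible_def of_int_less_iff by simp
  then have "(real_of_int e)\<^sup>2 < of_int D" by simp
  then have "sqrt ((real_of_int e)\<^sup>2) < sqrt (of_int D)" by (rule real_sqrt_less_mono)
  then show ?thesis by simp
qed

lemma multiplier_pos: "e \<in> admissible D \<Longrightarrow> multiplier D e > 0"
  using admissible_less_sqrt[of e D] by (simp add: multiplier_def)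

lemma sqrt_independent:
  assumes "\<nexists>k. D = k\<^sup>2" "D > 0" "real_of_int x = of_int y * sqrt (of_int D)"
  shows "x = 0 \<and> y = 0"
proof -
  have "(real_of_int x)\<^sup>2 = (of_int y)\<^sup>2 * of_int D" using assms by (simp add: power_mult_distrib)
  then have "real_of_int (x\<^sup>2) = of_int (y\<^sup>2 * D)" by simp
  then have sq: "x\<^sup>2 = y\<^sup>2 * D" by (simp only: of_int_eq_iff)
  have "y = 0"
  proof (rule ccontr)
    assume y: "y \<noteq> 0"
    have "y\<^sup>2 dvd x\<^sup>2" using sq by simp
    then have "y dvd x" by simp
    then obtain k where "x = y * k" ..
    then have "y\<^sup>2 * k\<^sup>2 = y\<^sup>2 * D" using sq by (simp add: power_mult_distrib)
    then have "D = k\<^sup>2" using y by simp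
    then show False using assms(1) by blast
  qed
  then show ?thesis using sq by simp
qed

lemma wedge_basis_relation:
  assumes "basis_relation (of_real c) M a b u v"
  shows "c\<^sup>2 * wedge a b = of_int (mdet M) * wedge u v"
proof -
  have "c\<^sup>2 * wedge a b = wedge (of_real c * a) (of_real c * b)" by (simp add: power2_eq_square)
  also have "\<dots> = of_int (m11 M * m22 M - m12 M * m21 M) * wedge u v"
    using assms unfolding basis_relation_def by (simp only: wedge_int_combination)
  finally show ?thesis by (simp add: mdet_def)
qed

lemma real_multiplier_integer:
  assumes b: "lattice_basis L u v" and x: "of_real x * u \<in> L"
  shows "\<exists>n. x = of_int n"
proof -
  obtain m n where "of_real x * u = of_int m * u + of_int n * v" using x mem_lattice[OF b] by blast
  then have "of_real x * u + of_real 0 * v = of_real (of_int m) * u + of_real (of_int n) * v" by simp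
  then have "x = of_int m" by (rule wedge_independent(1)[OF lattice_basis_pos[OF b]])
  then show ?thesis ..
qed

lemma matrix_mult_vec_2: "(A *v v) $ 1 = A $ 1 $ 1 * v $ 1 + A $ 1 $ 2 * v $ 2"
   "(A *v v) $ 2 = A $ 2 $ 1 * v $ 1 + A $ 2 $ 2 * v $ 2" for A :: "complex ^ 2 ^ 2"
  by (simp_all add: matrix_vector_mult_def sum_2)

lemma matrix_mult_2: "(A ** B) $ i $ j = A $ i $ 1 * B $ 1 $ j + A $ i $ 2 * B $ 2 $ j" for A :: "complex ^ 2 ^ 2"
  by (simp add: matrix_matrix_mult_def sum_2)

lemma matrix_eq_2: "A = B \<longleftrightarrow> A $ 1 $ 1 = B $ 1 $ 1 \<and> A $ 1 $ 2 = B $ 1 $ 2 \<and> A $ 2 $ 1 = B $ 2 $ 1 \<and> A $ 2 $ 2 = B $ 2 $ 2"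
  for A :: "complex ^ 2 ^ 2"
  by (auto simp: vec_eq_iff forall_2)

lemma mat_entries: "(mat 1 :: complex ^ 2 ^ 2) $ 1 $ 1 = 1" "(mat 1 :: complex ^ 2 ^ 2) $ 1 $ 2 = 0"
  "(mat 1 :: complex ^ 2 ^ 2) $ 2 $ 1 = 0" "(mat 1 :: complex ^ 2 ^ 2) $ 2 $ 2 = 1"
  by (simp_all add: mat_def)

lemma matrix_ring_carrier_iff:
  assumes "is_lattice L0" "is_lattice L1"
  shows "A \<in> carrier (matrix_ring L0 L1) \<longleftrightarrow>
    (\<forall>x\<in>L0. A $ 1 $ 1 * x \<in> L0 \<and> A $ 2 $ 1 * x \<in> L1) \<and> (\<forall>y\<in>L1. A $ 1 $ 2 * y \<in> L0 \<and> A $ 2 $ 2 * y \<in> L1)"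
proof
  assume A: "A \<in> carrier (matrix_ring L0 L1)"
  have "A *v v \<in> product_lattice L0 L1" if "v \<in> product_lattice L0 L1" for v
    using A that by (simp add: matrix_ring_def)
  then have *: "A $ 1 $ 1 * x + A $ 1 $ 2 * y \<in> L0 \<and> A $ 2 $ 1 * x + A $ 2 $ 2 * y \<in> L1"
    if "x \<in> L0" "y \<in> L1" for x y
    using that by (auto simp: product_lattice_def matrix_mult_vec_2 dest!: spec[of _ "vector [x, y]"] meta_spec[of _ "vector [x, y]"])
  show "(\<forall>x\<in>L0. A $ 1 $ 1 * x \<in> L0 \<and> A $ 2 $ 1 * x \<in> L1) \<and> (\<forall>y\<in>L1. A $ 1 $ 2 * y \<in> L0 \<and> A $ 2 $ 2 * y \<in> L1)"
    using *[OF _ lattice_closed(1)[OF assms(2)]] *[OF lattice_closed(1)[OF assms(1)]] by simp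
next
  assume "(\<forall>x\<in>L0. A $ 1 $ 1 * x \<in> L0 \<and> A $ 2 $ 1 * x \<in> L1) \<and> (\<forall>y\<in>L1. A $ 1 $ 2 * y \<in> L0 \<and> A $ 2 $ 2 * y \<in> L1)"
  then show "A \<in> carrier (matrix_ring L0 L1)"
    using lattice_closed(2)[OF assms(1)] lattice_closed(2)[OF assms(2)]
    by (simp add: matrix_ring_def product_lattice_def matrix_mult_vec_2)
qed

lemma lattice_basis_subset:
  assumes b: "lattice_basis L u v" and L': "is_lattice L'" and "c * u \<in> L'" "c * v \<in> L'" "x \<in> L"
  shows "c * x \<in> L'"
proof -
  obtain m n where x: "x = of_int m * u + of_int n * v" using mem_lattice[OF b] assms(5) by blast
  have "of_int m * (c * u) + of_int n * (c * v) \<in> L'"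
    using assms lattice_closed(2,5)[OF L'] by simp
  moreover have "of_int m * (c * u) + of_int n * (c * v) = c * x" by (simp add: x algebra_simps)
  ultimately show ?thesis by simp
qed

lemma matrix_self_adjoint_wedge:
  assumes b0: "lattice_basis L0 a b" and b1: "lattice_basis L1 u v"
    and A: "A \<in> carrier (matrix_ring L0 L1)"
  shows "matrix_self_adjoint L0 L1 A \<longleftrightarrow> (\<forall>x\<in>product_lattice L0 L1. \<forall>y\<in>product_lattice L0 L1.
     wedge ((A *v x) $ 1) (y $ 1) / wedge a b + 2 * (wedge ((A *v x) $ 2) (y $ 2) / wedge u v) =
     wedge (x $ 1) ((A *v y) $ 1) / wedge a b + 2 * (wedge (x $ 2) ((A *v y) $ 2) / wedge u v))"
proof -
  have "torus_intersection L0 ((A *v x) $ 1) (y $ 1) + 2 * torus_intersection L1 ((A *v x) $ 2) (y $ 2) =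
     torus_intersection L0 (x $ 1) ((A *v y) $ 1) + 2 * torus_intersection L1 (x $ 2) ((A *v y) $ 2) \<longleftrightarrow>
     wedge ((A *v x) $ 1) (y $ 1) / wedge a b + 2 * (wedge ((A *v x) $ 2) (y $ 2) / wedge u v) =
     wedge (x $ 1) ((A *v y) $ 1) / wedge a b + 2 * (wedge (x $ 2) ((A *v y) $ 2) / wedge u v)"
    if x: "x \<in> product_lattice L0 L1" and y: "y \<in> product_lattice L0 L1" for x y
  proof -
    have pres: "A *v x \<in> product_lattice L0 L1" "A *v y \<in> product_lattice L0 L1"
      using A x y by (simp_all add: matrix_ring_def)
    have T: "wedge s t / wedge a b = of_int (torus_intersection L0 s t)" if "s \<in> L0" "t \<in> L0" for s t
      using torus_intersection_wedge[OF b0 that] by simp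
    have T': "wedge s t / wedge u v = of_int (torus_intersection L1 s t)" if "s \<in> L1" "t \<in> L1" for s t
      using torus_intersection_wedge[OF b1 that] by simp
    have m: "x $ 1 \<in> L0" "y $ 1 \<in> L0" "x $ 2 \<in> L1" "y $ 2 \<in> L1" "(A *v x) $ 1 \<in> L0" "(A *v y) $ 1 \<in> L0"
      "(A *v x) $ 2 \<in> L1" "(A *v y) $ 2 \<in> L1"
      using x y pres by (simp_all add: product_lattice_def)
    have "(i :: int) + 2 * j = k + 2 * l \<longleftrightarrow> real_of_int i + 2 * real_of_int j = of_int k + 2 * of_int l" for i j k l
      by linarith
    then show ?thesis unfolding T[OF m(5,2)] T[OF m(1,6)] T'[OF m(7,4)] T'[OF m(3,8)] .
  qed
  then show ?thesis unfolding matrix_self_adjoint_def by (intro ball_cong refl) blast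
qed

lemma exists_nonzero_wedge:
  assumes "wedge u v > 0" "a \<noteq> 0"
  shows "wedge a u \<noteq> 0 \<or> wedge a v \<noteq> 0"
proof (rule ccontr)
  assume "\<not> ?thesis"
  then have "wedge u a = 0" "wedge a v = 0" using wedge_commute[of u a] by auto
  then have "a = of_real 0 * u + of_real 0 * v" using wedge_coordinates[OF assms(1), of a] by simp
  then show False using assms by simp
qed

text \<open>The inverse of the isogeny is given by the adjugate matrix divided by the determinant. Thus \<open>q\<close> is
twice the dual isogeny, and it is integral, with the same content as \<open>2 M\<close>.\<close>

lemma dual_basis_relation:
  assumes rel: "basis_relation c M a b u v" and c: "c \<noteq> 0" and q: "c * q = 2 * of_int (mdet M)"
  shows "q * u = 2 * (of_int (m22 M) * a - of_int (m12 M) * b)" "q * v = 2 * (of_int (m11 M) * b - of_int (m21 M) * a)"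
proof -
  have ca: "c * a = of_int (m11 M) * u + of_int (m12 M) * v" and cb: "c * b = of_int (m21 M) * u + of_int (m22 M) * v"
    using rel by (simp_all add: basis_relation_def)
  have "c * (q * u) = 2 * (of_int (m22 M) * (c * a) - of_int (m12 M) * (c * b))"
    unfolding ca cb mult.assoc[symmetric] q by (simp add: mdet_def algebra_simps)
  also have "\<dots> = c * (2 * (of_int (m22 M) * a - of_int (m12 M) * b))" by (simp add: algebra_simps)
  finally show "q * u = 2 * (of_int (m22 M) * a - of_int (m12 M) * b)" using c by simp
  have "c * (q * v) = 2 * (of_int (m11 M) * (c * b) - of_int (m21 M) * (c * a))"
    unfolding ca cb mult.assoc[symmetric] q by (simp add: mdet_def algebra_simps)
  also have "\<dots> = c * (2 * (of_int (m11 M) * b - of_int (m21 M) * a))" by (simp add: algebra_simps)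
  finally show "q * v = 2 * (of_int (m11 M) * b - of_int (m21 M) * a)" using c by simp
qed

text \<open>The generator of the order \<open>\<O>\<^sub>D\<close>; it is a root of \<open>x\<^sup>2 = D x - N\<close> with \<open>4 N = D\<^sup>2 - D\<close>.\<close>

definition theta :: "int \<Rightarrow> real" where
  "theta D = (of_int D + sqrt (of_int D)) / 2"

lemma theta_square:
  assumes "D > 0" "4 * N = D\<^sup>2 - D"
  shows "theta D * theta D = of_int D * theta D + of_int (- N) * 1"
proof -
  have "4 * real_of_int N = (of_int D)\<^sup>2 - of_int D"
    using arg_cong[OF assms(2), of real_of_int] by simp
  moreover have "sqrt (of_int D) * sqrt (of_int D) = of_int D" using assms by simp
  ultimately show ?thesis by (simp add: theta_def field_simps power2_eq_square)
qed

lemma theta_independent: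
  assumes D: "\<nexists>k. D = k\<^sup>2" "D > 0" and eq: "of_int a + of_int b * theta D = of_int a' + of_int b' * theta D"
  shows "a = a' \<and> b = b'"
proof -
  have "real_of_int (2 * (a' - a) + (b' - b) * D) = of_int (b - b') * sqrt (of_int D)"
    using eq by (simp add: theta_def field_simps)
  then have "2 * (a' - a) + (b' - b) * D = 0 \<and> b - b' = 0" by (rule sqrt_independent[OF D])
  then show ?thesis by auto
qed

lemma carrier_quadratic_order: "carrier (quadratic_order D) = {of_int a + of_int b * theta D | a b. True}"
  by (simp add: quadratic_order_def theta_def)

lemma mem_quadratic_order: "of_int a + of_int b * theta D \<in> carrier (quadratic_order D)"
  unfolding carrier_quadratic_order by blast

lemma matrix_carrier_mem:
  assumes "A \<in> carrier (matrix_ring L0 L1)" "is_lattice L0" "is_lattice L1"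
  shows "x \<in> L0 \<Longrightarrow> A $ 1 $ 1 * x \<in> L0" "x \<in> L0 \<Longrightarrow> A $ 2 $ 1 * x \<in> L1"
    "y \<in> L1 \<Longrightarrow> A $ 1 $ 2 * y \<in> L0" "y \<in> L1 \<Longrightarrow> A $ 2 $ 2 * y \<in> L1"
  using assms matrix_ring_carrier_iff[OF assms(2,3), of A] by blast+

text \<open>Testing self-adjointness on a vector \<open>(a, 0)\<close> against itself gives \<open>-Im p = Im p\<close> for the diagonal entry
\<open>p\<close>, and likewise for the other one.\<close>

lemma self_adjoint_diagonal_real:
  assumes b0: "lattice_basis L0 a b" and b1: "lattice_basis L1 u v"
    and A: "A \<in> carrier (matrix_ring L0 L1)" and sa: "matrix_self_adjoint L0 L1 A"
  shows "Im (A $ 1 $ 1) = 0" "Im (A $ 2 $ 2) = 0"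
proof -
  have L: "is_lattice L0" "is_lattice L1" using b0 b1 by (auto simp: is_lattice_def)
  note pos = lattice_basis_pos[OF b0] lattice_basis_pos[OF b1]
  have S: "wedge ((A *v x) $ 1) (y $ 1) / wedge a b + 2 * (wedge ((A *v x) $ 2) (y $ 2) / wedge u v) =
     wedge (x $ 1) ((A *v y) $ 1) / wedge a b + 2 * (wedge (x $ 2) ((A *v y) $ 2) / wedge u v)"
    if "x \<in> product_lattice L0 L1" "y \<in> product_lattice L0 L1" for x y
    using sa that unfolding matrix_self_adjoint_wedge[OF b0 b1 A] by blast
  have im: "wedge (z * t) t = - Im z * (cmod t)\<^sup>2" "wedge t (z * t) = Im z * (cmod t)\<^sup>2" for z t
    unfolding cmod_power2 by (simp_all add: wedge_def power2_eq_square algebra_simps)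
  have a0: "a \<noteq> 0" "u \<noteq> 0" using pos by auto
  have "vector [a, 0] \<in> product_lattice L0 L1" "vector [0, u] \<in> product_lattice L0 L1"
    using lattice_basis_mem[OF b0] lattice_basis_mem[OF b1] lattice_closed(1)[OF L(1)] lattice_closed(1)[OF L(2)]
    by (simp_all add: product_lattice_def)
  then have "- Im (A $ 1 $ 1) * (cmod a)\<^sup>2 / wedge a b = Im (A $ 1 $ 1) * (cmod a)\<^sup>2 / wedge a b"
    "- Im (A $ 2 $ 2) * (cmod u)\<^sup>2 / wedge u v = Im (A $ 2 $ 2) * (cmod u)\<^sup>2 / wedge u v"
    using S[of "vector [a, 0]" "vector [a, 0]"] S[of "vector [0, u]" "vector [0, u]"]
    by (simp_all add: matrix_mult_vec_2 im)
  then show "Im (A $ 1 $ 1) = 0" "Im (A $ 2 $ 2) = 0" using pos a0 by (simp_all add: field_simps)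
qed

text \<open>Here self-adjointness is tested on \<open>(a, 0)\<close> and \<open>(0, y)\<close>.\<close>

lemma self_adjoint_off_diagonal:
  assumes b0: "lattice_basis L0 a b" and b1: "lattice_basis L1 u v"
    and A: "A \<in> carrier (matrix_ring L0 L1)" and sa: "matrix_self_adjoint L0 L1 A"
    and real: "A $ 1 $ 2 = of_real q" "A $ 2 $ 1 = of_real r"
  shows "2 * r * wedge a b = q * wedge u v"
proof -
  have L: "is_lattice L0" "is_lattice L1" using b0 b1 by (auto simp: is_lattice_def)
  note pos = lattice_basis_pos[OF b0] lattice_basis_pos[OF b1]
  have a0: "a \<noteq> 0" using pos by auto
  obtain y where y: "y \<in> L1" "wedge a y \<noteq> 0"
    using exists_nonzero_wedge[OF pos(2) a0] lattice_basis_mem[OF b1] by blast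
  have mem: "vector [a, 0] \<in> product_lattice L0 L1" "vector [0, y] \<in> product_lattice L0 L1"
    using lattice_basis_mem[OF b0] y lattice_closed(1)[OF L(1)] lattice_closed(1)[OF L(2)]
    by (simp_all add: product_lattice_def)
  have "2 * (r * wedge a y / wedge u v) = q * wedge a y / wedge a b"
    using bspec[OF bspec[OF sa[unfolded matrix_self_adjoint_wedge[OF b0 b1 A]] mem(1)] mem(2)]
    by (simp add: matrix_mult_vec_2 real)
  then have "wedge a y * (2 * r * wedge a b) = wedge a y * (q * wedge u v)" using pos by (simp add: field_simps)
  then show ?thesis using y(2) by simp
qed

text \<open>Let \<open>A\<close>, with rows \<open>(p, q)\<close> and \<open>(r, s)\<close>, be the matrix of the generator of \<open>\<O>\<^sub>D\<close>. The eigenvector condition reads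
\<open>p + 2 r = \<mu>\<close> and \<open>q + 2 s = 2 \<mu>\<close>, and the eigenvalue \<open>\<mu>\<close> is one of \<open>(D \<plusminus> \<surd>D) / 2\<close>. Self-adjointness makes
\<open>p\<close> and \<open>s\<close> real; as multipliers of lattices they are integers \<open>P\<close> and \<open>S\<close>, and \<open>P + S = D\<close> is the trace. This
expresses \<open>r\<close> and \<open>q\<close> by \<open>\<surd>D\<close> and \<open>P - S\<close>. The index of \<open>r \<Lambda>\<^sub>0\<close> in \<open>\<Lambda>\<^sub>1\<close> follows from the
off-diagonal part of self-adjointness. If \<open>k > 1\<close> divided both the content of that sublattice and
\<open>P - S\<close>, then \<open>(A - S) / k\<close> would still be an endomorphism, against properness.\<close>

lemma real_mult_matrices_imp_lattices:
  assumes D: "\<nexists>k. D = k\<^sup>2" "D > 0" "4 * N = D\<^sup>2 - D"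
    and L: "is_lattice L0" "is_lattice L1" and R: "real_mult_matrices D L0 L1 R"
  shows "real_mult_lattices D L0 L1"
proof -
  let ?M = "matrix_ring L0 L1" and ?O = "quadratic_order D"
  interpret M: ring ?M by (rule ring_matrix_ring[OF L])
  have sub: "subring R ?M" and iso: "?M\<lparr>carrier := R\<rparr> \<simeq> ?O"
    and RA: "\<And>A. A \<in> R \<Longrightarrow> matrix_self_adjoint L0 L1 A \<and> matrix_eigenform A"
    and proper: "\<And>A n. A \<in> carrier ?M \<Longrightarrow> (n :: int) \<noteq> 0 \<Longrightarrow> of_int n *\<^sub>R A \<in> R \<Longrightarrow> A \<in> R"
    using R by (auto simp: real_mult_matrices_def)
  obtain h where h: "h \<in> ring_iso (?M\<lparr>carrier := R\<rparr>) ?O" using iso by (auto simp: is_ring_iso_def)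
  define g where "g = inv_into R h"
  have "g \<in> ring_iso ?O (?M\<lparr>carrier := R\<rparr>)"
    using ring_iso_set_sym[OF M.subring_is_ring[OF sub] h] by (simp add: g_def)
  then have g: "\<And>x. x \<in> carrier ?O \<Longrightarrow> g x \<in> R"
    "\<And>x y. x \<in> carrier ?O \<Longrightarrow> y \<in> carrier ?O \<Longrightarrow> g (x * y) = g x ** g y"
    "\<And>x y. x \<in> carrier ?O \<Longrightarrow> y \<in> carrier ?O \<Longrightarrow> g (x + y) = g x + g y"
    "g 1 = mat 1" "inj_on g (carrier ?O)" "g ` carrier ?O = R"
    by (auto simp: ring_iso_def ring_hom_def bij_betw_def quadratic_order_def matrix_ring_def)
  \<comment> \<open>\<open>g\<close> is the embedding of \<open>\<O>\<^sub>D\<close> as a ring of matrices and \<open>A\<close> the image of its generator.\<close>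
  define A where "A = g (theta D)"
  have gcomb: "g (of_int m + of_int n * theta D) = of_int m *\<^sub>R mat 1 + of_int n *\<^sub>R A" for m n
  proof -
    have O: "of_int i + of_int j * theta D \<in> carrier ?O" for i j by (rule mem_quadratic_order)
    have int_mult: "g (of_int n * x) = of_int n *\<^sub>R g x"
      if x: "\<And>n :: int. of_int n * x \<in> carrier ?O" for n x
    proof -
      have step: "g (of_int (i + 1) * x) = g (of_int i * x) + g x" for i
        using g(3)[OF x[of i] x[of 1]] by (simp add: algebra_simps)
      have zero: "g (of_int 0 * x) = 0" using g(3)[OF x[of 0] x[of 0]] by simp
      show ?thesis
      proof (induction n rule: int_induct[of _ 0])
        case base
        then show ?case using zero by simp
      next
        case (step1 i)
        then show ?case using step[of i] by (simp add: algebra_simps)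
      next
        case (step2 i)
        then show ?case using step[of "i - 1"] by (simp add: algebra_simps)
      qed
    qed
    have "g (of_int m * 1 + of_int n * theta D) = g (of_int m * 1) + g (of_int n * theta D)"
      using O[of m 0] O[of 0 n] by (intro g(3)) simp_all
    also have "\<dots> = of_int m *\<^sub>R g 1 + of_int n *\<^sub>R g (theta D)"
      using int_mult[of 1 m] int_mult[of "theta D" n] O[of _ 0] O[of 0] by simp
    finally show ?thesis by (simp add: g(4) A_def)
  qed
  have AR: "A \<in> R" unfolding A_def using mem_quadratic_order[of 0 1 D] by (intro g(1)) simp
  then have AM: "A \<in> carrier ?M" using subringE(1)[OF sub] by blast
  have sa: "matrix_self_adjoint L0 L1 A" and eig: "matrix_eigenform A" using RA[OF AR] by auto
  have quad: "A ** A = of_int D *\<^sub>R A - of_int N *\<^sub>R mat 1"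
  proof -
    have "A ** A = g (theta D * theta D)"
      unfolding A_def using mem_quadratic_order[of 0 1 D] by (intro g(2)[symmetric]) simp_all
    also have "theta D * theta D = of_int (- N) + of_int D * theta D"
      using theta_square[OF D(2,3)] by simp
    finally show ?thesis unfolding gcomb by simp
  qed
  define p q r s where "p = A $ 1 $ 1" and "q = A $ 1 $ 2" and "r = A $ 2 $ 1" and "s = A $ 2 $ 2"
  note pqrs = p_def[symmetric] q_def[symmetric] r_def[symmetric] s_def[symmetric]
  obtain \<mu> where \<mu>: "p + 2 * r = \<mu>" "q + 2 * s = 2 * \<mu>"
  proof -
    obtain \<mu> where *: "\<And>v. (A *v v) $ 1 + 2 * (A *v v) $ 2 = \<mu> * (v $ 1 + 2 * v $ 2)"
      using eig by (auto simp: matrix_eigenform_def)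
    show thesis
      using that[of \<mu>] *[of "vector [1, 0]"] *[of "vector [0, 1]"]
      by (simp add: matrix_mult_vec_2 pqrs mult.commute)
  qed
  have A2: "p * p + q * r = of_int D * p - of_int N" "p * q + q * s = of_int D * q"
    "r * p + s * r = of_int D * r"
    using quad unfolding matrix_eq_2 matrix_mult_2
    by (simp_all add: mat_entries pqrs scaleR_conv_of_real[where 'a = complex])
  \<comment> \<open>The eigenvalue satisfies the equation of \<open>A\<close>, hence is \<open>(D \<plusminus> \<surd>D) / 2\<close>; the sign is called \<open>\<sigma>\<close> below.\<close>
  have mu2: "\<mu> * \<mu> = of_int D * \<mu> - of_int N"
  proof -
    have "\<mu> * \<mu> = p * (p + 2 * r) + (q + 2 * s) * r"
      using \<mu> by (simp add: algebra_simps) (metis distrib_right mult.commute mult.left_commute)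
    also have "\<dots> = (p * p + q * r) + 2 * (r * p + s * r)" by (simp add: algebra_simps)
    also have "\<dots> = of_int D * \<mu> - of_int N" unfolding A2 \<mu>(1)[symmetric] by (simp add: algebra_simps)
    finally show ?thesis .
  qed
  define \<sigma>0 where "\<sigma>0 = (2 * \<mu> - of_int D) / of_real (sqrt (of_int D))"
  have sqD: "complex_of_real (sqrt (of_int D)) * of_real (sqrt (of_int D)) = of_int D" "sqrt (of_int D) > 0"
    using D(2) by (simp_all flip: of_real_mult)
  have N4: "4 * complex_of_int N = of_int D * of_int D - of_int D"
    using arg_cong[OF D(3), of complex_of_int] by (simp add: power2_eq_square)
  have "(2 * \<mu> - of_int D) * (2 * \<mu> - of_int D) = 4 * (\<mu> * \<mu>) - 4 * of_int D * \<mu> + of_int D * of_int D"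
    by (simp add: algebra_simps)
  also have "\<dots> = of_int D" unfolding mu2 using N4 by (simp add: algebra_simps)
  finally have "(2 * \<mu> - of_int D) * (2 * \<mu> - of_int D) = of_int D" .
  then have "\<sigma>0 * \<sigma>0 = 1" using sqD D(2) by (simp add: \<sigma>0_def)
  then have "\<sigma>0 = 1 \<or> \<sigma>0 = -1" by (simp add: square_eq_1_iff)
  then obtain \<sigma> :: int where \<sigma>: "\<sigma> = 1 \<or> \<sigma> = -1" "\<sigma>0 = of_int \<sigma>"
    using that[of 1] that[of "-1"] by auto
  define m where "m = (of_int D + of_int \<sigma> * sqrt (of_int D)) / 2"
  have \<mu>m: "\<mu> = of_real m"
  proof -
    have "2 * \<mu> - of_int D = of_int \<sigma> * of_real (sqrt (of_int D))"
      using \<sigma>(2) sqD(2) by (simp add: \<sigma>0_def field_simps)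
    then show ?thesis by (simp add: m_def field_simps)
  qed
  obtain a b where b0: "lattice_basis L0 a b" using L by (auto simp: is_lattice_def)
  obtain u v where b1: "lattice_basis L1 u v" using L by (auto simp: is_lattice_def)
  note pos = lattice_basis_pos[OF b0] lattice_basis_pos[OF b1]
  note mem0 = lattice_basis_mem[OF b0] and mem1 = lattice_basis_mem[OF b1]
  note carr = matrix_carrier_mem[OF AM L, unfolded pqrs]
  have "Im p = 0" "Im s = 0" using self_adjoint_diagonal_real[OF b0 b1 AM sa] by (simp_all add: pqrs)
  then have "p = of_real (Re p)" "s = of_real (Re s)" by (simp_all add: complex_eq_iff)
  then obtain P S :: int where PS: "p = of_int P" "s = of_int S"
    using real_multiplier_integer[OF b0, of "Re p"] real_multiplier_integer[OF b1, of "Re s"]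
      carr(1)[OF mem0(1)] carr(4)[OF mem1(1)] by (metis of_real_of_int_eq)
  define r' q' where "r' = (m - of_int P) / 2" and "q' = 2 * (m - of_int S)"
  have rq: "r = of_real r'" "q = of_real q'"
    using \<mu> unfolding \<mu>m PS by (auto simp: r'_def q'_def algebra_simps)
  \<comment> \<open>Otherwise \<open>\<mu>\<close> would be an integer. Then the entry \<open>q\<close> of the equation for \<open>A\<close> gives the trace.\<close>
  have q0: "q' \<noteq> 0"
  proof
    assume "q' = 0"
    then have "real_of_int (2 * S - D) = of_int \<sigma> * sqrt (of_int D)" by (simp add: q'_def m_def field_simps)
    then show False using sqrt_independent[OF D(1,2)] \<sigma>(1) by fastforce
  qed
  have tr: "P + S = D"
  proof -
    have "q * (of_int P + of_int S - of_int D) = 0" using A2(2) unfolding PS by (simp add: algebra_simps)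
    then have "complex_of_int (P + S) = of_int D" using q0 rq by simp
    then show ?thesis by (simp only: of_int_eq_iff)
  qed
  define e0 where "e0 = P - S"
  have qr: "4 * (q' * r') = of_int (D - e0\<^sup>2)"
  proof -
    have "2 * m - D = of_int \<sigma> * sqrt (of_int D)" by (simp add: m_def field_simps)
    then have sq: "(2 * m - D) * (2 * m - D) = of_int D" using \<sigma>(1) D(2) by auto
    have PSD: "2 * real_of_int P = D + e0" "2 * real_of_int S = D - e0" using tr by (simp_all add: e0_def)
    have "4 * (q' * r') = (2 * m - 2 * real_of_int P) * (2 * m - 2 * real_of_int S)" by (simp add: q'_def r'_def)
    also have "\<dots> = (2 * m - D) * (2 * m - D) - real_of_int e0 * e0"
      unfolding PSD by (simp add: algebra_simps)
    finally show ?thesis unfolding sq by (simp add: power2_eq_square)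
  qed
  obtain x1 x2 where ra: "r * a = of_int x1 * u + of_int x2 * v" using carr(2)[OF mem0(1)] mem_lattice[OF b1] by blast
  obtain y1 y2 where rb: "r * b = of_int y1 * u + of_int y2 * v" using carr(2)[OF mem0(2)] mem_lattice[OF b1] by blast
  define M0 where "M0 = Mat x1 x2 y1 y2"
  have rel0: "basis_relation (of_real r') M0 a b u v"
    using ra rb rq by (simp add: basis_relation_def M0_def)
  have adj: "2 * r' * wedge a b = q' * wedge u v"
    by (rule self_adjoint_off_diagonal[OF b0 b1 AM sa]) (simp_all add: pqrs rq)
  have det: "2 * of_int (mdet M0) = q' * r'"
  proof -
    have "wedge u v * (2 * of_int (mdet M0)) = r' * (2 * r' * wedge a b)"
      using wedge_basis_relation[OF rel0] by (simp add: power2_eq_square mult_ac)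
    also have "\<dots> = wedge u v * (q' * r')" unfolding adj by simp
    finally show ?thesis using pos by simp
  qed
  have "r' \<noteq> 0" using adj q0 pos by auto
  have detpos: "mdet M0 > 0"
  proof -
    have "0 < r'\<^sup>2 * wedge a b" using \<open>r' \<noteq> 0\<close> pos by simp
    then have "0 < real_of_int (mdet M0)" using wedge_basis_relation[OF rel0] pos by (simp add: zero_less_mult_iff)
    then show ?thesis by simp
  qed
  have det8: "8 * mdet M0 = D - e0\<^sup>2"
  proof -
    have "real_of_int (8 * mdet M0) = of_int (D - e0\<^sup>2)" using det qr by simp
    then show ?thesis by (simp only: of_int_eq_iff)
  qed
  \<comment> \<open>If \<open>\<mu>\<close> is the conjugate root, then \<open>r = -c\<close>; the sign is absorbed by passing from \<open>e0\<close> and \<open>M0\<close> to \<open>-e0\<close> and \<open>-M0\<close>.\<close>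
  define e where "e = \<sigma> * e0"
  have e2: "e\<^sup>2 = e0\<^sup>2" using \<sigma>(1) by (auto simp: e_def)
  have adm: "e \<in> admissible D" 
  proof -
    have "e0\<^sup>2 < D" using det8 detpos by linarith
    moreover have "8 dvd D - e0\<^sup>2" unfolding det8[symmetric] by simp
    ultimately show ?thesis by (simp add: admissible_def e2)
  qed
  have lev: "mdet M0 = level_index D e" using level_index_8[OF adm] det8 e2 by simp
  define M where "M = Mat (\<sigma> * x1) (\<sigma> * x2) (\<sigma> * y1) (\<sigma> * y2)"
  have detM: "mdet M = level_index D e" using \<sigma>(1) lev by (auto simp: mdet_def M_def M0_def)
  have mult: "multiplier D e = of_int \<sigma> * r'"
  proof -
    have "r' = (of_int \<sigma> * sqrt (of_int D) - e0) / 4" using tr by (simp add: r'_def m_def e0_def field_simps)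
    then show ?thesis using \<sigma>(1) by (auto simp: multiplier_def e_def)
  qed
  have rel: "basis_relation (of_real (multiplier D e)) M a b u v"
    unfolding mult using rel0 \<sigma>(1) by (auto simp: basis_relation_def M_def M0_def)
  have "coprime (content M) e"
  proof -
    define k where "k = gcd (content M) e"
    have "content M \<noteq> 0"
    proof
      assume "content M = 0"
      then have "mdet M = 0" by (simp add: content_def mdet_def)
      then show False using detM level_index_pos[OF adm] by simp
    qed
    then have k: "k > 0" by (simp add: k_def gcd_pos_int)
    have "k dvd content M0" "k dvd e0"
    proof -
      have "k dvd content M" "k dvd e" by (simp_all add: k_def)
      then show "k dvd content M0" "k dvd e0"
        using \<sigma>(1) unfolding dvd_content_iff by (auto simp: M_def M0_def e_def)
    qed
    then obtain i1 i2 j1 j2 f where ij: "x1 = k * i1" "x2 = k * i2" "y1 = k * j1" "y2 = k * j2" "e0 = k * f"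
      unfolding dvd_content_iff M0_def mat2.sel unfolding dvd_def by metis
    have dual: "q * u = 2 * (of_int y2 * a - of_int x2 * b)" "q * v = 2 * (of_int x1 * b - of_int y1 * a)"
    proof -
      have "of_real r' * q = 2 * complex_of_int (mdet M0)"
        using arg_cong[OF det, of complex_of_real] by (simp add: rq mult.commute)
      then show "q * u = 2 * (of_int y2 * a - of_int x2 * b)" "q * v = 2 * (of_int x1 * b - of_int y1 * a)"
        using dual_basis_relation[OF rel0] \<open>r' \<noteq> 0\<close> by (simp_all add: M0_def)
    qed
    \<comment> \<open>\<open>B = (A - S) / k\<close> has integral diagonal entries \<open>(P - S) / k\<close> and \<open>0\<close>, and the off-diagonal entries remain integral by the choice of \<open>k\<close>.\<close>
    define B :: "complex ^ 2 ^ 2" where "B = (1 / of_int k) *\<^sub>R (A - of_int S *\<^sub>R mat 1)"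
    have B: "B $ 1 $ 1 = of_int f" "B $ 1 $ 2 = q / of_int k" "B $ 2 $ 1 = r / of_int k" "B $ 2 $ 2 = 0"
    proof -
      have "p - s = of_int k * of_int f" unfolding PS using ij(5) e0_def by (simp flip: of_int_diff of_int_mult)
      then show "B $ 1 $ 1 = of_int f" using k
        by (simp add: B_def mat_entries pqrs scaleR_conv_of_real[where 'a = complex] PS(2)[symmetric])
      show "B $ 1 $ 2 = q / of_int k" "B $ 2 $ 1 = r / of_int k" "B $ 2 $ 2 = 0"
        using PS(2) by (simp_all add: B_def mat_entries pqrs scaleR_conv_of_real[where 'a = complex] field_simps)
    qed
    have kk: "of_int k \<noteq> (0 :: complex)" using k by simp
    have "r / of_int k * a = of_int i1 * u + of_int i2 * v" "r / of_int k * b = of_int j1 * u + of_int j2 * v"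
      using ra rb ij kk by (simp_all add: field_simps)
    then have rk: "r / of_int k * a \<in> L1" "r / of_int k * b \<in> L1" using mem_lattice[OF b1] by blast+
    have "q / of_int k * u = of_int (2 * j2) * a + of_int (- 2 * i2) * b" "q / of_int k * v = of_int (- 2 * j1) * a + of_int (2 * i1) * b"
      using dual ij kk by (simp_all add: field_simps)
    then have qk: "q / of_int k * u \<in> L0" "q / of_int k * v \<in> L0" using mem_lattice[OF b0] by blast+
    have "B \<in> carrier ?M"
      unfolding matrix_ring_carrier_iff[OF L] B
      using lattice_closed(5)[OF L(1)] lattice_closed(1)[OF L(2)]
        lattice_basis_subset[OF b0 L(2) rk] lattice_basis_subset[OF b1 L(1) qk] by simp
    moreover have kB: "of_int k *\<^sub>R B = g (of_int (- S) + of_int 1 * theta D)"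
      unfolding gcomb B_def using k by simp
    moreover have "g (of_int (- S) + of_int 1 * theta D) \<in> R" by (rule g(1)[OF mem_quadratic_order])
    ultimately have "B \<in> R" using proper[of B k] k by simp
    then obtain x where x: "x \<in> carrier ?O" "B = g x" using g(6) by blast
    then obtain i j :: int where ij': "x = of_int i + of_int j * theta D" by (auto simp: carrier_quadratic_order)
    have "of_int k *\<^sub>R B = g (of_int (k * i) + of_int (k * j) * theta D)"
      unfolding x(2) ij' gcomb by (simp add: scaleR_right_distrib)
    then have "g (of_int (k * i) + of_int (k * j) * theta D) = g (of_int (- S) + of_int 1 * theta D)" using kB by simp
    then have "of_int (k * i) + of_int (k * j) * theta D = of_int (- S) + of_int 1 * theta D"
      using inj_onD[OF g(5) _ mem_quadratic_order mem_quadratic_order] by blast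
    \<comment> \<open>By properness \<open>B\<close> is the image of \<open>i + j \<theta>\<close>, and comparison of the coefficients of \<open>\<theta>\<close> leaves \<open>k = 1\<close>.\<close>
    then have "k * j = 1" using theta_independent[OF D(1,2)] by blast
    then have "k = 1" using k by (simp add: zmult_eq_1_iff)
    then show ?thesis by (simp add: k_def coprime_iff_gcd_eq_1)
  qed
  then show ?thesis unfolding real_mult_lattices_def using b0 b1 adm detM rel by blast
qed

lemma real_entries_self_adjoint:
  assumes b0: "lattice_basis L0 a b" and b1: "lattice_basis L1 u v"
    and A: "A \<in> carrier (matrix_ring L0 L1)"
    and real: "A $ 1 $ 1 = of_real p" "A $ 1 $ 2 = of_real q" "A $ 2 $ 1 = of_real r" "A $ 2 $ 2 = of_real s"
    and adj: "2 * r * wedge a b = q * wedge u v"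
  shows "matrix_self_adjoint L0 L1 A"
  unfolding matrix_self_adjoint_wedge[OF b0 b1 A]
proof (intro ballI)
  fix x y :: "complex ^ 2"
  note pos = lattice_basis_pos[OF b0] lattice_basis_pos[OF b1]
  have adj': "q / wedge a b = 2 * (r / wedge u v)" using adj pos by (simp add: field_simps)
  have "wedge ((A *v x) $ 1) (y $ 1) / wedge a b = p / wedge a b * wedge (x $ 1) (y $ 1) + q / wedge a b * wedge (x $ 2) (y $ 1)"
    "wedge (x $ 1) ((A *v y) $ 1) / wedge a b = p / wedge a b * wedge (x $ 1) (y $ 1) + q / wedge a b * wedge (x $ 1) (y $ 2)"
    "wedge ((A *v x) $ 2) (y $ 2) / wedge u v = r / wedge u v * wedge (x $ 1) (y $ 2) + s / wedge u v * wedge (x $ 2) (y $ 2)"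
    "wedge (x $ 2) ((A *v y) $ 2) / wedge u v = r / wedge u v * wedge (x $ 2) (y $ 1) + s / wedge u v * wedge (x $ 2) (y $ 2)"
    by (simp_all add: matrix_mult_vec_2 real add_divide_distrib)
  then show "wedge ((A *v x) $ 1) (y $ 1) / wedge a b + 2 * (wedge ((A *v x) $ 2) (y $ 2) / wedge u v) =
     wedge (x $ 1) ((A *v y) $ 1) / wedge a b + 2 * (wedge (x $ 2) ((A *v y) $ 2) / wedge u v)"
    unfolding adj' by (simp add: algebra_simps)
qed

text \<open>Conversely, the matrix \<open>A\<close> with rows \<open>(P, q)\<close> and \<open>(c, S)\<close>, where \<open>P + S = D\<close>, \<open>P - S = e\<close> and \<open>q = \<surd>D + e\<close> is twice
the dual of \<open>c\<close>, preserves the product of the lattices and generates a copy of \<open>\<O>\<^sub>D\<close>. For properness,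
suppose \<open>m + n A\<close> is divisible by \<open>k\<close>. The difference of the diagonal entries shows that \<open>k\<close> divides \<open>n e\<close>, the
lower left entry that \<open>k\<close> divides \<open>n\<close> times the content; since content and \<open>e\<close> are coprime, \<open>k\<close> divides
\<open>n\<close> and then \<open>m\<close>.\<close>

lemma real_mult_lattices_imp_matrices:
  assumes D: "\<nexists>k. D = k\<^sup>2" "D > 0" "4 * N = D\<^sup>2 - D"
    and L: "is_lattice L0" "is_lattice L1" and RM: "real_mult_lattices D L0 L1"
  shows "\<exists>R. real_mult_matrices D L0 L1 R"
proof -
  let ?M = "matrix_ring L0 L1" and ?O = "quadratic_order D"
  interpret M: ring ?M by (rule ring_matrix_ring[OF L])
  obtain e a b u v M where b0: "lattice_basis L0 a b" and b1: "lattice_basis L1 u v" and adm: "e \<in> admissible D"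
    and det: "mdet M = level_index D e" and cop: "coprime (content M) e"
    and rel: "basis_relation (of_real (multiplier D e)) M a b u v"
    using RM by (auto simp: real_mult_lattices_def)
  note pos = lattice_basis_pos[OF b0] lattice_basis_pos[OF b1]
  note mem0 = lattice_basis_mem[OF b0] and mem1 = lattice_basis_mem[OF b1]
  define c where "c = multiplier D e"
  have c: "c > 0" using multiplier_pos[OF adm] by (simp add: c_def)
  note rel = rel[folded c_def]
  have ca: "of_real c * a = of_int (m11 M) * u + of_int (m12 M) * v"
    and cb: "of_real c * b = of_int (m21 M) * u + of_int (m22 M) * v"
    using rel by (simp_all add: basis_relation_def)
  have D8: "8 * mdet M = D - e\<^sup>2" using level_index_8[OF adm] det by simp
  have "even (D - e)"
  proof -
    have "D = 8 * mdet M + e\<^sup>2" using D8 by simp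
    then show ?thesis by simp
  qed
  then obtain S where S: "D - e = 2 * S" ..
  define P where "P = S + e"
  have PS: "P + S = D" "P - S = e" using S by (simp_all add: P_def)
  define q where "q = sqrt (of_int D) + of_int e"
  have sq: "sqrt (of_int D) * sqrt (of_int D) = real_of_int D" using D(2) by simp
  have cq: "c * q = 2 * of_int (mdet M)"
  proof -
    have "4 * (c * q) = (sqrt (of_int D) - of_int e) * (sqrt (of_int D) + of_int e)"
      by (simp add: c_def multiplier_def q_def)
    also have "\<dots> = sqrt (of_int D) * sqrt (of_int D) - of_int e * of_int e"
      by (simp only: algebra_simps)
    also have "\<dots> = real_of_int (D - e\<^sup>2)" unfolding sq by (simp add: power2_eq_square)
    also have "\<dots> = 8 * of_int (mdet M)" unfolding D8[symmetric] by simp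
    finally show ?thesis by simp
  qed
  have dual: "of_real q * u = of_int (2 * m22 M) * a + of_int (- 2 * m12 M) * b"
    "of_real q * v = of_int (- 2 * m21 M) * a + of_int (2 * m11 M) * b"
  proof -
    have "of_real c * of_real q = 2 * complex_of_int (mdet M)"
      using arg_cong[OF cq, of complex_of_real] by simp
    from dual_basis_relation[OF rel _ this] c
    show "of_real q * u = of_int (2 * m22 M) * a + of_int (- 2 * m12 M) * b"
      "of_real q * v = of_int (- 2 * m21 M) * a + of_int (2 * m11 M) * b" by (simp_all add: algebra_simps)
  qed
  have adj: "2 * c * wedge a b = q * wedge u v"
  proof -
    have "c * (2 * c * wedge a b) = 2 * (c\<^sup>2 * wedge a b)" by (simp add: power2_eq_square)
    also have "\<dots> = 2 * of_int (mdet M) * wedge u v" unfolding wedge_basis_relation[OF rel] by simp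
    also have "\<dots> = c * (q * wedge u v)" unfolding cq[symmetric] by simp
    finally have "c * (2 * c * wedge a b) = c * (q * wedge u v)" .
    then show ?thesis using c by simp
  qed
  define A :: "complex ^ 2 ^ 2" where "A = vector [vector [of_int P, of_real q], vector [of_real c, of_int S]]"
  have A: "A $ 1 $ 1 = of_int P" "A $ 1 $ 2 = of_real q" "A $ 2 $ 1 = of_real c" "A $ 2 $ 2 = of_int S"
    by (simp_all add: A_def)
  define G where "G = (\<lambda>m n :: int. of_int m *\<^sub>R mat 1 + of_int n *\<^sub>R A)"
  have G: "G m n $ 1 $ 1 = of_int (m + n * P)" "G m n $ 1 $ 2 = of_real (of_int n * q)"
    "G m n $ 2 $ 1 = of_real (of_int n * c)" "G m n $ 2 $ 2 = of_int (m + n * S)" for m n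
    by (simp_all add: G_def mat_entries A scaleR_conv_of_real[where 'a = complex])
  have th: "of_int P + 2 * c = theta D" "q + 2 * of_int S = 2 * theta D"
  proof -
    have "2 * real_of_int S = of_int D - of_int e" "2 * real_of_int P = of_int D + of_int e"
      using arg_cong[OF S, of real_of_int] PS by (simp_all add: P_def)
    then show "of_int P + 2 * c = theta D" "q + 2 * of_int S = 2 * theta D"
      by (simp_all add: c_def multiplier_def theta_def q_def field_simps)
  qed
  have Gmul: "G m n ** G m' n' = G (m * m' - N * n * n') (m * n' + m' * n + D * n * n')" for m n m' n'
  proof -
    have "4 * (P * S - N) = 8 * mdet M"
    proof -
      have "4 * (P * S) = (P + S)\<^sup>2 - (P - S)\<^sup>2" by (simp add: power2_eq_square algebra_simps)
      then show ?thesis unfolding PS using D(3) D8 by (simp add: algebra_simps)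
    qed
    then have "P * S - N = 2 * mdet M" by simp
    then have qc: "complex_of_real q * of_real c = of_int (P * S - N)"
      using arg_cong[OF cq, of complex_of_real] by (simp add: mult.commute)
    have NN: "complex_of_int N = of_int P * of_int S - of_real q * of_real c" unfolding qc by simp
    have DPS: "complex_of_int D = of_int P + of_int S" using PS(1) by (metis of_int_add)
    show ?thesis unfolding matrix_eq_2 matrix_mult_2 G of_int_add of_int_diff of_int_mult of_real_mult
        of_real_add of_real_diff of_real_of_int_eq unfolding NN DPS
      by (intro conjI; simp only: algebra_simps)
  qed
  have Gadd: "G m n + G m' n' = G (m + m') (n + n')" for m n m' n'
    by (simp add: G_def scaleR_left_distrib)
  have GM: "G m n \<in> carrier ?M" for m n
  proof -
    have gen: "of_real c * a \<in> L1" "of_real c * b \<in> L1" "of_real q * u \<in> L0" "of_real q * v \<in> L0"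
      unfolding ca cb dual mem_lattice[OF b0] mem_lattice[OF b1] by (rule exI, rule exI, rule refl)+
    have 1: "of_real c * x \<in> L1" if "x \<in> L0" for x
      by (rule lattice_basis_subset[OF b0 L(2) gen(1,2) that])
    have 2: "of_real q * y \<in> L0" if "y \<in> L1" for y
      by (rule lattice_basis_subset[OF b1 L(1) gen(3,4) that])
    have "of_int n * (of_real c * x) \<in> L1" if "x \<in> L0" for x by (rule lattice_closed(5)[OF L(2) 1[OF that]])
    moreover have "of_int n * (of_real q * y) \<in> L0" if "y \<in> L1" for y by (rule lattice_closed(5)[OF L(1) 2[OF that]])
    ultimately show ?thesis unfolding matrix_ring_carrier_iff[OF L] G
      using lattice_closed(5)[OF L(1), of _ "m + n * P"] lattice_closed(5)[OF L(2), of _ "m + n * S"]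
      by (simp add: mult.assoc)
  qed
  define R where "R = {G m n | m n. True}"
  have RM: "R \<subseteq> carrier ?M" using GM by (auto simp: R_def)
  have GR: "G m n \<in> R" for m n by (auto simp: R_def)
  have Ruminus: "\<ominus>\<^bsub>?M\<^esub> (G m n) = G (- m) (- n)" for m n
  proof (rule M.minus_equality)
    show "G (- m) (- n) \<oplus>\<^bsub>?M\<^esub> G m n = \<zero>\<^bsub>?M\<^esub>"
      using Gadd[of "- m" "- n" m n] by (simp add: matrix_ring_def G_def)
  qed (rule GM)+
  have sub: "subring R ?M"
  proof (rule M.subringI[OF RM])
    have "G 1 0 = mat 1" by (simp add: G_def)
    then show "\<one>\<^bsub>?M\<^esub> \<in> R" using GR[of 1 0] by (simp add: matrix_ring_def)
    fix B assume "B \<in> R"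
    then obtain m n where B: "B = G m n" by (auto simp: R_def)
    show "\<ominus>\<^bsub>?M\<^esub> B \<in> R" unfolding B Ruminus by (rule GR)
    fix C assume "C \<in> R"
    then obtain m' n' where C: "C = G m' n'" by (auto simp: R_def)
    show "B \<otimes>\<^bsub>?M\<^esub> C \<in> R" "B \<oplus>\<^bsub>?M\<^esub> C \<in> R"
      using GR unfolding B C by (simp_all add: matrix_ring_def Gmul Gadd)
  qed
  \<comment> \<open>The inverse isomorphism is the eigenvalue on \<open>(x, y) \<mapsto> x + 2 y\<close>, read off from the first column.\<close>
  define h where "h = (\<lambda>B :: complex ^ 2 ^ 2. Re (B $ 1 $ 1 + 2 * B $ 2 $ 1))"
  have hG: "h (G m n) = of_int m + of_int n * theta D" for m n
    unfolding h_def G th(1)[symmetric] by (simp add: algebra_simps)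
  have h_iso: "h \<in> ring_iso (?M\<lparr>carrier := R\<rparr>) ?O"
    unfolding ring_iso_def
  proof (intro CollectI conjI)
    show "h \<in> ring_hom (?M\<lparr>carrier := R\<rparr>) ?O"
    proof (rule ring_hom_memI)
      fix B assume "B \<in> carrier (?M\<lparr>carrier := R\<rparr>)"
      then obtain m n where B: "B = G m n" by (auto simp: R_def)
      show "h B \<in> carrier ?O" unfolding B hG by (rule mem_quadratic_order)
      fix C assume "C \<in> carrier (?M\<lparr>carrier := R\<rparr>)"
      then obtain m' n' where C: "C = G m' n'" by (auto simp: R_def)
      have "h (B ** C) = h B * h C"
      proof -
        have "h B * h C = of_int (m * m') + of_int (m * n' + m' * n) * theta D + of_int (n * n') * (theta D * theta D)"
          unfolding B C hG by (simp add: algebra_simps)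
        also have "\<dots> = h (B ** C)"
          unfolding theta_square[OF D(2,3)] B C Gmul hG by (simp add: algebra_simps)
        finally show ?thesis ..
      qed
      then show "h (B \<otimes>\<^bsub>?M\<lparr>carrier := R\<rparr>\<^esub> C) = h B \<otimes>\<^bsub>?O\<^esub> h C"
        by (simp add: matrix_ring_def quadratic_order_def)
      show "h (B \<oplus>\<^bsub>?M\<lparr>carrier := R\<rparr>\<^esub> C) = h B \<oplus>\<^bsub>?O\<^esub> h C"
        by (simp add: matrix_ring_def quadratic_order_def h_def)
    next
      show "h \<one>\<^bsub>?M\<lparr>carrier := R\<rparr>\<^esub> = \<one>\<^bsub>?O\<^esub>"
        by (simp add: matrix_ring_def quadratic_order_def h_def mat_entries)
    qed
    have "inj_on h R"
    proof (rule inj_onI)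
      fix B C assume "B \<in> R" "C \<in> R" and eq: "h B = h C"
      then obtain m n m' n' where BC: "B = G m n" "C = G m' n'" by (auto simp: R_def)
      then show "B = C" using eq theta_independent[OF D(1,2), of m n m' n'] by (simp add: hG)
    qed
    moreover have "h ` R = carrier ?O"
    proof (intro equalityI subsetI)
      fix x assume "x \<in> carrier ?O"
      then obtain m n where "x = of_int m + of_int n * theta D" by (auto simp: carrier_quadratic_order)
      then have "x = h (G m n)" using hG by simp
      then show "x \<in> h ` R" using GR by blast
    next
      fix x assume "x \<in> h ` R"
      then obtain m n where "x = h (G m n)" by (auto simp: R_def)
      then show "x \<in> carrier ?O" using hG mem_quadratic_order by simp
    qed
    ultimately show "bij_betw h (carrier (?M\<lparr>carrier := R\<rparr>)) (carrier ?O)" by (simp add: bij_betw_def)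
  qed
  have "real_mult_matrices D L0 L1 R"
    unfolding real_mult_matrices_def
  proof (intro conjI ballI allI impI sub)
    show "?M\<lparr>carrier := R\<rparr> \<simeq> ?O" using h_iso by (auto simp: is_ring_iso_def)
    fix B assume "B \<in> R"
    then obtain m n where B: "B = G m n" by (auto simp: R_def)
    show "matrix_self_adjoint L0 L1 B" unfolding B
    proof (rule real_entries_self_adjoint[OF b0 b1 GM])
      show "2 * (of_int n * c) * wedge a b = of_int n * q * wedge u v"
        using adj by (simp add: mult.assoc mult.left_commute)
      show "G m n $ 1 $ 1 = of_real (of_int (m + n * P))" "G m n $ 2 $ 2 = of_real (of_int (m + n * S))"
        "G m n $ 1 $ 2 = of_real (of_int n * q)" "G m n $ 2 $ 1 = of_real (of_int n * c)"
        unfolding G by simp_all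
    qed
    show "matrix_eigenform B"
    proof -
      have th': "of_int P + 2 * of_real c = complex_of_real (theta D)" "of_real q + 2 * of_int S = 2 * complex_of_real (theta D)"
        using arg_cong[OF th(1), of complex_of_real] arg_cong[OF th(2), of complex_of_real] by simp_all
      have "(B *v w) $ 1 + 2 * (B *v w) $ 2 = (of_int m + of_int n * of_real (theta D)) * (w $ 1 + 2 * w $ 2)" for w
      proof -
        have "(B *v w) $ 1 + 2 * (B *v w) $ 2 = of_int m * (w $ 1 + 2 * w $ 2)
            + of_int n * ((of_int P + 2 * of_real c) * w $ 1 + (of_real q + 2 * of_int S) * w $ 2)"
          unfolding B matrix_mult_vec_2 G by (simp add: algebra_simps)
        also have "\<dots> = (of_int m + of_int n * of_real (theta D)) * (w $ 1 + 2 * w $ 2)"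
          unfolding th' by (simp add: algebra_simps)
        finally show ?thesis .
      qed
      then show ?thesis unfolding matrix_eigenform_def by blast
    qed
  next
    fix B and k :: int assume B: "B \<in> carrier ?M" and k: "k \<noteq> 0" and "of_int k *\<^sub>R B \<in> R"
    then obtain m n where kB: "of_int k *\<^sub>R B = G m n" by (auto simp: R_def)
    have kk: "complex_of_int k \<noteq> 0" using k by simp
    have ent: "of_int k * B $ i $ j = G m n $ i $ j" for i j
      unfolding kB[symmetric] by (simp add: scaleR_conv_of_real[where 'a = complex])
    note carr = matrix_carrier_mem[OF B L]
    have div1: "k dvd t" if h: "of_int k * z = of_int t" "z * x \<in> L" "lattice_basis L x y" for z t x y L
    proof -
      have "z = of_real (of_int t / of_int k)" using h(1) kk by (simp add: field_simps)
      then have "of_real (of_int t / of_int k) * x \<in> L" using h(2) by simp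
      then obtain i where "real_of_int t / of_int k = of_int i" using real_multiplier_integer[OF h(3)] by blast
      then have "real_of_int t = of_int (k * i)" using k by (simp add: field_simps)
      then have "t = k * i" by (simp only: of_int_eq_iff)
      then show ?thesis by simp
    qed
    have dP: "k dvd m + n * P" using ent[of 1 1] carr(1)[OF mem0(1)] b0 unfolding G by (rule div1)
    have dS: "k dvd m + n * S" using ent[of 2 2] carr(4)[OF mem1(1)] b1 unfolding G by (rule div1)
    have "k dvd (m + n * P) - (m + n * S)" using dP dS by (rule dvd_diff)
    also have "(m + n * P) - (m + n * S) = n * e" unfolding PS(2)[symmetric] by (simp add: algebra_simps)
    finally have ne: "k dvd n * e" .
    have div2: "k dvd n * i \<and> k dvd n * j"
      if h: "of_real c * x = of_int i * u + of_int j * v" "B $ 2 $ 1 * x \<in> L1" for x i j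
    proof -
      obtain i' j' where ij: "B $ 2 $ 1 * x = of_int i' * u + of_int j' * v" using h(2) mem_lattice[OF b1] by blast
      have "of_int (k * i') * u + of_int (k * j') * v = of_int k * (B $ 2 $ 1 * x)" unfolding ij by (simp add: algebra_simps)
      also have "\<dots> = of_int n * (of_real c * x)" using ent[of 2 1] unfolding G by (simp add: mult.assoc[symmetric])
      also have "\<dots> = of_int (n * i) * u + of_int (n * j) * v" unfolding h(1) by (simp add: algebra_simps)
      finally have "k * i' = n * i" "k * j' = n * j" by (rule wedge_independent_int[OF pos(2)])+
      then show ?thesis by (metis dvd_triv_left)
    qed
    have "k dvd n * m11 M" "k dvd n * m12 M" "k dvd n * m21 M" "k dvd n * m22 M"
      using div2[OF ca carr(2)[OF mem0(1)]] div2[OF cb carr(2)[OF mem0(2)]] by auto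
    then have "k dvd gcd (gcd (n * m11 M) (n * m12 M)) (gcd (n * m21 M) (n * m22 M))" by simp
    also have "\<dots> = \<bar>n\<bar> * content M" by (simp add: content_def gcd_mult_left abs_mult)
    finally have nc: "k dvd n * content M" by (cases "n \<ge> 0") auto
    obtain x y where "x * content M + y * e = 1" using cop bezout_int[of "content M" e] by auto
    then have "n = x * (n * content M) + y * (n * e)" by (metis distrib_left mult.left_commute mult.right_neutral)
    then have "k dvd n" using nc ne by (metis dvd_add dvd_mult)
    then obtain n' where n': "n = k * n'" ..
    have "k dvd m" using dP n' by (simp add: dvd_add_left_iff mult.assoc)
    then obtain m' where m': "m = k * m'" ..
    have "of_int k *\<^sub>R B = of_int k *\<^sub>R G m' n'" unfolding kB m' n' by (simp add: G_def scaleR_right_distrib)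
    then have "B = G m' n'" using k by simp
    then show "B \<in> R" using GR by simp
  qed
  then show ?thesis ..
qed

section \<open>Eigenform triples and their isomorphism classes\<close>

text \<open>The right-hand side mentions neither the involution nor the Prym variety: any involution leads to the
same condition on the period lattices.\<close>

lemma eigenform_triples_iff:
  assumes D: "\<nexists>k. D = k\<^sup>2" "D > 0" "4 * N = D\<^sup>2 - D"
  shows "X \<in> eigenform_triples D \<longleftrightarrow> (\<forall>j. elliptic_form (X j)) \<and>
    period_lattice (X 2) = period_lattice (X 1) \<and>
    real_mult_lattices D (period_lattice (X 0)) (period_lattice (X 1))"
proof (cases "\<forall>j. elliptic_form (X j)")
  case True
  then have ell: "\<And>j. elliptic_form (X j)" by blast
  have L: "is_lattice (period_lattice (X 0))" "is_lattice (period_lattice (X 1))"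
    using elliptic_form_simps(4)[OF ell] by auto
  have core: "(\<chi> j. form (X j)) \<in> forms_minus \<tau> \<and>
      (\<exists>R. real_mult D X \<tau> R \<and> (\<forall>T\<in>R. eigenform \<tau> T (\<chi> j. form (X j)))) \<longleftrightarrow>
      real_mult_lattices D (period_lattice (X 0)) (period_lattice (X 1))"
    if inv: "is_involution X \<tau>" for \<tau>
  proof (rule involution_form[OF ell inv])
    fix p \<alpha> \<beta> \<delta>
    assume "\<tau> 0 = (\<lambda>z. 2 * p - z)" "\<tau> 1 = (\<lambda>z. \<alpha> * z + \<beta>)" "\<tau> 2 = (\<lambda>z. z / \<alpha> + \<delta>)"
      "\<alpha> \<noteq> 0" "(\<lambda>z. \<alpha> * z) ` lat (X 1) = lat (X 2)" "form (X 2) * \<alpha> = - form (X 1)"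
    then interpret prym X \<tau> \<alpha> \<beta> \<delta> p using ell by unfold_locales
    have "(\<exists>R. real_mult_matrices D (period_lattice (X 0)) (period_lattice (X 1)) R) \<longleftrightarrow>
        real_mult_lattices D (period_lattice (X 0)) (period_lattice (X 1))"
      using real_mult_matrices_imp_lattices[OF D L] real_mult_lattices_imp_matrices[OF D L] by blast
    then show ?thesis unfolding real_mult_iff_matrices using forms_in_forms_minus by blast
  qed
  show ?thesis
  proof
    assume "X \<in> eigenform_triples D"
    then obtain \<tau> where \<tau>: "is_involution X \<tau>" "(\<chi> j. form (X j)) \<in> forms_minus \<tau>"
      "\<exists>R. real_mult D X \<tau> R \<and> (\<forall>T\<in>R. eigenform \<tau> T (\<chi> j. form (X j)))"
      unfolding eigenform_triples_def by blast
    have "real_mult_lattices D (period_lattice (X 0)) (period_lattice (X 1))"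
      by (rule iffD1[OF core[OF \<tau>(1)] conjI[OF \<tau>(2,3)]])
    then show "(\<forall>j. elliptic_form (X j)) \<and> period_lattice (X 2) = period_lattice (X 1) \<and>
       real_mult_lattices D (period_lattice (X 0)) (period_lattice (X 1))"
      using True involution_period_lattice[OF ell \<tau>(1)] by simp
  next
    assume *: "(\<forall>j. elliptic_form (X j)) \<and> period_lattice (X 2) = period_lattice (X 1) \<and>
       real_mult_lattices D (period_lattice (X 0)) (period_lattice (X 1))"
    then obtain \<tau> where \<tau>: "is_involution X \<tau>" using exists_involution[of X] ell by blast
    then show "X \<in> eigenform_triples D"
      unfolding eigenform_triples_def using * core[OF \<tau>] by blast
  qed
next
  case False
  then show ?thesis unfolding eigenform_triples_def by blast
qed

definition standard_triple :: "complex set \<Rightarrow> complex set \<Rightarrow> triple" where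
  "standard_triple L0 L1 = (\<lambda>j. let L = if j = 0 then L0 else L1 in
     \<lparr>lat = L, marked = torus_point L 0, form = 1\<rparr>)"

lemma standard_triple_simps:
  "lat (standard_triple L0 L1 0) = L0" "lat (standard_triple L0 L1 1) = L1" "lat (standard_triple L0 L1 2) = L1"
  "form (standard_triple L0 L1 j) = 1"
  "period_lattice (standard_triple L0 L1 0) = L0" "period_lattice (standard_triple L0 L1 1) = L1"
  "period_lattice (standard_triple L0 L1 2) = L1"
  by (simp_all add: standard_triple_def period_lattice_def)

lemma elliptic_standard_triple:
  "is_lattice L0 \<Longrightarrow> is_lattice L1 \<Longrightarrow> elliptic_form (standard_triple L0 L1 j)"
  by (simp add: elliptic_form_def standard_triple_def Let_def)

lemma standard_triple_eigenform:
  assumes D: "\<nexists>k. D = k\<^sup>2" "D > 0" "4 * N = D\<^sup>2 - D" and "real_mult_lattices D L0 L1"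
  shows "standard_triple L0 L1 \<in> eigenform_triples D"
proof -
  have "is_lattice L0" "is_lattice L1"
    using assms(4) by (auto simp: real_mult_lattices_def is_lattice_def)
  then show ?thesis
    unfolding eigenform_triples_iff[OF D] using assms(4) elliptic_standard_triple
    by (simp add: standard_triple_simps)
qed

lemma eigenform_elliptic: "X \<in> eigenform_triples D \<Longrightarrow> elliptic_form (X j)"
  by (simp add: eigenform_triples_def)

lemma triple_iso_scale_iff:
  assumes "X \<in> eigenform_triples D" "Y \<in> eigenform_triples D" "k \<noteq> 0"
  shows "triple_iso (scale k X) Y \<longleftrightarrow> (\<forall>j. (\<lambda>z. k * z) ` period_lattice (X j) = period_lattice (Y j))"
  using triple_iso_iff[of "scale k X" Y] eigenform_elliptic[OF assms(1)] eigenform_elliptic[OF assms(2)]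
    elliptic_form_scale assms(3) by (simp add: period_lattice_scale)

lemma triple_iso_scale_iff_2:
  assumes D: "\<nexists>k. D = k\<^sup>2" "D > 0" "4 * N = D\<^sup>2 - D"
    and X: "X \<in> eigenform_triples D" and Y: "Y \<in> eigenform_triples D" and "k \<noteq> 0"
  shows "triple_iso (scale k X) Y \<longleftrightarrow> (\<lambda>z. k * z) ` period_lattice (X 0) = period_lattice (Y 0) \<and>
    (\<lambda>z. k * z) ` period_lattice (X 1) = period_lattice (Y 1)"
  using X Y unfolding triple_iso_scale_iff[OF assms(4-6)] forall_3_zero
  by (simp add: eigenform_triples_iff[OF D])

lemma scale_scale_image: "(\<lambda>z. k * z) ` (\<lambda>z. l * z) ` L = (\<lambda>z. (k * l) * (z :: complex)) ` L"
  by (simp add: image_image mult.assoc)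

text \<open>By \<open>triple_iso_scale_iff\<close> the relation says that the period lattices are proportional.\<close>

lemma equiv_W_rel:
  assumes D: "\<nexists>k. D = k\<^sup>2" "D > 0" "4 * N = D\<^sup>2 - D"
  shows "equiv (eigenform_triples D) (W_rel D)"
proof (rule equivI)
  show "W_rel D \<subseteq> eigenform_triples D \<times> eigenform_triples D" by (auto simp: W_rel_def)
  show "refl_on (eigenform_triples D) (W_rel D)"
  proof (rule refl_onI)
    fix X assume X: "X \<in> eigenform_triples D"
    then have "triple_iso (scale 1 X) X" using triple_iso_scale_iff[OF X X, of 1] by simp
    then show "(X, X) \<in> W_rel D" using X by (auto simp: W_rel_def intro!: exI[of _ 1])
  qed
  show "sym (W_rel D)"
  proof (rule symI)
    fix X Y assume "(X, Y) \<in> W_rel D"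
    then obtain k where X: "X \<in> eigenform_triples D" and Y: "Y \<in> eigenform_triples D" and k: "k \<noteq> 0" "triple_iso (scale k X) Y"
      by (auto simp: W_rel_def)
    have "(\<lambda>z. (1 / k) * z) ` period_lattice (Y j) = period_lattice (X j)" for j
    proof -
      have "period_lattice (Y j) = (\<lambda>z. k * z) ` period_lattice (X j)"
        using k(2) unfolding triple_iso_scale_iff[OF X Y k(1)] by simp
      then show ?thesis using k(1) by (simp add: image_image)
    qed
    then have "triple_iso (scale (1 / k) Y) X" using triple_iso_scale_iff[OF Y X, of "1 / k"] k by simp
    then show "(Y, X) \<in> W_rel D" using X Y k by (auto simp: W_rel_def intro!: exI[of _ "1 / k"])
  qed
  show "trans (W_rel D)"
  proof (rule transI)
    fix X Y Z assume "(X, Y) \<in> W_rel D" "(Y, Z) \<in> W_rel D"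
    then obtain k l where X: "X \<in> eigenform_triples D" and Y: "Y \<in> eigenform_triples D" and Z: "Z \<in> eigenform_triples D"
      and k: "k \<noteq> 0" "triple_iso (scale k X) Y" and l: "l \<noteq> 0" "triple_iso (scale l Y) Z"
      by (auto simp: W_rel_def)
    have "(\<lambda>z. (l * k) * z) ` period_lattice (X j) = period_lattice (Z j)" for j
    proof -
      have "(\<lambda>z. k * z) ` period_lattice (X j) = period_lattice (Y j)"
        "(\<lambda>z. l * z) ` period_lattice (Y j) = period_lattice (Z j)"
        using k(2) l(2) unfolding triple_iso_scale_iff[OF X Y k(1)] triple_iso_scale_iff[OF Y Z l(1)] by blast+
      then show ?thesis unfolding scale_scale_image[symmetric] by simp
    qed
    then have "triple_iso (scale (l * k) X) Z" using triple_iso_scale_iff[OF X Z, of "l * k"] k l by simp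
    then show "(X, Z) \<in> W_rel D" using X Z k l by (auto simp: W_rel_def intro!: exI[of _ "l * k"])
  qed
qed

section \<open>Lattices from points of the upper half plane\<close>

definition sub_lattice :: "real \<Rightarrow> (int \<times> int) set \<Rightarrow> complex \<Rightarrow> complex set" where
  "sub_lattice c K \<tau> = (\<lambda>(m, n). (of_int m + of_int n * \<tau>) / of_real c) ` K"

abbreviation base_lattice :: "complex \<Rightarrow> complex set" where
  "base_lattice \<equiv> sub_lattice 1 UNIV"

lemma wedge_1: "wedge 1 \<tau> = Im \<tau>"
  by (simp add: wedge_def)

lemma base_lattice_basis: "\<tau> \<in> uhp \<Longrightarrow> lattice_basis (base_lattice \<tau>) 1 \<tau>"
  unfolding lattice_basis_wedge by (auto simp: wedge_1 uhp_def sub_lattice_def)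

text \<open>The bases are such that \<open>M\<close> is the matrix of multiplication by \<open>c\<close>; the positive determinant makes them
positively oriented.\<close>

lemma sub_lattice_basis:
  assumes \<tau>: "\<tau> \<in> uhp" and M: "mdet M > 0" and c: "c > 0"
  defines "a \<equiv> (of_int (m11 M) + of_int (m12 M) * \<tau>) / of_real c"
    and "b \<equiv> (of_int (m21 M) + of_int (m22 M) * \<tau>) / of_real c"
  shows "lattice_basis (sub_lattice c (row_lattice M) \<tau>) a b" "basis_relation (of_real c) M a b 1 \<tau>"
proof -
  show rel: "basis_relation (of_real c) M a b 1 \<tau>" using c by (simp add: basis_relation_def a_def b_def)
  have "0 < c\<^sup>2 * wedge a b" unfolding wedge_basis_relation[OF rel] using M \<tau> by (simp add: wedge_1 uhp_def)
  then have "wedge a b > 0" using c by (simp add: zero_less_mult_iff)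
  moreover have key: "(of_int (m * m11 M + n * m21 M) + of_int (m * m12 M + n * m22 M) * \<tau>) / of_real c = of_int m * a + of_int n * b" for m n
    using c by (simp add: a_def b_def field_simps)
  have "sub_lattice c (row_lattice M) \<tau> = {of_int m * a + of_int n * b | m n. True}"
  proof (intro equalityI subsetI)
    fix z assume "z \<in> sub_lattice c (row_lattice M) \<tau>"
    then obtain p where p: "p \<in> row_lattice M" "z = (of_int (fst p) + of_int (snd p) * \<tau>) / of_real c"
      by (auto simp: sub_lattice_def)
    from p(1) obtain m n where "p = (m * m11 M + n * m21 M, m * m12 M + n * m22 M)"
      unfolding row_lattice_def by blast
    then have "z = (of_int (m * m11 M + n * m21 M) + of_int (m * m12 M + n * m22 M) * \<tau>) / of_real c"
      using p(2) by simp
    then show "z \<in> {of_int m * a + of_int n * b | m n. True}" unfolding key by blast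
  next
    fix z assume "z \<in> {of_int m * a + of_int n * b | m n. True}"
    then obtain m n where "z = (of_int (m * m11 M + n * m21 M) + of_int (m * m12 M + n * m22 M) * \<tau>) / of_real c"
      unfolding key[symmetric] by blast
    moreover have "(m * m11 M + n * m21 M, m * m12 M + n * m22 M) \<in> row_lattice M" unfolding row_lattice_def by blast
    ultimately show "z \<in> sub_lattice c (row_lattice M) \<tau>"
      unfolding sub_lattice_def by (intro image_eqI[of _ _ "(m * m11 M + n * m21 M, m * m12 M + n * m22 M)"]) simp_all
  qed
  ultimately show "lattice_basis (sub_lattice c (row_lattice M) \<tau>) a b" by (simp add: lattice_basis_wedge)
qed

text \<open>Scaling by \<open>1/u\<close> turns the basis \<open>u, v\<close> into \<open>1, \<tau>\<close> with \<open>\<tau> = v/u\<close>.\<close>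

lemma lattices_from_basis_relation:
  assumes b0: "lattice_basis L0 a b" and b1: "lattice_basis L1 u v" and c: "c > 0"
    and rel: "basis_relation (of_real c) M a b u v"
  shows "v / u \<in> uhp" "u \<noteq> 0" "L1 = (\<lambda>z. u * z) ` base_lattice (v / u)"
    "L0 = (\<lambda>z. u * z) ` sub_lattice c (row_lattice M) (v / u)"
proof -
  have pos: "wedge u v > 0" "wedge a b > 0" using b0 b1 lattice_basis_pos by auto
  show u: "u \<noteq> 0" using pos by auto
  have "wedge u v = (cmod u)\<^sup>2 * Im (v / u)" using wedge_mult[of u 1 "v / u"] u by (simp add: wedge_1)
  then show \<tau>: "v / u \<in> uhp" using pos u by (simp add: uhp_def zero_less_mult_iff)
  have "lattice_basis ((\<lambda>z. u * z) ` base_lattice (v / u)) (u * 1) (u * (v / u))"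
    by (rule lattice_basis_scale[OF base_lattice_basis[OF \<tau>] u])
  then show "L1 = (\<lambda>z. u * z) ` base_lattice (v / u)" using b1 u by (simp add: lattice_basis_wedge)
  have "0 < c\<^sup>2 * wedge a b" using c pos by simp
  then have M: "mdet M > 0" unfolding wedge_basis_relation[OF rel] using pos by (simp add: zero_less_mult_iff)
  have ab: "u * ((of_int (m11 M) + of_int (m12 M) * (v / u)) / of_real c) = a" "u * ((of_int (m21 M) + of_int (m22 M) * (v / u)) / of_real c) = b"
  proof -
    have "of_real c * a = of_int (m11 M) * u + of_int (m12 M) * v" "of_real c * b = of_int (m21 M) * u + of_int (m22 M) * v"
      using rel by (simp_all add: basis_relation_def)
    moreover have "u * ((of_int i + of_int j * (v / u)) / of_real c) = (of_int i * u + of_int j * v) / of_real c" for i j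
      using u by (simp add: distrib_left mult.commute)
    ultimately show "u * ((of_int (m11 M) + of_int (m12 M) * (v / u)) / of_real c) = a" "u * ((of_int (m21 M) + of_int (m22 M) * (v / u)) / of_real c) = b"
      using c by (simp_all flip: \<open>of_real c * a = _\<close> \<open>of_real c * b = _\<close>)
  qed
  have "lattice_basis ((\<lambda>z. u * z) ` sub_lattice c (row_lattice M) (v / u)) a b"
    using lattice_basis_scale[OF sub_lattice_basis(1)[OF \<tau> M c] u] unfolding ab .
  then show "L0 = (\<lambda>z. u * z) ` sub_lattice c (row_lattice M) (v / u)" using b0 by (simp add: lattice_basis_wedge)
qed

lemma sublattice_act_point:
  assumes g: "g \<in> SL2" and \<tau>: "\<tau> \<in> uhp"
  shows "(of_int m + of_int n * \<tau>) / (of_int (m21 g) * \<tau> + of_int (m22 g)) =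
    of_int (fst (sublattice_act g (m, n))) + of_int (snd (sublattice_act g (m, n))) * mob g \<tau>"
proof -
  obtain a b c d where g': "g = Mat a b c d" by (cases g)
  define w where "w = of_int c * \<tau> + of_int d"
  have w: "w \<noteq> 0" using denominator_nonzero[of a b c d \<tau>] g \<tau> g' w_def by simp
  have det: "complex_of_int a * of_int d - of_int b * of_int c = 1"
    using g g' by (simp flip: of_int_mult of_int_diff)
  have "(of_int (a * m - b * n) + of_int (- c * m + d * n) * ((of_int a * \<tau> + of_int b) / w)) * w
      = of_int (a * m - b * n) * w + of_int (- c * m + d * n) * (of_int a * \<tau> + of_int b)"
    using w by (simp add: field_simps)
  also have "\<dots> = (of_int a * of_int d - of_int b * of_int c) * (of_int m + of_int n * \<tau>)"
    by (simp add: w_def algebra_simps)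
  finally show ?thesis using w det by (simp add: g' w_def[symmetric] nonzero_divide_eq_eq)
qed

lemma sub_lattice_act:
  assumes g: "g \<in> SL2" and \<tau>: "\<tau> \<in> uhp"
  shows "(\<lambda>z. 1 / (of_int (m21 g) * \<tau> + of_int (m22 g)) * z) ` sub_lattice c K \<tau> = sub_lattice c (sublattice_act g ` K) (mob g \<tau>)"
  unfolding sub_lattice_def image_image
proof (rule image_cong[OF refl])
  fix p assume "p \<in> K"
  obtain m n where p: "p = (m, n)" by (cases p)
  have "1 / (of_int (m21 g) * \<tau> + of_int (m22 g)) * ((of_int m + of_int n * \<tau>) / of_real c) =
      (of_int m + of_int n * \<tau>) / (of_int (m21 g) * \<tau> + of_int (m22 g)) / of_real c" by simp
  then show "1 / (of_int (m21 g) * \<tau> + of_int (m22 g)) * (case p of (m, n) \<Rightarrow> (of_int m + of_int n * \<tau>) / of_real c) =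
      (case sublattice_act g p of (m, n) \<Rightarrow> (of_int m + of_int n * mob g \<tau>) / of_real c)"
    unfolding p sublattice_act_point[OF g \<tau>] by (simp add: case_prod_beta)
qed

lemma sublattice_act_UNIV: "g \<in> SL2 \<Longrightarrow> sublattice_act g ` UNIV = UNIV"
proof -
  assume g: "g \<in> SL2"
  have "p = sublattice_act g (sublattice_act (minv g) p)" for p
  proof -
    have "sublattice_act (Mat 1 0 0 1) p = p" by (cases p) simp
    then show ?thesis using mmul_minv[OF g] by (simp add: sublattice_act_mmul[symmetric])
  qed
  then show ?thesis by blast
qed

lemma sub_lattice_inject:
  assumes \<tau>: "\<tau> \<in> uhp" and c: "c > 0" and eq: "sub_lattice c K \<tau> = sub_lattice c K' \<tau>"
  shows "K = K'"
proof -
  let ?f = "\<lambda>(m, n). (of_int m + of_int n * \<tau>) / of_real c"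
  have "inj ?f"
  proof (rule injI)
    fix p q assume "?f p = ?f q"
    then have "of_int (fst p) * 1 + of_int (snd p) * \<tau> = of_int (fst q) * 1 + of_int (snd q) * \<tau>"
      using c by (simp add: case_prod_beta)
    note E = this
    have W: "wedge 1 \<tau> > 0" using \<tau> by (simp add: wedge_1 uhp_def)
    have "fst p = fst q" "snd p = snd q" using wedge_independent_int[OF W E] by blast+
    then show "p = q" by (rule prod_eqI)
  qed
  then show ?thesis using eq unfolding sub_lattice_def by (simp add: inj_image_eq_iff)
qed

text \<open>The vectors \<open>c x\<close> and \<open>c' x\<close> of \<open>L\<close> are real multiples of each other, so \<open>c'/c\<close> is rational. A rational ratio
of \<open>\<surd>D - e'\<close> and \<open>\<surd>D - e\<close> must be \<open>1\<close> because \<open>\<surd>D\<close> is irrational.\<close>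

lemma multiplier_unique:
  assumes D: "\<nexists>k. D = k\<^sup>2" "D > 0" and L: "is_lattice L"
    and e: "e \<in> admissible D" "e' \<in> admissible D" and x: "x \<noteq> 0"
    and m: "of_real (multiplier D e) * x \<in> L" "of_real (multiplier D e') * x \<in> L"
  shows "e = e'"
proof -
  obtain u v where b: "lattice_basis L u v" using L by (auto simp: is_lattice_def)
  note pos = lattice_basis_pos[OF b]
  obtain i j where ij: "of_real (multiplier D e) * x = of_int i * u + of_int j * v" using m mem_lattice[OF b] by blast
  obtain i' j' where ij': "of_real (multiplier D e') * x = of_int i' * u + of_int j' * v" using m mem_lattice[OF b] by blast
  define c c' where "c = multiplier D e" and "c' = multiplier D e'"
  have c: "c > 0" "c' > 0" using multiplier_pos e by (auto simp: c_def c'_def)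
  have "of_real (c' * of_int i) * u + of_real (c' * of_int j) * v = of_real c' * (of_real c * x)"
    unfolding c_def ij by (simp add: algebra_simps)
  also have "\<dots> = of_real c * (of_real c' * x)" by simp
  also have "\<dots> = of_real (c * of_int i') * u + of_real (c * of_int j') * v"
    unfolding c'_def ij' by (simp add: algebra_simps)
  finally have eqs: "c' * of_int i = c * of_int i'" "c' * of_int j = c * of_int j'"
    by (rule wedge_independent[OF pos])+
  have nz: "i \<noteq> 0 \<or> j \<noteq> 0" using ij c x by (auto simp: c_def)
  have fin: "e = e'" if "c' * of_int s = c * of_int t" "s \<noteq> 0" for s t :: int
  proof -
    have "real_of_int (s * e' - t * e) = of_int (s - t) * sqrt (of_int D)"
      using that(1) by (simp add: c_def c'_def multiplier_def field_simps)
    then have "s * e' - t * e = 0 \<and> s - t = 0" by (rule sqrt_independent[OF D])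
    then show ?thesis using that(2) by auto
  qed
  show ?thesis using nz fin eqs by blast
qed

section \<open>The parametrization by level data\<close>

definition level_lattice :: "int \<Rightarrow> int \<times> (int \<times> int) set \<Rightarrow> complex \<Rightarrow> complex set" where
  "level_lattice D s \<tau> = sub_lattice (multiplier D (fst s)) (snd s) \<tau>"

definition level_triple :: "int \<Rightarrow> int \<times> (int \<times> int) set \<Rightarrow> complex \<Rightarrow> triple" where
  "level_triple D s \<tau> = standard_triple (level_lattice D s \<tau>) (base_lattice \<tau>)"

definition level_point :: "int \<Rightarrow> int \<times> (int \<times> int) set \<Rightarrow> complex \<Rightarrow> triple set" where
  "level_point D s \<tau> = W_rel D `` {level_triple D s \<tau>}"

lemma level_dataE:
  assumes "s \<in> level_data D"
  obtains e M where "s = (e, row_lattice M)" "e \<in> admissible D" "mdet M = level_index D e" "coprime (content M) e"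
    "mdet M > 0" "multiplier D e > 0"
proof -
  obtain e K where s: "s = (e, K)" "e \<in> admissible D" "K \<in> sublattices (level_index D e) e"
    using assms by (auto simp: level_data_def)
  then obtain M where "K = row_lattice M" "mdet M = level_index D e" "coprime (content M) e"
    by (auto simp: sublattices_def)
  then show thesis using that s level_index_pos multiplier_pos by metis
qed

lemma level_dataI:
  "e \<in> admissible D \<Longrightarrow> mdet M = level_index D e \<Longrightarrow> coprime (content M) e \<Longrightarrow> (e, row_lattice M) \<in> level_data D"
  by (auto simp: level_data_def sublattices_def)

lemma real_mult_level_lattice:
  assumes s: "s \<in> level_data D" and \<tau>: "\<tau> \<in> uhp"
  shows "real_mult_lattices D (level_lattice D s \<tau>) (base_lattice \<tau>)"
proof -
  obtain e M where e: "s = (e, row_lattice M)" "e \<in> admissible D" "mdet M = level_index D e" "coprime (content M) e"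
    "mdet M > 0" "multiplier D e > 0" using level_dataE[OF s] .
  show ?thesis unfolding real_mult_lattices_def level_lattice_def e(1) fst_conv snd_conv
    using sub_lattice_basis[OF \<tau> e(5,6)] base_lattice_basis[OF \<tau>] e by blast
qed

text \<open>The images of \<open>1\<close> and \<open>\<tau>\<close> form a second positive basis of the lattice; the change of basis has determinant
\<open>1\<close> because both bases span the same area.\<close>

lemma base_lattice_scale_eq:
  assumes \<tau>: "\<tau> \<in> uhp" and \<tau>': "\<tau>' \<in> uhp" and k: "k \<noteq> 0"
    and eq: "(\<lambda>z. k * z) ` base_lattice \<tau> = base_lattice \<tau>'"
  obtains g where "g \<in> SL2" "mob g \<tau> = \<tau>'" "k = 1 / (of_int (m21 g) * \<tau> + of_int (m22 g))"
proof -
  have b: "lattice_basis (base_lattice \<tau>') k (k * \<tau>)"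
    using lattice_basis_scale[OF base_lattice_basis[OF \<tau>] k] unfolding eq by simp
  have b': "lattice_basis (base_lattice \<tau>') 1 \<tau>'" by (rule base_lattice_basis[OF \<tau>'])
  obtain d c where dc: "1 = of_int d * k + of_int c * (k * \<tau>)"
    using lattice_basis_mem(1)[OF b'] mem_lattice[OF b] by blast
  obtain b a where ba: "\<tau>' = of_int b * k + of_int a * (k * \<tau>)"
    using lattice_basis_mem(2)[OF b'] mem_lattice[OF b] by blast
  have "wedge 1 \<tau>' = of_int (d * a - c * b) * wedge k (k * \<tau>)"
    unfolding ba by (subst dc) (rule wedge_int_combination)
  also have "wedge k (k * \<tau>) = wedge 1 \<tau>'" by (rule lattice_basis_same_area[OF b' b])
  finally have "real_of_int (d * a - c * b) = 1" using lattice_basis_pos[OF b'] by simp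
  then have "d * a - c * b = 1" by linarith
  then have det: "a * d - b * c = 1" by (simp add: mult.commute)
  define w where "w = of_int c * \<tau> + of_int d"
  have kw: "k * w = 1" unfolding w_def by (subst dc) (simp add: algebra_simps)
  then have w: "w \<noteq> 0" by auto
  have kk: "k = 1 / w" using kw w by (simp add: field_simps)
  have "\<tau>' = (of_int a * \<tau> + of_int b) / w"
    unfolding ba kk by (simp add: add_divide_distrib add.commute mult.commute)
  then have "mob (Mat a b c d) \<tau> = \<tau>'" by (simp add: w_def)
  then show thesis using that[of "Mat a b c d"] det kk by (simp add: w_def)
qed

text \<open>A common factor of the two lattices is \<open>1 / (c\<tau> + d)\<close> for some \<open>g\<close> in \<open>SL2\<close>, by the second pair of lattices. By
\<open>multiplier_unique\<close> both level data have the same \<open>e\<close>, and then the first pair compares the sublattices.\<close>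

lemma level_lattice_scale_iff:
  assumes D: "\<nexists>k. D = k\<^sup>2" "D > 0"
    and s: "s \<in> level_data D" and s': "s' \<in> level_data D" and \<tau>: "\<tau> \<in> uhp" and \<tau>': "\<tau>' \<in> uhp" and k: "k \<noteq> 0"
  shows "(\<lambda>z. k * z) ` level_lattice D s \<tau> = level_lattice D s' \<tau>' \<and> (\<lambda>z. k * z) ` base_lattice \<tau> = base_lattice \<tau>' \<longleftrightarrow>
    (\<exists>g\<in>SL2. mob g \<tau> = \<tau>' \<and> level_act g s = s' \<and> k = 1 / (of_int (m21 g) * \<tau> + of_int (m22 g)))"
proof
  assume "\<exists>g\<in>SL2. mob g \<tau> = \<tau>' \<and> level_act g s = s' \<and> k = 1 / (of_int (m21 g) * \<tau> + of_int (m22 g))"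
  then obtain g where g: "g \<in> SL2" "mob g \<tau> = \<tau>'" "level_act g s = s'" "k = 1 / (of_int (m21 g) * \<tau> + of_int (m22 g))" by blast
  show "(\<lambda>z. k * z) ` level_lattice D s \<tau> = level_lattice D s' \<tau>' \<and> (\<lambda>z. k * z) ` base_lattice \<tau> = base_lattice \<tau>'"
    unfolding level_lattice_def g(4) sub_lattice_act[OF g(1) \<tau>] g(2) sublattice_act_UNIV[OF g(1)] g(3)[symmetric]
    by (simp add: level_act_def)
next
  assume eq: "(\<lambda>z. k * z) ` level_lattice D s \<tau> = level_lattice D s' \<tau>' \<and> (\<lambda>z. k * z) ` base_lattice \<tau> = base_lattice \<tau>'"
  obtain g where g: "g \<in> SL2" "mob g \<tau> = \<tau>'" "k = 1 / (of_int (m21 g) * \<tau> + of_int (m22 g))"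
    using base_lattice_scale_eq[OF \<tau> \<tau>' k] eq by blast
  obtain e M where e: "s = (e, row_lattice M)" "e \<in> admissible D" "mdet M > 0" "multiplier D e > 0" using level_dataE[OF s] by blast
  obtain e' M' where e': "s' = (e', row_lattice M')" "e' \<in> admissible D" "mdet M' > 0" "multiplier D e' > 0"
    using level_dataE[OF s'] by blast
  have L: "is_lattice (base_lattice \<tau>')" using base_lattice_basis[OF \<tau>'] by (auto simp: is_lattice_def)
  have sub: "of_real c * x \<in> base_lattice \<tau>" if x: "x \<in> sub_lattice c K \<tau>" and c: "c > 0" for c K x \<tau>
  proof -
    obtain m n where "x = (of_int m + of_int n * \<tau>) / of_real c" using x by (auto simp: sub_lattice_def)
    then have "of_real c * x = of_int m + of_int n * \<tau>" using c by simp
    then show ?thesis unfolding sub_lattice_def by (intro image_eqI[of _ _ "(m, n)"]) simp_all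
  qed
  have same: "e = e'"
  proof -
    define x where "x = (of_int (m11 M) + of_int (m12 M) * \<tau>) / complex_of_real (multiplier D e)"
    have b: "lattice_basis (level_lattice D s \<tau>) x ((of_int (m21 M) + of_int (m22 M) * \<tau>) / complex_of_real (multiplier D e))"
      unfolding level_lattice_def e(1) fst_conv snd_conv x_def by (rule sub_lattice_basis(1)[OF \<tau> e(3,4)])
    have xm: "x \<in> level_lattice D s \<tau>" by (rule lattice_basis_mem(1)[OF b])
    have x0: "x \<noteq> 0" using lattice_basis_pos[OF b] by auto
    have "of_real (multiplier D e) * x \<in> base_lattice \<tau>"
      using sub xm e unfolding level_lattice_def e(1) by simp
    then have "k * (of_real (multiplier D e) * x) \<in> base_lattice \<tau>'" using eq by blast
    then have 1: "of_real (multiplier D e) * (k * x) \<in> base_lattice \<tau>'" by (simp add: mult.left_commute)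
    have "k * x \<in> level_lattice D s' \<tau>'" using eq xm by blast
    then have 2: "of_real (multiplier D e') * (k * x) \<in> base_lattice \<tau>'"
      using sub e' unfolding level_lattice_def e'(1) by simp
    show ?thesis using multiplier_unique[OF D L e(2) e'(2) _ 1 2] x0 k by simp
  qed
  have "level_lattice D s' \<tau>' = sub_lattice (multiplier D e) (sublattice_act g ` row_lattice M) \<tau>'"
    using eq unfolding level_lattice_def e(1) fst_conv snd_conv g(3) sub_lattice_act[OF g(1) \<tau>] g(2) by simp
  then have "sub_lattice (multiplier D e) (row_lattice M') \<tau>' = sub_lattice (multiplier D e) (sublattice_act g ` row_lattice M) \<tau>'"
    unfolding level_lattice_def e'(1) fst_conv snd_conv same .
  then have "row_lattice M' = sublattice_act g ` row_lattice M" by (rule sub_lattice_inject[OF \<tau>' e(4)])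
  then have "level_act g s = s'" by (simp add: level_act_def e(1) e'(1) same)
  then show "\<exists>g\<in>SL2. mob g \<tau> = \<tau>' \<and> level_act g s = s' \<and> k = 1 / (of_int (m21 g) * \<tau> + of_int (m22 g))"
    using g by blast
qed

text \<open>This describes the content by the two lattices and \<open>c\<close> alone, which makes it independent of bases.\<close>

lemma dvd_content_iff_lattices:
  assumes b0: "lattice_basis L0 a b" and b1: "lattice_basis L1 u v" and rel: "basis_relation c M a b u v"
  shows "k dvd content M \<longleftrightarrow> (\<forall>x\<in>L0. \<exists>y\<in>L1. c * x = of_int k * y)"
proof
  have ca: "c * a = of_int (m11 M) * u + of_int (m12 M) * v" and cb: "c * b = of_int (m21 M) * u + of_int (m22 M) * v"
    using rel by (simp_all add: basis_relation_def)
  {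
    assume "k dvd content M"
    then obtain i1 i2 j1 j2 where ij: "m11 M = k * i1" "m12 M = k * i2" "m21 M = k * j1" "m22 M = k * j2"
      unfolding dvd_content_iff unfolding dvd_def by metis
    show "\<forall>x\<in>L0. \<exists>y\<in>L1. c * x = of_int k * y"
    proof
      fix x assume "x \<in> L0"
      then obtain m n where x: "x = of_int m * a + of_int n * b" using mem_lattice[OF b0] by blast
      have "c * x = of_int m * (c * a) + of_int n * (c * b)" by (simp add: x algebra_simps)
      also have "\<dots> = of_int k * (of_int (m * i1 + n * j1) * u + of_int (m * i2 + n * j2) * v)"
        unfolding ca cb ij by (simp add: algebra_simps)
      finally show "\<exists>y\<in>L1. c * x = of_int k * y" using mem_lattice[OF b1] by blast
    qed
  }
  assume *: "\<forall>x\<in>L0. \<exists>y\<in>L1. c * x = of_int k * y"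
  have dv: "k dvd i \<and> k dvd j" if h: "of_int i * u + of_int j * v = of_int k * y" "y \<in> L1" for i j y
  proof -
    obtain m n where "y = of_int m * u + of_int n * v" using h(2) mem_lattice[OF b1] by blast
    then have "of_int i * u + of_int j * v = of_int (k * m) * u + of_int (k * n) * v"
      using h(1) by (simp add: algebra_simps)
    then have "i = k * m" "j = k * n" by (rule wedge_independent_int[OF lattice_basis_pos[OF b1]])+
    then show ?thesis by simp
  qed
  obtain y z where "y \<in> L1" "c * a = of_int k * y" "z \<in> L1" "c * b = of_int k * z"
    using * lattice_basis_mem[OF b0] by blast
  then show "k dvd content M" unfolding dvd_content_iff using dv ca cb by metis
qed

text \<open>In \<open>real_mult_lattices\<close> the bases are existentially quantified; this lemma provides the relation for any
prescribed pair of bases.\<close>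

lemma real_mult_lattices_basis:
  assumes RM: "real_mult_lattices D L0 L1" and b0: "lattice_basis L0 a b" and b1: "lattice_basis L1 u v"
  obtains e M where "e \<in> admissible D" "mdet M = level_index D e" "coprime (content M) e"
    "basis_relation (of_real (multiplier D e)) M a b u v"
proof -
  obtain e a' b' u' v' M' where *: "lattice_basis L0 a' b'" "lattice_basis L1 u' v'" "e \<in> admissible D"
    "mdet M' = level_index D e" "coprime (content M') e" "basis_relation (of_real (multiplier D e)) M' a' b' u' v'"
    using RM by (auto simp: real_mult_lattices_def)
  let ?c = "complex_of_real (multiplier D e)"
  have "\<forall>x\<in>L0. \<exists>y\<in>L1. ?c * x = of_int 1 * y"
    using dvd_content_iff_lattices[OF *(1,2,6), of 1] by simp
  then have sub: "\<And>x. x \<in> L0 \<Longrightarrow> ?c * x \<in> L1" by fastforce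
  obtain x1 x2 where x: "?c * a = of_int x1 * u + of_int x2 * v"
    using sub[OF lattice_basis_mem(1)[OF b0]] mem_lattice[OF b1] by blast
  obtain y1 y2 where y: "?c * b = of_int y1 * u + of_int y2 * v"
    using sub[OF lattice_basis_mem(2)[OF b0]] mem_lattice[OF b1] by blast
  define M where "M = Mat x1 x2 y1 y2"
  have rel: "basis_relation ?c M a b u v" using x y by (simp add: basis_relation_def M_def)
  have "real_of_int (mdet M) * wedge u v = of_int (mdet M') * wedge u' v'"
    using wedge_basis_relation[OF rel] wedge_basis_relation[OF *(6)] lattice_basis_same_area[OF b0 *(1)] by simp
  then have "real_of_int (mdet M) = of_int (mdet M')"
    using lattice_basis_same_area[OF b1 *(2)] lattice_basis_pos[OF b1] by simp
  then have det: "mdet M = level_index D e" using *(4) by simp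
  have "k dvd content M \<longleftrightarrow> k dvd content M'" for k
    unfolding dvd_content_iff_lattices[OF b0 b1 rel] dvd_content_iff_lattices[OF *(1,2,6)] ..
  then have "coprime (content M) e" using *(5) unfolding coprime_def by blast
  then show thesis using that *(3) det rel by blast
qed

text \<open>\<open>N\<close> is the norm of the generator of \<open>\<O>\<^sub>D\<close>; its existence encodes \<open>D \<equiv> 0, 1 (mod 4)\<close>.\<close>

locale discriminant =
  fixes D N :: int
  assumes D: "\<nexists>k. D = k\<^sup>2" "D > 0" "4 * N = D\<^sup>2 - D"
begin

lemma level_triple_eigenform: "s \<in> level_data D \<Longrightarrow> \<tau> \<in> uhp \<Longrightarrow> level_triple D s \<tau> \<in> eigenform_triples D"
  unfolding level_triple_def by (rule standard_triple_eigenform[OF D real_mult_level_lattice])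

lemma eigenform_triple_periods:
  assumes X: "X \<in> eigenform_triples D" and b0: "lattice_basis (period_lattice (X 0)) a b"
    and b1: "lattice_basis (period_lattice (X 1)) u v"
    and e: "e \<in> admissible D" "mdet M = level_index D e" "coprime (content M) e"
    and rel: "basis_relation (of_real (multiplier D e)) M a b u v"
  shows "W_rel D `` {X} = level_point D (e, row_lattice M) (v / u)" "v / u \<in> uhp" "(e, row_lattice M) \<in> level_data D"
proof -
  note lat = lattices_from_basis_relation[OF b0 b1 multiplier_pos[OF e(1)] rel]
  show \<tau>: "v / u \<in> uhp" by (rule lat(1))
  show s: "(e, row_lattice M) \<in> level_data D" by (rule level_dataI[OF e])
  let ?Y = "level_triple D (e, row_lattice M) (v / u)"
  have Y: "?Y \<in> eigenform_triples D" by (rule level_triple_eigenform[OF s \<tau>])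
  have "triple_iso (scale u ?Y) X"
    unfolding triple_iso_scale_iff_2[OF D Y X lat(2)]
    using lat(3,4) by (simp add: level_triple_def standard_triple_simps level_lattice_def)
  then have "(?Y, X) \<in> W_rel D" using X Y lat(2) by (auto simp: W_rel_def)
  then show "W_rel D `` {X} = level_point D (e, row_lattice M) (v / u)"
    unfolding level_point_def using equiv_class_eq[OF equiv_W_rel[OF D]] by blast
qed

lemma W_eq: "W D = (\<Union>s\<in>level_data D. level_point D s ` uhp)"
proof (intro equalityI subsetI)
  fix w assume "w \<in> W D"
  then obtain X where X: "X \<in> eigenform_triples D" "w = W_rel D `` {X}" by (auto simp: W_def quotient_def)
  have RM: "real_mult_lattices D (period_lattice (X 0)) (period_lattice (X 1))"
    using X(1) unfolding eigenform_triples_iff[OF D] by blast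
  obtain a b where b0: "lattice_basis (period_lattice (X 0)) a b"
    using elliptic_form_simps(4)[OF eigenform_elliptic[OF X(1)], of 0] unfolding is_lattice_def by blast
  obtain u v where b1: "lattice_basis (period_lattice (X 1)) u v"
    using elliptic_form_simps(4)[OF eigenform_elliptic[OF X(1)], of 1] unfolding is_lattice_def by blast
  obtain e M where "e \<in> admissible D" "mdet M = level_index D e" "coprime (content M) e"
    "basis_relation (of_real (multiplier D e)) M a b u v"
    using real_mult_lattices_basis[OF RM b0 b1] .
  from eigenform_triple_periods[OF X(1) b0 b1 this]
  show "w \<in> (\<Union>s\<in>level_data D. level_point D s ` uhp)" unfolding X(2) by blast
next
  fix w assume "w \<in> (\<Union>s\<in>level_data D. level_point D s ` uhp)"
  then show "w \<in> W D"
    using level_triple_eigenform by (auto simp: W_def level_point_def intro!: quotientI)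
qed

lemma level_point_eq_iff:
  assumes s: "s \<in> level_data D" and s': "s' \<in> level_data D" and \<tau>: "\<tau> \<in> uhp" and \<tau>': "\<tau>' \<in> uhp"
  shows "level_point D s \<tau> = level_point D s' \<tau>' \<longleftrightarrow> (\<exists>g\<in>SL2. mob g \<tau> = \<tau>' \<and> level_act g s = s')"
proof -
  note X = level_triple_eigenform[OF s \<tau>] and Y = level_triple_eigenform[OF s' \<tau>']
  have "level_point D s \<tau> = level_point D s' \<tau>' \<longleftrightarrow> (level_triple D s \<tau>, level_triple D s' \<tau>') \<in> W_rel D"
    unfolding level_point_def by (rule eq_equiv_class_iff[OF equiv_W_rel[OF D] X Y])
  also have "\<dots> \<longleftrightarrow> (\<exists>k. k \<noteq> 0 \<and> triple_iso (scale k (level_triple D s \<tau>)) (level_triple D s' \<tau>'))"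
    using X Y by (simp add: W_rel_def)
  also have "\<dots> \<longleftrightarrow> (\<exists>k. k \<noteq> 0 \<and> (\<exists>g\<in>SL2. mob g \<tau> = \<tau>' \<and> level_act g s = s' \<and> k = 1 / (of_int (m21 g) * \<tau> + of_int (m22 g))))"
  proof (rule arg_cong[where f = Ex], rule ext, rule conj_cong[OF refl])
    fix k :: complex assume k: "k \<noteq> 0"
    show "triple_iso (scale k (level_triple D s \<tau>)) (level_triple D s' \<tau>') \<longleftrightarrow>
      (\<exists>g\<in>SL2. mob g \<tau> = \<tau>' \<and> level_act g s = s' \<and> k = 1 / (of_int (m21 g) * \<tau> + of_int (m22 g)))"
      unfolding triple_iso_scale_iff_2[OF D X Y k] level_lattice_scale_iff[OF D(1,2) s s' \<tau> \<tau>' k, symmetric]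
      by (simp add: level_triple_def standard_triple_simps)
  qed
  also have "\<dots> \<longleftrightarrow> (\<exists>g\<in>SL2. mob g \<tau> = \<tau>' \<and> level_act g s = s')"
  proof -
    have "1 / (of_int (m21 g) * \<tau> + of_int (m22 g)) \<noteq> 0" if "g \<in> SL2" for g
      using denominator_nonzero[of "m11 g" "m12 g" "m21 g" "m22 g" \<tau>] that \<tau> by simp
    then show ?thesis by blast
  qed
  finally show ?thesis .
qed

text \<open>The factors \<open>k\<close> for which the multiple by \<open>k\<close> is isomorphic to the triple correspond to the \<open>g\<close> through \<open>k = 1 / (c\<tau> + d)\<close>, and \<open>k\<close> determines
\<open>g\<close>: it gives \<open>c\<close> and \<open>d\<close>, and \<open>a\<tau> + b = \<tau> (c\<tau> + d)\<close> gives \<open>a\<close> and \<open>b\<close>.\<close>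

lemma isotropy_order_level_point:
  assumes s: "s \<in> level_data D" and \<tau>: "\<tau> \<in> uhp"
  shows "isotropy_order (level_point D s \<tau>) = card {g \<in> SL2. mob g \<tau> = \<tau> \<and> level_act g s = s} div 2"
proof -
  let ?X = "level_triple D s \<tau>" and ?G = "{g \<in> SL2. mob g \<tau> = \<tau> \<and> level_act g s = s}"
  let ?k = "\<lambda>g. 1 / (of_int (m21 g) * \<tau> + of_int (m22 g))"
  note X = level_triple_eigenform[OF s \<tau>]
  have nz: "of_int (m21 g) * \<tau> + of_int (m22 g) \<noteq> 0" if "g \<in> SL2" for g
    using denominator_nonzero[of "m11 g" "m12 g" "m21 g" "m22 g" \<tau>] that \<tau> by simp
  \<comment> \<open>The set of such \<open>k\<close> is the same for all representatives of the point.\<close>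
  have indep: "triple_iso (scale k Y) Y \<longleftrightarrow> triple_iso (scale k ?X) ?X"
    if Y: "Y \<in> level_point D s \<tau>" and k: "k \<noteq> 0" for Y k
  proof -
    obtain l where l: "Y \<in> eigenform_triples D" "l \<noteq> 0" "triple_iso (scale l ?X) Y"
      using Y by (auto simp: level_point_def W_rel_def)
    have YX: "period_lattice (Y j) = (\<lambda>z. l * z) ` period_lattice (?X j)" for j
      using l(3) unfolding triple_iso_scale_iff[OF X l(1,2)] by simp
    have "inj (\<lambda>z. l * z)" using l(2) by (auto simp: inj_def)
    then show ?thesis
      unfolding triple_iso_scale_iff[OF l(1) l(1) k] triple_iso_scale_iff[OF X X k] YX
      by (simp add: scale_scale_image mult.commute[of k l]) (simp add: scale_scale_image[symmetric] inj_image_eq_iff)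
  qed
  have self: "?X \<in> level_point D s \<tau>"
    unfolding level_point_def using equiv_class_self[OF equiv_W_rel[OF D] X] .
  have "{k. k \<noteq> 0 \<and> (\<exists>Y\<in>level_point D s \<tau>. triple_iso (scale k Y) Y)} = {k. k \<noteq> 0 \<and> triple_iso (scale k ?X) ?X}"
    using indep self by blast
  also have "\<dots> = ?k ` ?G"
  proof -
    have iff: "triple_iso (scale k ?X) ?X \<longleftrightarrow> (\<exists>g\<in>SL2. mob g \<tau> = \<tau> \<and> level_act g s = s \<and> k = ?k g)" if "k \<noteq> 0" for k
      unfolding triple_iso_scale_iff_2[OF D X X that] level_lattice_scale_iff[OF D(1,2) s s \<tau> \<tau> that, symmetric]
      by (simp add: level_triple_def standard_triple_simps)
    have k0: "?k g \<noteq> 0" if "g \<in> SL2" for g using nz[OF that] by simp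
    show ?thesis
    proof (intro equalityI subsetI)
      fix k assume "k \<in> {k. k \<noteq> 0 \<and> triple_iso (scale k ?X) ?X}"
      then have "k \<noteq> 0" "triple_iso (scale k ?X) ?X" by blast+
      then have "\<exists>g\<in>SL2. mob g \<tau> = \<tau> \<and> level_act g s = s \<and> k = ?k g" by (rule iff[THEN iffD1])
      then obtain g where g: "g \<in> SL2" "mob g \<tau> = \<tau>" "level_act g s = s" "k = ?k g" by (elim bexE conjE)
      then have "g \<in> ?G" by simp
      with g(4) show "k \<in> ?k ` ?G" by (rule image_eqI)
    next
      fix k assume "k \<in> ?k ` ?G"
      then obtain g where kg: "k = ?k g" "g \<in> ?G" by (rule imageE)
      then have g: "g \<in> SL2" "mob g \<tau> = \<tau>" "level_act g s = s" "k = ?k g" by simp_all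
      have "k \<noteq> 0" unfolding g(4) by (rule k0[OF g(1)])
      moreover have "triple_iso (scale k ?X) ?X"
        unfolding iff[OF \<open>k \<noteq> 0\<close>] using g(1) by (intro bexI[of _ g]) (simp_all add: g(2-4))
      ultimately show "k \<in> {k. k \<noteq> 0 \<and> triple_iso (scale k ?X) ?X}" by simp
    qed
  qed
  finally have "isotropy_order (level_point D s \<tau>) = card (?k ` ?G) div 2" by (simp add: isotropy_order_def)
  moreover have "inj_on ?k ?G"
  proof (rule inj_onI)
    fix g h assume gh: "g \<in> ?G" "h \<in> ?G" and eq: "?k g = ?k h"
    obtain a b c d a' b' c' d' where g: "g = Mat a b c d" and h: "h = Mat a' b' c' d'" by (cases g, cases h)
    have W: "wedge 1 \<tau> > 0" using \<tau> by (simp add: wedge_1 uhp_def)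
    have ng: "of_int c * \<tau> + of_int d \<noteq> 0" "of_int c' * \<tau> + of_int d' \<noteq> 0" using nz[of g] nz[of h] gh g h by auto
    have den: "of_int c * \<tau> + of_int d = of_int c' * \<tau> + of_int d'" using eq ng by (simp add: g h)
    then have "of_int d * 1 + of_int c * \<tau> = of_int d' * 1 + of_int c' * \<tau>" by (simp add: add.commute)
    then have cd: "d = d'" "c = c'" by (rule wedge_independent_int[OF W])+
    have "of_int a * \<tau> + of_int b = \<tau> * (of_int c * \<tau> + of_int d)" "of_int a' * \<tau> + of_int b' = \<tau> * (of_int c' * \<tau> + of_int d')"
      using gh ng by (simp_all add: g h nonzero_divide_eq_eq)
    then have "of_int b * 1 + of_int a * \<tau> = of_int b' * 1 + of_int a' * \<tau>" using den by (simp add: add.commute)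
    then have "b = b'" "a = a'" by (rule wedge_independent_int[OF W])+
    then show "g = h" using cd g h by simp
  qed
  ultimately show ?thesis by (simp add: card_image)
qed

end

section \<open>The topology in period coordinates\<close>

definition basis_lattice :: "complex \<Rightarrow> complex \<Rightarrow> complex set" where
  "basis_lattice u v = {of_int m * u + of_int n * v | m n. True}"

lemma lattice_basis_basis_lattice: "wedge u v > 0 \<Longrightarrow> lattice_basis (basis_lattice u v) u v"
  by (simp add: lattice_basis_wedge basis_lattice_def)

lemma continuous_wedge [continuous_intros]:
  "continuous_on S f \<Longrightarrow> continuous_on S g \<Longrightarrow> continuous_on S (\<lambda>x. wedge (f x) (g x))"
  unfolding wedge_def by (intro continuous_intros)

context discriminant
begin

lemma period_space_iff:
  "(a, b, u, v) \<in> period_space D \<longleftrightarrow> wedge a b > 0 \<and> wedge u v > 0 \<and>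
    real_mult_lattices D (basis_lattice a b) (basis_lattice u v)"
proof
  assume "(a, b, u, v) \<in> period_space D"
  then obtain X where X: "X \<in> eigenform_triples D" and per: "(a, b, u, v) \<in> periods X"
    unfolding period_space_def by blast
  from per obtain a' b' u' v' where
    eq: "a = form (X 0) * a'" "b = form (X 0) * b'" "u = form (X 1) * u'" "v = form (X 1) * v'"
    and bases: "lattice_basis (lat (X 0)) a' b'" "lattice_basis (lat (X 1)) u' v'"
    unfolding periods_def by blast
  have nz: "form (X j) \<noteq> 0" for j using elliptic_form_simps(2)[OF eigenform_elliptic[OF X]] .
  have b0: "lattice_basis (period_lattice (X 0)) a b" and b1: "lattice_basis (period_lattice (X 1)) u v"
    unfolding period_lattice_def eq using bases nz by (intro lattice_basis_scale; simp)+
  have "real_mult_lattices D (period_lattice (X 0)) (period_lattice (X 1))"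
    using X unfolding eigenform_triples_iff[OF D] by blast
  moreover have "period_lattice (X 0) = basis_lattice a b" "period_lattice (X 1) = basis_lattice u v"
    using b0 b1 by (simp_all add: lattice_basis_wedge basis_lattice_def)
  ultimately show "wedge a b > 0 \<and> wedge u v > 0 \<and> real_mult_lattices D (basis_lattice a b) (basis_lattice u v)"
    using lattice_basis_pos b0 b1 by simp
next
  assume *: "wedge a b > 0 \<and> wedge u v > 0 \<and> real_mult_lattices D (basis_lattice a b) (basis_lattice u v)"
  let ?X = "standard_triple (basis_lattice a b) (basis_lattice u v)"
  have "?X \<in> eigenform_triples D" using * by (intro standard_triple_eigenform[OF D]) blast
  moreover have "(a, b, u, v) \<in> periods ?X"
    unfolding periods_def standard_triple_simps using * lattice_basis_basis_lattice by fastforce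
  ultimately show "(a, b, u, v) \<in> period_space D" unfolding period_space_def by blast
qed

text \<open>Every triple with the given periods is equivalent to the one attached to \<open>(e, row_lattice M)\<close> and \<open>v/u\<close>; this
resolves the definite description in \<open>W_point\<close>.\<close>

lemma W_point_eq:
  assumes pos: "wedge a b > 0" "wedge u v > 0" and e: "e \<in> admissible D" "mdet M = level_index D e" "coprime (content M) e"
    and rel: "basis_relation (of_real (multiplier D e)) M a b u v"
  shows "(a, b, u, v) \<in> period_space D" "W_point D (a, b, u, v) = level_point D (e, row_lattice M) (v / u)"
    "v / u \<in> uhp" "(e, row_lattice M) \<in> level_data D"
proof -
  note B = lattice_basis_basis_lattice[OF pos(1)] lattice_basis_basis_lattice[OF pos(2)]
  have RM: "real_mult_lattices D (basis_lattice a b) (basis_lattice u v)"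
    unfolding real_mult_lattices_def using B e rel by blast
  then show p: "(a, b, u, v) \<in> period_space D" unfolding period_space_iff using pos by blast
  let ?X = "standard_triple (basis_lattice a b) (basis_lattice u v)"
  have X: "?X \<in> eigenform_triples D" by (rule standard_triple_eigenform[OF D RM])
  have *: "W_rel D `` {Y} = level_point D (e, row_lattice M) (v / u) \<and> v / u \<in> uhp \<and> (e, row_lattice M) \<in> level_data D"
    if Y: "Y \<in> eigenform_triples D" "(a, b, u, v) \<in> periods Y" for Y
  proof -
    obtain a' b' u' v' where eq: "a = form (Y 0) * a'" "b = form (Y 0) * b'" "u = form (Y 1) * u'" "v = form (Y 1) * v'"
      and bases: "lattice_basis (lat (Y 0)) a' b'" "lattice_basis (lat (Y 1)) u' v'"
      using Y(2) unfolding periods_def by blast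
    have nz: "form (Y j) \<noteq> 0" for j using elliptic_form_simps(2)[OF eigenform_elliptic[OF Y(1)]] .
    have "lattice_basis (period_lattice (Y 0)) a b" "lattice_basis (period_lattice (Y 1)) u v"
      unfolding period_lattice_def eq using bases nz by (intro lattice_basis_scale; simp)+
    from eigenform_triple_periods[OF Y(1) this e rel] show ?thesis by blast
  qed
  have perX: "(a, b, u, v) \<in> periods ?X"
    unfolding periods_def standard_triple_simps using B by fastforce
  show "v / u \<in> uhp" "(e, row_lattice M) \<in> level_data D" using *[OF X perX] by blast+
  show "W_point D (a, b, u, v) = level_point D (e, row_lattice M) (v / u)"
    unfolding W_point_def
  proof (rule the_equality)
    have "?X \<in> W_rel D `` {?X}" by (rule equiv_class_self[OF equiv_W_rel[OF D] X])
    moreover have "W_rel D `` {?X} \<in> W D" unfolding W_def by (rule quotientI[OF X])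
    ultimately show "level_point D (e, row_lattice M) (v / u) \<in> W D \<and>
        (\<exists>X\<in>level_point D (e, row_lattice M) (v / u). (a, b, u, v) \<in> periods X)"
      using *[OF X perX] perX by auto
  next
    fix w assume "w \<in> W D \<and> (\<exists>X\<in>w. (a, b, u, v) \<in> periods X)"
    then obtain Y where Y: "w \<in> W D" "Y \<in> w" "(a, b, u, v) \<in> periods Y" by blast
    obtain Z where Z: "Z \<in> eigenform_triples D" "w = W_rel D `` {Z}" using Y(1) by (auto simp: W_def quotient_def)
    then have "(Z, Y) \<in> W_rel D" using Y(2) by simp
    then have "w = W_rel D `` {Y}" "Y \<in> eigenform_triples D"
      using equiv_class_eq[OF equiv_W_rel[OF D]] Z(2) by (auto simp: W_rel_def)
    then show "w = level_point D (e, row_lattice M) (v / u)" using *[OF _ Y(3)] by simp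
  qed
qed

lemma period_space_obtain:
  assumes "(a, b, u, v) \<in> period_space D"
  obtains e M where "e \<in> admissible D" "mdet M = level_index D e" "coprime (content M) e"
    "basis_relation (of_real (multiplier D e)) M a b u v" "wedge a b > 0" "wedge u v > 0"
proof -
  have *: "wedge a b > 0" "wedge u v > 0" "real_mult_lattices D (basis_lattice a b) (basis_lattice u v)"
    using assms unfolding period_space_iff by blast+
  then show thesis
    using real_mult_lattices_basis[OF *(3) lattice_basis_basis_lattice[OF *(1)] lattice_basis_basis_lattice[OF *(2)]] that
    by metis
qed

definition period_domain :: "(complex \<times> complex \<times> complex \<times> complex) set" where
  "period_domain = {(a, b, u, v). wedge u v > 0}"

lemma open_period_domain: "open period_domain"
proof -
  have "period_domain = {p. 0 < wedge (fst (snd (snd p))) (snd (snd (snd p)))}"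
    by (auto simp: period_domain_def)
  moreover have "open {p :: complex \<times> complex \<times> complex \<times> complex. 0 < wedge (fst (snd (snd p))) (snd (snd (snd p)))}"
    by (intro open_Collect_less continuous_intros)
  ultimately show ?thesis by simp
qed

text \<open>The coordinates of \<open>x\<close> with respect to the basis \<open>u, v\<close>.\<close>

definition coord1 :: "complex \<Rightarrow> complex \<Rightarrow> complex \<Rightarrow> real" where "coord1 x u v = wedge x v / wedge u v"
definition coord2 :: "complex \<Rightarrow> complex \<Rightarrow> complex \<Rightarrow> real" where "coord2 x u v = wedge u x / wedge u v"

lemma coords_int:
  assumes "wedge u v > 0" "x = of_int m * u + of_int n * v"
  shows "coord1 x u v = of_int m" "coord2 x u v = of_int n"
  using assms by (simp_all add: coord1_def coord2_def)

lemma coords_mem: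
  assumes "wedge u v > 0" "coord1 x u v \<in> \<int>" "coord2 x u v \<in> \<int>"
  shows "x \<in> basis_lattice u v"
proof -
  obtain m n where "coord1 x u v = of_int m" "coord2 x u v = of_int n" using assms by (auto elim!: Ints_cases)
  moreover have "x = of_real (coord1 x u v) * u + of_real (coord2 x u v) * v"
    unfolding coord1_def coord2_def by (rule wedge_coordinates[OF assms(1)])
  ultimately have "x = of_int m * u + of_int n * v" by simp
  then show ?thesis unfolding basis_lattice_def by blast
qed

lemma continuous_period_coords:
  "continuous_on period_domain (\<lambda>(a, b, u, v). coord1 (c * a) u v)" "continuous_on period_domain (\<lambda>(a, b, u, v). coord2 (c * a) u v)"
  "continuous_on period_domain (\<lambda>(a, b, u, v). coord1 (c * b) u v)" "continuous_on period_domain (\<lambda>(a, b, u, v). coord2 (c * b) u v)"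
  "continuous_on period_domain (\<lambda>(a, b, u, v). v / u)"
proof -
  have nz: "wedge (fst (snd (snd p))) (snd (snd (snd p))) \<noteq> 0" "fst (snd (snd p)) \<noteq> 0" if "p \<in> period_domain" for p
    using that by (auto simp: period_domain_def)
  show "continuous_on period_domain (\<lambda>(a, b, u, v). coord1 (c * a) u v)" "continuous_on period_domain (\<lambda>(a, b, u, v). coord2 (c * a) u v)"
    "continuous_on period_domain (\<lambda>(a, b, u, v). coord1 (c * b) u v)" "continuous_on period_domain (\<lambda>(a, b, u, v). coord2 (c * b) u v)"
    "continuous_on period_domain (\<lambda>(a, b, u, v). v / u)"
    unfolding case_prod_unfold coord1_def coord2_def using nz by (auto intro!: continuous_intros)
qed

lemma open_period_vimage:
  fixes f :: "complex \<times> complex \<times> complex \<times> complex \<Rightarrow> 'a :: topological_space"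
  assumes "continuous_on period_domain f" "open V"
  shows "open {p \<in> period_domain. f p \<in> V}"
proof -
  have "{p \<in> period_domain. f p \<in> V} = period_domain \<inter> f -` V" by auto
  then show ?thesis using continuous_open_preimage[OF assms(1) open_period_domain assms(2)] by simp
qed

lemma open_not_Ints: "open {p \<in> period_domain. \<not> (f p \<in> \<int> \<and> g p \<in> \<int>)}"
  if "continuous_on period_domain f" "continuous_on period_domain g"
  for f g :: "complex \<times> complex \<times> complex \<times> complex \<Rightarrow> real"
proof -
  have op: "open (- \<int> :: real set)" using closed_Ints by blast
  have "{p \<in> period_domain. \<not> (f p \<in> \<int> \<and> g p \<in> \<int>)} = {p \<in> period_domain. f p \<in> - \<int>} \<union> {p \<in> period_domain. g p \<in> - \<int>}"
    by auto
  then show ?thesis using open_period_vimage[OF that(1) op] open_period_vimage[OF that(2) op] by auto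
qed

text \<open>On period space, \<open>e\<close> and \<open>M\<close> are locally constant: the entries of \<open>M\<close> are the coordinates of \<open>c a\<close> and \<open>c b\<close> in
the basis \<open>u, v\<close>, which are continuous and integral, and the finitely many other values of \<open>e\<close> are excluded
nearby because the multiple of \<open>a\<close> by their multiplier is not in the lattice, which is an open condition. On such a neighbourhood the
point of \<open>W\<^sub>D(0\<^sup>3)\<close> depends on the periods only through \<open>v/u\<close>. In the other direction
\<open>\<tau> \<mapsto> (a, b, 1, \<tau>)\<close> is a continuous section.\<close>

lemma openin_W_top_iff:
  "openin (W_top D) U \<longleftrightarrow> U \<subseteq> (\<Union>s\<in>level_data D. level_point D s ` uhp) \<and>
     (\<forall>s\<in>level_data D. open {\<tau> \<in> uhp. level_point D s \<tau> \<in> U})"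
proof -
  have "openin (top_of_set (period_space D)) {p \<in> period_space D. W_point D p \<in> U} \<longleftrightarrow>
     (\<forall>s\<in>level_data D. open {\<tau> \<in> uhp. level_point D s \<tau> \<in> U})" (is "?L \<longleftrightarrow> ?R")
  proof
    assume L: ?L
    show ?R
    proof
      fix s assume s: "s \<in> level_data D"
      obtain e M where e: "s = (e, row_lattice M)" "e \<in> admissible D" "mdet M = level_index D e" "coprime (content M) e"
        "mdet M > 0" "multiplier D e > 0" using level_dataE[OF s] .
      define c where "c = complex_of_real (multiplier D e)"
      have c0: "c \<noteq> 0" using e(6) by (simp add: c_def)
      \<comment> \<open>The section through the periods of \<open>level_triple D s \<tau>\<close>.\<close>
      define \<sigma> where "\<sigma> = (\<lambda>\<tau>. ((of_int (m11 M) + of_int (m12 M) * \<tau>) / c, (of_int (m21 M) + of_int (m22 M) * \<tau>) / c, 1 :: complex, \<tau>))"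
      have \<sigma>: "\<sigma> \<tau> \<in> period_space D \<and> W_point D (\<sigma> \<tau>) = level_point D s \<tau>" if \<tau>: "\<tau> \<in> uhp" for \<tau>
      proof -
        note sb = sub_lattice_basis[OF \<tau> e(5,6)]
        have "wedge 1 \<tau> > 0" using \<tau> by (simp add: wedge_1 uhp_def)
        from W_point_eq[OF lattice_basis_pos[OF sb(1)] this e(2-4) sb(2)]
        show ?thesis by (simp add: \<sigma>_def e(1) c_def)
      qed
      have "continuous_on uhp \<sigma>" unfolding \<sigma>_def using c0 by (intro continuous_intros) auto
      moreover have "\<sigma> ` uhp \<subseteq> period_space D" using \<sigma> by blast
      ultimately have "openin (top_of_set uhp) (uhp \<inter> \<sigma> -` {p \<in> period_space D. W_point D p \<in> U})"
        using L by (intro continuous_openin_preimage) auto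
      moreover have "uhp \<inter> \<sigma> -` {p \<in> period_space D. W_point D p \<in> U} = {\<tau> \<in> uhp. level_point D s \<tau> \<in> U}"
        using \<sigma> by auto
      ultimately show "open {\<tau> \<in> uhp. level_point D s \<tau> \<in> U}" using openin_open_eq[OF open_uhp] by auto
    qed
  next
    assume R: ?R
    show ?L
    proof (subst openin_subopen, intro ballI)
      fix p assume p: "p \<in> {p \<in> period_space D. W_point D p \<in> U}"
      obtain a b u v where p_eq: "p = (a, b, u, v)" by (cases p)
      have pP: "(a, b, u, v) \<in> period_space D" and pU: "W_point D (a, b, u, v) \<in> U" using p p_eq by auto
      obtain e M where e: "e \<in> admissible D" "mdet M = level_index D e" "coprime (content M) e"
        and rel: "basis_relation (of_real (multiplier D e)) M a b u v" and pos: "wedge a b > 0" "wedge u v > 0"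
        using period_space_obtain[OF pP] .
      note Wp = W_point_eq[OF pos e rel]
      let ?c = "\<lambda>e. complex_of_real (multiplier D e)"
      let ?V = "{\<tau> \<in> uhp. level_point D (e, row_lattice M) \<tau> \<in> U}"
      \<comment> \<open>On \<open>A\<close> integral coordinates must be the entries of \<open>M\<close>; a period in one of the sets \<open>B\<close> is not carried into the second lattice by the multiplier of that parameter.\<close>
      define O1 where "O1 = (\<lambda>i f. {p \<in> period_domain. f p \<in> {real_of_int i - 1 / 2 <..< of_int i + 1 / 2}})"
      define A where "A = O1 (m11 M) (\<lambda>(a, b, u, v). coord1 (?c e * a) u v) \<inter> O1 (m12 M) (\<lambda>(a, b, u, v). coord2 (?c e * a) u v)
        \<inter> O1 (m21 M) (\<lambda>(a, b, u, v). coord1 (?c e * b) u v) \<inter> O1 (m22 M) (\<lambda>(a, b, u, v). coord2 (?c e * b) u v)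
        \<inter> {p \<in> period_domain. (\<lambda>(a, b, u, v). v / u) p \<in> ?V}"
      define B where "B = (\<lambda>e'. {p \<in> period_domain. \<not> ((\<lambda>(a, b, u, v). coord1 (?c e' * a) u v) p \<in> \<int> \<and>
        (\<lambda>(a, b, u, v). coord2 (?c e' * a) u v) p \<in> \<int>)})"
      define Nb where "Nb = A \<inter> (\<Inter>e'\<in>admissible D - {e}. B e')"
      have "open ?V" using R Wp(4) by blast
      then have "open A" unfolding A_def O1_def
        by (intro open_Int open_period_vimage continuous_period_coords) auto
      moreover have "open (B e')" for e' unfolding B_def by (intro open_not_Ints continuous_period_coords)
      ultimately have openN: "open Nb" unfolding Nb_def using finite_admissible by (intro open_Int open_INT) auto
      have rels: "?c e * a = of_int (m11 M) * u + of_int (m12 M) * v" "?c e * b = of_int (m21 M) * u + of_int (m22 M) * v"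
        using rel by (simp_all add: basis_relation_def)
      have pdom: "(a, b, u, v) \<in> period_domain" using pos by (simp add: period_domain_def)
      have "(a, b, u, v) \<in> A"
        unfolding A_def O1_def using pdom coords_int[OF pos(2) rels(1)] coords_int[OF pos(2) rels(2)] Wp(2,3) pU by simp
      moreover have "(a, b, u, v) \<in> B e'" if e': "e' \<in> admissible D - {e}" for e'
      proof -
        have "\<not> (coord1 (?c e' * a) u v \<in> \<int> \<and> coord2 (?c e' * a) u v \<in> \<int>)"
        proof
          assume "coord1 (?c e' * a) u v \<in> \<int> \<and> coord2 (?c e' * a) u v \<in> \<int>"
          then have 1: "?c e' * a \<in> basis_lattice u v" using coords_mem[OF pos(2)] by blast
          have 2: "?c e * a \<in> basis_lattice u v" unfolding rels basis_lattice_def by blast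
          have L: "is_lattice (basis_lattice u v)" using lattice_basis_basis_lattice[OF pos(2)] by (auto simp: is_lattice_def)
          have "a \<noteq> 0" using pos by auto
          then have "e' = e" using e' e(1) 1 2 by (intro multiplier_unique[OF D(1,2) L]) auto
          then show False using e' by simp
        qed
        then show ?thesis using pdom by (simp add: B_def)
      qed
      ultimately have pN: "p \<in> Nb" unfolding Nb_def p_eq by blast
      have sub: "period_space D \<inter> Nb \<subseteq> {p \<in> period_space D. W_point D p \<in> U}"
      proof
        fix q assume q: "q \<in> period_space D \<inter> Nb"
        obtain a' b' u' v' where q_eq: "q = (a', b', u', v')" by (cases q)
        have qP: "(a', b', u', v') \<in> period_space D" using q q_eq by simp
        obtain e' M' where e': "e' \<in> admissible D" "mdet M' = level_index D e'" "coprime (content M') e'"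
          and rel': "basis_relation (of_real (multiplier D e')) M' a' b' u' v'" and pos': "wedge a' b' > 0" "wedge u' v' > 0"
          using period_space_obtain[OF qP] .
        have rels': "?c e' * a' = of_int (m11 M') * u' + of_int (m12 M') * v'" "?c e' * b' = of_int (m21 M') * u' + of_int (m22 M') * v'"
          using rel' by (simp_all add: basis_relation_def)
        note cs = coords_int[OF pos'(2) rels'(1)] coords_int[OF pos'(2) rels'(2)]
        have "q \<notin> B e'" unfolding B_def q_eq using cs by simp
        then have ee: "e' = e" using q e'(1) unfolding Nb_def by blast
        have qA: "(a', b', u', v') \<in> A" using q q_eq by (simp add: Nb_def)
        have "M' = M"
        proof -
          have near: "i = j" if "real_of_int i - 1 / 2 < of_int j" "real_of_int j < of_int i + 1 / 2" for i j using that by linarith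
          have "m11 M = m11 M'" "m12 M = m12 M'" "m21 M = m21 M'" "m22 M = m22 M'"
            using qA cs unfolding A_def O1_def ee by (auto intro!: near)
          then show ?thesis by (cases M; cases M') simp
        qed
        have "v' / u' \<in> ?V" using qA unfolding A_def by simp
        then have "W_point D (a', b', u', v') \<in> U"
          using W_point_eq(2)[OF pos' e' rel'] by (simp add: ee \<open>M' = M\<close>)
        then show "q \<in> {p \<in> period_space D. W_point D p \<in> U}" using qP q_eq by simp
      qed
      show "\<exists>T. openin (top_of_set (period_space D)) T \<and> p \<in> T \<and> T \<subseteq> {p \<in> period_space D. W_point D p \<in> U}"
        using openN sub pN p by (intro exI[of _ "period_space D \<inter> Nb"]) (auto simp: openin_open)
    qed
  qed
  then show ?thesis unfolding openin_W_top W_eq by blast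
qed

section \<open>The Euler characteristic\<close>

text \<open>The level data with the projections \<open>level_point D s\<close> satisfy the hypotheses on a finite cover of the
modular curve.\<close>

theorem euler_char_W:
  "has_orbifold_euler_char (W_top D) isotropy_order (- 1 / 6 * (\<Sum>e\<in>admissible D. m_fun D e))"
proof -
  interpret modular_quotient "level_data D" level_act "level_point D" "W_top D" isotropy_order
  proof unfold_locales
    show "finite (level_data D)" by (rule finite_level_data)
    show "level_act g s \<in> level_data D" if "g \<in> SL2" "s \<in> level_data D" for g s using level_act_closed that by blast
    show "level_act (mmul g h) s = level_act g (level_act h s)" for g h s by (rule level_act_mmul)
    show "level_act (Mat 1 0 0 1) s = s" for s by (rule level_act_one)
    show "level_act (Mat (-1) 0 0 (-1)) s = s" if "s \<in> level_data D" for s using level_act_minus_one that by blast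
  qed (rule openin_W_top_iff level_point_eq_iff isotropy_order_level_point; assumption?)+
  have "- real (card (level_data D)) / 6 = - 1 / 6 * (\<Sum>e\<in>admissible D. m_fun D e)"
    unfolding card_level_data by simp
  then show ?thesis using orbifold_euler_char by simp
qed

end

theorem proposition12p3:
  fixes D :: int
  assumes "D > 9"
    and "[D = 0] (mod 8) \<or> [D = 1] (mod 8) \<or> [D = 4] (mod 8)"
    and "\<nexists>k. D = k\<^sup>2"
  shows "has_orbifold_euler_char (W_top D) isotropy_order
    (- 1 / 6 * (\<Sum>e | - sqrt (of_int D) < of_int e \<and> of_int e < sqrt (of_int D) \<and> [e\<^sup>2 = D] (mod 8).
       m_fun D e))"
proof -
  have "4 dvd D * (D - 1)"
  proof -
    have "D mod 8 = 0 \<or> D mod 8 = 1 \<or> D mod 8 = 4" using assms(2) by (simp add: cong_def)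
    then have "4 dvd D \<or> 4 dvd D - 1" by presburger
    then show ?thesis by auto
  qed
  then obtain N where N: "4 * N = D\<^sup>2 - D" by (auto simp: power2_eq_square algebra_simps elim!: dvdE)
  interpret discriminant D N using assms N by unfold_locales auto
  have "{e. - sqrt (of_int D) < of_int e \<and> of_int e < sqrt (of_int D) \<and> [e\<^sup>2 = D] (mod 8)} = admissible D"
  proof -
    have "- sqrt (of_int D) < of_int e \<and> of_int e < sqrt (of_int D) \<longleftrightarrow> e\<^sup>2 < D" for e
    proof -
      have "- sqrt (of_int D) < of_int e \<and> of_int e < sqrt (of_int D) \<longleftrightarrow> \<bar>real_of_int e\<bar> < sqrt (of_int D)" by linarith
      also have "\<dots> \<longleftrightarrow> sqrt ((real_of_int e)\<^sup>2) < sqrt (of_int D)" by simp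
      also have "\<dots> \<longleftrightarrow> real_of_int (e\<^sup>2) < of_int D" unfolding real_sqrt_less_iff by simp
      finally show ?thesis by (simp only: of_int_less_iff)
    qed
    moreover have "[e\<^sup>2 = D] (mod 8) \<longleftrightarrow> 8 dvd D - e\<^sup>2" for e
      by (simp add: cong_iff_dvd_diff dvd_diff_commute)
    ultimately show ?thesis by (simp add: admissible_def conj_assoc[symmetric])
  qed
  then show ?thesis using euler_char_W by simp
qed

end
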